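(* Let $\mathcal{T}$ be a bimonad on a monoidal category $(\mathsf{C},\cdot,I)$, let $\mathsf{M}$ be a (left) $\mathsf{C}$-module-category, and let $\mathcal{S}$ be a $\mathcal{T}$-comodule-monad on $\mathsf{M}$. Let $C$ be a comonoid in $\mathsf{C}$ and let $Z=\mathcal{T}(C)$ be the free $\mathcal{T}$-algebra-comonoid on $C$. Assume: (a) the category $\mathsf{M}$ has equalizers of all coreflexive pairs which are $\mathcal{S}$-split in $\mathsf{M}^{\mathcal{S}}$; (b) the functors $\hat{C}$, $\hat{C}^2$ and $\mathcal{S}$ preserve such equalizers; (c) the functor $\mathcal{S}$ is conservative. Then the functors $\mathcal{A}:\mathsf{M}_{\hat{C}}\to\mathsf{Hopf}(\mathcal{T};\mathcal{S},Z)$ and $\mathcal{B}:\mathsf{Hopf}(\mathcal{T};\mathcal{S},Z)\to\mathsf{M}_{\hat{C}}$ form an adjoint equivalence $$\mathsf{M}_{\hat{C}}\cong\mathsf{Hopf}(\mathcal{T};\mathcal{S},Z)$$ if and only if the Galois map $$\mathbb{G}_{C,M}:\mathcal{S}(C\cdot\mathcal{S}(M))\to\mathcal{T}(C)\cdot\mathcal{S}(M)=Z\cdot\mathcal{S}(M)$$ is invertible for all objects $M$ in $\mathsf{M}$.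
   Context: Both the tensor product of $\mathsf{C}$ and its action on $\mathsf{M}$ are written $\cdot$; associativity and unit constraints are suppressed. Bimonad: a monad $(\mathcal{T},\mu,\iota)$ on $\mathsf{C}$ whose functor is comonoidal (= colax monoidal), with structure $\psi_{X,Y}:\mathcal{T}(X\cdot Y)\to\mathcal{T}(X)\cdot\mathcal{T}(Y)$, $\psi_0:\mathcal{T}(I)\to I$, and such that $\mu,\iota$ are morphisms of comonoidal functors. $\mathcal{T}$-comodule-monad: a monad $(\mathcal{S},\mu,\iota)$ on $\mathsf{M}$ with a natural transformation $\chi_{X,M}:\mathcal{S}(X\cdot M)\to\mathcal{T}(X)\cdot\mathcal{S}(M)$ such that $(\mathrm{id}\cdot\chi_{Y,M})\chi_{X,Y\cdot M}=(\psi_{X,Y}\cdot\mathrm{id})\chi_{X\cdot Y,M}$; $(\psi_0\cdot\mathrm{id})\chi_{I,M}=\mathrm{id}$; $\chi_{X,M}\,\mu_{X\cdot M}=(\mu_X\cdot\mu_M)\,\chi_{\mathcal{T}(X),\mathcal{S}(M)}\,\mathcal{S}(\chi_{X,M})$; $\chi_{X,M}\,\iota_{X\cdot M}=\iota_X\cdot\iota_M$. For a comonoid $(C,\Delta,\epsilon)$ in $\mathsf{C}$, $\hat{C}$ is the comonad $\hat C(M)=C\cdot M$ on $\mathsf{M}$, and $\mathsf{M}_{\hat{C}}$ is the category of left $C$-comodules in $\mathsf{M}$. The object $Z=\mathcal{T}(C)$ is a comonoid in $\mathsf{C}$ with comultiplication $\psi_{C,C}\mathcal{T}(\Delta)$ and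 counit $\psi_0\mathcal{T}(\epsilon)$, and a $\mathcal{T}$-algebra with action $\alpha=\mu_C:\mathcal{T}(Z)\to Z$. A Hopf $(\mathcal{T};\mathcal{S},Z)$-module $(M,\sigma,\zeta)$ is an object $M$ of $\mathsf{M}$ with an $\mathcal{S}$-algebra structure $\sigma:\mathcal{S}(M)\to M$ and a left $Z$-comodule structure $\zeta:M\to Z\cdot M$ such that $\zeta\sigma=(\alpha\cdot\sigma)\,\chi_{Z,M}\,\mathcal{S}(\zeta)$. Morphisms are arrows in $\mathsf{M}$ which are morphisms of $\mathcal{S}$-algebras and of $Z$-comodules; the category is $\mathsf{Hopf}(\mathcal{T};\mathcal{S},Z)$. Functor $\mathcal{A}$: $\mathcal{A}(M,c)=(\mathcal{S}(M),\mu_M,d)$ with $d=\chi_{C,M}\circ\mathcal{S}(c):\mathcal{S}(M)\to\mathcal{S}(C\cdot M)\to\mathcal{T}(C)\cdot\mathcal{S}(M)$. Functor $\mathcal{B}$: $\mathcal{B}(M,\sigma,\zeta)$ is the equalizer in $\mathsf{M}_{\hat{C}}$ of the pair $$C\cdot M\xrightarrow{\Delta\cdot\mathrm{id}}C\cdot C\cdot M\xrightarrow{\mathrm{id}\cdot\iota_C\cdot\mathrm{id}}C\cdot\mathcal{T}(C)\cdot M=C\cdot Z\cdot M\quad\text{and}\quad C\cdot M\xrightarrow{\mathrm{id}\cdot\zeta}C\cdot Z\cdot M$$ (of cofree $C$-comodules); $\mathcal{B}$ is defined when these equalizers exist, and the assertion that $\mathcal{A},\mathcal{B}$ form an adjoint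 equivalence includes this existence. The adjunction $\mathcal{A}\dashv\mathcal{B}$ has unit at $(M,c)$ the map $M\to\mathcal{B}\mathcal{A}(M,c)$ induced by $(\mathrm{id}\cdot\iota_M)c:M\to C\cdot\mathcal{S}(M)$, and counit at $(M,\sigma,\zeta)$ the composite $\mathcal{S}(\mathcal{B}(M,\sigma,\zeta))\to\mathcal{S}(C\cdot M)\xrightarrow{\mathcal{S}(\epsilon\cdot\mathrm{id})}\mathcal{S}(M)\xrightarrow{\sigma}M$. The Galois map is $\mathbb{G}_{X,M}=(\mathrm{id}_{\mathcal{T}(X)}\cdot\mu_M)\circ\chi_{X,\mathcal{S}(M)}:\mathcal{S}(X\cdot\mathcal{S}(M))\to\mathcal{T}(X)\cdot\mathcal{S}(M)$. $\mathsf{M}^{\mathcal{S}}$ is the category of $\mathcal{S}$-algebras and $\mathcal{F}^{\mathcal{S}}:\mathsf{M}\to\mathsf{M}^{\mathcal{S}}$, $M\mapsto(\mathcal{S}(M),\mu_M)$, the free algebra functor. A parallel pair $f,g:X\rightrightarrows Y$ is coreflexive if there is $r:Y\to X$ with $rf=\mathrm{id}=rg$. A split cofork is a diagram $E\xrightarrow{e}X\rightrightarrows Y$ (parallel arrows $f,g$) with $fe=ge$ for which there are $p:X\to E$, $q:Y\to X$ with $pe=\mathrm{id}$, $qf=\mathrm{id}$, $ep=qg$. A pair in $\mathsf{M}$ is $\mathcal{S}$-split in $\mathsf{M}^{\mathcal{S}}$ if its image under $\mathcal{F}^{\mathcal{S}}$ is part of a split cofork in $\mathsf{M}^{\mathcal{S}}$.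 A functor is conservative if it reflects isomorphisms. *)

theory Defs
  imports Main
begin

section \<open>Categories, functors, natural transformations\<close>

text \<open>
  A category consists of a set of objects and a set of arrows inside two types; the operations
  are total functions whose values are constrained only on objects and on composable arrows.
  \<open>g \<cdot> f\<close> is the composite "first f, then g".
\<close>

record ('o, 'a) cat =
  Obj :: "'o set"
  Arr :: "'a set"
  Dom :: "'a \<Rightarrow> 'o"
  Cod :: "'a \<Rightarrow> 'o"
  Ident :: "'o \<Rightarrow> 'a"
  Comp :: "'a \<Rightarrow> 'a \<Rightarrow> 'a"  (infixr "\<cdot>\<index>" 55)

definition Hom :: "('o, 'a, 'z) cat_scheme \<Rightarrow> 'o \<Rightarrow> 'o \<Rightarrow> 'a set" where
  "Hom \<A> X Y = {f \<in> Arr \<A>. Dom \<A> f = X \<and> Cod \<A> f = Y}"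

locale category =
  fixes \<A> :: "('o, 'a, 'z) cat_scheme" (structure)
  assumes Dom_Obj: "f \<in> Arr \<A> \<Longrightarrow> Dom \<A> f \<in> Obj \<A>"
    and Cod_Obj: "f \<in> Arr \<A> \<Longrightarrow> Cod \<A> f \<in> Obj \<A>"
    and Ident_Hom: "X \<in> Obj \<A> \<Longrightarrow> Ident \<A> X \<in> Hom \<A> X X"
    and Comp_Hom: "f \<in> Hom \<A> X Y \<Longrightarrow> g \<in> Hom \<A> Y Z \<Longrightarrow> g \<cdot> f \<in> Hom \<A> X Z"
    and Comp_Ident_left: "f \<in> Hom \<A> X Y \<Longrightarrow> Ident \<A> Y \<cdot> f = f"
    and Comp_Ident_right: "f \<in> Hom \<A> X Y \<Longrightarrow> f \<cdot> Ident \<A> X = f"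
    and Comp_assoc: "f \<in> Hom \<A> W X \<Longrightarrow> g \<in> Hom \<A> X Y \<Longrightarrow> h \<in> Hom \<A> Y Z \<Longrightarrow>
      (h \<cdot> g) \<cdot> f = h \<cdot> (g \<cdot> f)"

definition is_iso :: "('o, 'a, 'z) cat_scheme \<Rightarrow> 'a \<Rightarrow> bool" where
  "is_iso \<A> f \<longleftrightarrow> f \<in> Arr \<A> \<and>
    (\<exists>g \<in> Hom \<A> (Cod \<A> f) (Dom \<A> f).
      g \<cdot>\<^bsub>\<A>\<^esub> f = Ident \<A> (Dom \<A> f) \<and> f \<cdot>\<^bsub>\<A>\<^esub> g = Ident \<A> (Cod \<A> f))"

record ('o, 'a, 'p, 'b) func =
  Fo :: "'o \<Rightarrow> 'p"
  Fa :: "'a \<Rightarrow> 'b"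

locale cat_functor = A: category \<A> + B: category \<B>
  for \<A> :: "('o, 'a, 'y) cat_scheme" and \<B> :: "('p, 'b, 'z) cat_scheme" +
  fixes F :: "('o, 'a, 'p, 'b, 'w) func_scheme"
  assumes Fo_Obj: "X \<in> Obj \<A> \<Longrightarrow> Fo F X \<in> Obj \<B>"
    and Fa_Hom: "f \<in> Hom \<A> X Y \<Longrightarrow> Fa F f \<in> Hom \<B> (Fo F X) (Fo F Y)"
    and Fa_Ident: "X \<in> Obj \<A> \<Longrightarrow> Fa F (Ident \<A> X) = Ident \<B> (Fo F X)"
    and Fa_Comp: "f \<in> Hom \<A> X Y \<Longrightarrow> g \<in> Hom \<A> Y Z \<Longrightarrow>
      Fa F (g \<cdot>\<^bsub>\<A>\<^esub> f) = Fa F g \<cdot>\<^bsub>\<B>\<^esub> Fa F f"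

definition id_func :: "('o, 'a, 'o, 'a) func" where
  "id_func = \<lparr>Fo = (\<lambda>X. X), Fa = (\<lambda>f. f)\<rparr>"

definition comp_func ::
  "('p, 'b, 'q, 'c, 'y) func_scheme \<Rightarrow> ('o, 'a, 'p, 'b, 'z) func_scheme \<Rightarrow> ('o, 'a, 'q, 'c) func" where
  "comp_func G F = \<lparr>Fo = (\<lambda>X. Fo G (Fo F X)), Fa = (\<lambda>f. Fa G (Fa F f))\<rparr>"

definition natural_transformation ::
  "('o, 'a, 'x) cat_scheme \<Rightarrow> ('p, 'b, 'y) cat_scheme \<Rightarrow>
   ('o, 'a, 'p, 'b, 'v) func_scheme \<Rightarrow> ('o, 'a, 'p, 'b, 'w) func_scheme \<Rightarrow> ('o \<Rightarrow> 'b) \<Rightarrow> bool" where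
  "natural_transformation \<A> \<B> F G t \<longleftrightarrow>
    (\<forall>X \<in> Obj \<A>. t X \<in> Hom \<B> (Fo F X) (Fo G X)) \<and>
    (\<forall>f \<in> Arr \<A>. Fa G f \<cdot>\<^bsub>\<B>\<^esub> t (Dom \<A> f) = t (Cod \<A> f) \<cdot>\<^bsub>\<B>\<^esub> Fa F f)"

text \<open>
  \<open>F\<close> is left adjoint to \<open>G\<close> with unit \<open>\<eta>\<close> and counit \<open>\<epsilon>\<close>, and \<open>\<eta>\<close>, \<open>\<epsilon>\<close> are invertible.
\<close>

definition adjoint_equivalence ::
  "('o, 'a, 'x) cat_scheme \<Rightarrow> ('p, 'b, 'y) cat_scheme \<Rightarrow>
   ('o, 'a, 'p, 'b, 'v) func_scheme \<Rightarrow> ('p, 'b, 'o, 'a, 'w) func_scheme \<Rightarrow>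
   ('o \<Rightarrow> 'a) \<Rightarrow> ('p \<Rightarrow> 'b) \<Rightarrow> bool" where
  "adjoint_equivalence \<A> \<B> F G \<eta> \<epsilon> \<longleftrightarrow>
    cat_functor \<A> \<B> F \<and> cat_functor \<B> \<A> G \<and>
    natural_transformation \<A> \<A> id_func (comp_func G F) \<eta> \<and>
    natural_transformation \<B> \<B> (comp_func F G) id_func \<epsilon> \<and>
    (\<forall>X \<in> Obj \<A>. \<epsilon> (Fo F X) \<cdot>\<^bsub>\<B>\<^esub> Fa F (\<eta> X) = Ident \<B> (Fo F X)) \<and>
    (\<forall>Y \<in> Obj \<B>. Fa G (\<epsilon> Y) \<cdot>\<^bsub>\<A>\<^esub> \<eta> (Fo G Y) = Ident \<A> (Fo G Y)) \<and>
    (\<forall>X \<in> Obj \<A>. is_iso \<A> (\<eta> X)) \<and>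
    (\<forall>Y \<in> Obj \<B>. is_iso \<B> (\<epsilon> Y))"

definition conservative ::
  "('o, 'a, 'x) cat_scheme \<Rightarrow> ('p, 'b, 'y) cat_scheme \<Rightarrow> ('o, 'a, 'p, 'b, 'w) func_scheme \<Rightarrow> bool" where
  "conservative \<A> \<B> F \<longleftrightarrow> (\<forall>f \<in> Arr \<A>. is_iso \<B> (Fa F f) \<longrightarrow> is_iso \<A> f)"


section \<open>Parallel pairs, equalizers, split coforks\<close>

definition parallel_pair :: "('o, 'a, 'z) cat_scheme \<Rightarrow> 'a \<Rightarrow> 'a \<Rightarrow> bool" where
  "parallel_pair \<A> f g \<longleftrightarrow>
    f \<in> Arr \<A> \<and> g \<in> Arr \<A> \<and> Dom \<A> f = Dom \<A> g \<and> Cod \<A> f = Cod \<A> g"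

definition coreflexive_pair :: "('o, 'a, 'z) cat_scheme \<Rightarrow> 'a \<Rightarrow> 'a \<Rightarrow> bool" where
  "coreflexive_pair \<A> f g \<longleftrightarrow> parallel_pair \<A> f g \<and>
    (\<exists>r \<in> Hom \<A> (Cod \<A> f) (Dom \<A> f).
      r \<cdot>\<^bsub>\<A>\<^esub> f = Ident \<A> (Dom \<A> f) \<and> r \<cdot>\<^bsub>\<A>\<^esub> g = Ident \<A> (Dom \<A> f))"

definition is_equalizer :: "('o, 'a, 'z) cat_scheme \<Rightarrow> 'a \<Rightarrow> 'a \<Rightarrow> 'a \<Rightarrow> bool" where
  "is_equalizer \<A> f g e \<longleftrightarrow> parallel_pair \<A> f g \<and>
    e \<in> Arr \<A> \<and> Cod \<A> e = Dom \<A> f \<and> f \<cdot>\<^bsub>\<A>\<^esub> e = g \<cdot>\<^bsub>\<A>\<^esub> e \<and>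
    (\<forall>h \<in> Arr \<A>. Cod \<A> h = Dom \<A> f \<and> f \<cdot>\<^bsub>\<A>\<^esub> h = g \<cdot>\<^bsub>\<A>\<^esub> h \<longrightarrow>
      (\<exists>!u. u \<in> Hom \<A> (Dom \<A> h) (Dom \<A> e) \<and> e \<cdot>\<^bsub>\<A>\<^esub> u = h))"

definition split_cofork :: "('o, 'a, 'z) cat_scheme \<Rightarrow> 'a \<Rightarrow> 'a \<Rightarrow> 'a \<Rightarrow> bool" where
  "split_cofork \<A> e f g \<longleftrightarrow> parallel_pair \<A> f g \<and>
    e \<in> Arr \<A> \<and> Cod \<A> e = Dom \<A> f \<and> f \<cdot>\<^bsub>\<A>\<^esub> e = g \<cdot>\<^bsub>\<A>\<^esub> e \<and>
    (\<exists>p \<in> Hom \<A> (Dom \<A> f) (Dom \<A> e). \<exists>q \<in> Hom \<A> (Cod \<A> f) (Dom \<A> f).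
      p \<cdot>\<^bsub>\<A>\<^esub> e = Ident \<A> (Dom \<A> e) \<and>
      q \<cdot>\<^bsub>\<A>\<^esub> f = Ident \<A> (Dom \<A> f) \<and>
      e \<cdot>\<^bsub>\<A>\<^esub> p = q \<cdot>\<^bsub>\<A>\<^esub> g)"

definition preserves_equalizers_of ::
  "('o, 'a, 'x) cat_scheme \<Rightarrow> ('p, 'b, 'y) cat_scheme \<Rightarrow> ('o, 'a, 'p, 'b, 'w) func_scheme \<Rightarrow>
   'a \<Rightarrow> 'a \<Rightarrow> bool" where
  "preserves_equalizers_of \<A> \<B> F f g \<longleftrightarrow>
    (\<forall>e. is_equalizer \<A> f g e \<longrightarrow> is_equalizer \<B> (Fa F f) (Fa F g) (Fa F e))"


section \<open>Categories of structured objects\<close>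

text \<open>
  The category with object set \<open>Ob\<close> in which an arrow from \<open>x\<close> to \<open>y\<close> is an arrow
  \<open>f : U x \<rightarrow> U y\<close> of \<open>\<A>\<close> with \<open>P x y f\<close>.  The arrow is stored as \<open>(x, f, y)\<close> so
  that domain and codomain can be read off.
\<close>

definition struct_cat ::
  "('o, 'a, 'z) cat_scheme \<Rightarrow> 's set \<Rightarrow> ('s \<Rightarrow> 'o) \<Rightarrow> ('s \<Rightarrow> 's \<Rightarrow> 'a \<Rightarrow> bool) \<Rightarrow>
   ('s, 's \<times> 'a \<times> 's) cat" where
  "struct_cat \<A> Ob U P =
    \<lparr>Obj = Ob,
     Arr = {(x, f, y). x \<in> Ob \<and> y \<in> Ob \<and> f \<in> Hom \<A> (U x) (U y) \<and> P x y f},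
     Dom = (\<lambda>(x, f, y). x),
     Cod = (\<lambda>(x, f, y). y),
     Ident = (\<lambda>x. (x, Ident \<A> (U x), x)),
     Comp = (\<lambda>(_, g, z) (x, f, _). (x, g \<cdot>\<^bsub>\<A>\<^esub> f, z))\<rparr>"

definition underlying :: "'s \<times> 'a \<times> 's \<Rightarrow> 'a" where
  "underlying = (\<lambda>(x, f, y). f)"


section \<open>Monads and their algebras\<close>

record ('o, 'a) monad = "('o, 'a, 'o, 'a) func" +
  Mu :: "'o \<Rightarrow> 'a"
  Iota :: "'o \<Rightarrow> 'a"

locale cat_monad = cat_functor \<A> \<A> S
  for \<A> :: "('o, 'a, 'y) cat_scheme" and S :: "('o, 'a, 'z) monad_scheme" +
  assumes Mu_natural: "natural_transformation \<A> \<A> (comp_func S S) S (Mu S)"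
    and Iota_natural: "natural_transformation \<A> \<A> id_func S (Iota S)"
    and Mu_assoc: "X \<in> Obj \<A> \<Longrightarrow> Mu S X \<cdot>\<^bsub>\<A>\<^esub> Mu S (Fo S X) = Mu S X \<cdot>\<^bsub>\<A>\<^esub> Fa S (Mu S X)"
    and Mu_Iota_left: "X \<in> Obj \<A> \<Longrightarrow> Mu S X \<cdot>\<^bsub>\<A>\<^esub> Iota S (Fo S X) = Ident \<A> (Fo S X)"
    and Mu_Iota_right: "X \<in> Obj \<A> \<Longrightarrow> Mu S X \<cdot>\<^bsub>\<A>\<^esub> Fa S (Iota S X) = Ident \<A> (Fo S X)"

definition is_algebra ::
  "('o, 'a, 'y) cat_scheme \<Rightarrow> ('o, 'a, 'z) monad_scheme \<Rightarrow> 'o \<Rightarrow> 'a \<Rightarrow> bool" where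
  "is_algebra \<A> S N \<sigma> \<longleftrightarrow> N \<in> Obj \<A> \<and> \<sigma> \<in> Hom \<A> (Fo S N) N \<and>
    \<sigma> \<cdot>\<^bsub>\<A>\<^esub> Fa S \<sigma> = \<sigma> \<cdot>\<^bsub>\<A>\<^esub> Mu S N \<and> \<sigma> \<cdot>\<^bsub>\<A>\<^esub> Iota S N = Ident \<A> N"

definition is_algebra_map ::
  "('o, 'a, 'y) cat_scheme \<Rightarrow> ('o, 'a, 'z) monad_scheme \<Rightarrow> 'a \<Rightarrow> 'a \<Rightarrow> 'a \<Rightarrow> bool" where
  "is_algebra_map \<A> S \<sigma> \<sigma>' f \<longleftrightarrow> f \<cdot>\<^bsub>\<A>\<^esub> \<sigma> = \<sigma>' \<cdot>\<^bsub>\<A>\<^esub> Fa S f"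

definition algebra_cat ::
  "('o, 'a, 'y) cat_scheme \<Rightarrow> ('o, 'a, 'z) monad_scheme \<Rightarrow>
   ('o \<times> 'a, ('o \<times> 'a) \<times> 'a \<times> ('o \<times> 'a)) cat" where
  "algebra_cat \<A> S = struct_cat \<A> {(N, \<sigma>). is_algebra \<A> S N \<sigma>} fst
    (\<lambda>(_, \<sigma>) (_, \<sigma>') f. is_algebra_map \<A> S \<sigma> \<sigma>' f)"

definition free_algebra ::
  "('o, 'a, 'y) cat_scheme \<Rightarrow> ('o, 'a, 'z) monad_scheme \<Rightarrow>
   ('o, 'a, 'o \<times> 'a, ('o \<times> 'a) \<times> 'a \<times> ('o \<times> 'a)) func" where
  "free_algebra \<A> S =
    \<lparr>Fo = (\<lambda>N. (Fo S N, Mu S N)),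
     Fa = (\<lambda>f. ((Fo S (Dom \<A> f), Mu S (Dom \<A> f)), Fa S f, (Fo S (Cod \<A> f), Mu S (Cod \<A> f))))\<rparr>"

definition monad_split_pair ::
  "('o, 'a, 'y) cat_scheme \<Rightarrow> ('o, 'a, 'z) monad_scheme \<Rightarrow> 'a \<Rightarrow> 'a \<Rightarrow> bool" where
  "monad_split_pair \<A> S f g \<longleftrightarrow> parallel_pair \<A> f g \<and>
    (\<exists>e. split_cofork (algebra_cat \<A> S) e (Fa (free_algebra \<A> S) f) (Fa (free_algebra \<A> S) g))"


section \<open>Monoidal categories and module categories\<close>

text \<open>
  Neither is assumed strict: the associativity and unit constraints that informal notation
  suppresses are written out everywhere below.
\<close>

locale bifunctor = A: category \<A> + B: category \<B> + D: category \<D>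
  for \<A> :: "('o, 'a, 'x) cat_scheme" and \<B> :: "('p, 'b, 'y) cat_scheme"
    and \<D> :: "('q, 'c, 'z) cat_scheme" +
  fixes Bo :: "'o \<Rightarrow> 'p \<Rightarrow> 'q" and Ba :: "'a \<Rightarrow> 'b \<Rightarrow> 'c"
  assumes Bo_Obj: "X \<in> Obj \<A> \<Longrightarrow> Y \<in> Obj \<B> \<Longrightarrow> Bo X Y \<in> Obj \<D>"
    and Ba_Hom: "f \<in> Hom \<A> X X' \<Longrightarrow> g \<in> Hom \<B> Y Y' \<Longrightarrow> Ba f g \<in> Hom \<D> (Bo X Y) (Bo X' Y')"
    and Ba_Ident: "X \<in> Obj \<A> \<Longrightarrow> Y \<in> Obj \<B> \<Longrightarrow> Ba (Ident \<A> X) (Ident \<B> Y) = Ident \<D> (Bo X Y)"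
    and Ba_Comp: "f \<in> Hom \<A> X X' \<Longrightarrow> f' \<in> Hom \<A> X' X'' \<Longrightarrow>
      g \<in> Hom \<B> Y Y' \<Longrightarrow> g' \<in> Hom \<B> Y' Y'' \<Longrightarrow>
      Ba (f' \<cdot>\<^bsub>\<A>\<^esub> f) (g' \<cdot>\<^bsub>\<B>\<^esub> g) = Ba f' g' \<cdot>\<^bsub>\<D>\<^esub> Ba f g"

record ('o, 'a) moncat = "('o, 'a) cat" +
  Tens :: "'o \<Rightarrow> 'o \<Rightarrow> 'o"  (infixr "\<otimes>\<index>" 70)
  TensA :: "'a \<Rightarrow> 'a \<Rightarrow> 'a"  (infixr "\<boxtimes>\<index>" 70)
  Unit :: "'o"
  Assoc :: "'o \<Rightarrow> 'o \<Rightarrow> 'o \<Rightarrow> 'a"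
  LUnit :: "'o \<Rightarrow> 'a"
  RUnit :: "'o \<Rightarrow> 'a"

locale monoidal_category =
  category \<C> + bifunctor \<C> \<C> \<C> "Tens \<C>" "TensA \<C>"
  for \<C> :: "('o, 'a, 'z) moncat_scheme" (structure) +
  assumes Unit_Obj: "Unit \<C> \<in> Obj \<C>"
    and Assoc_Hom: "X \<in> Obj \<C> \<Longrightarrow> Y \<in> Obj \<C> \<Longrightarrow> Z \<in> Obj \<C> \<Longrightarrow>
      Assoc \<C> X Y Z \<in> Hom \<C> ((X \<otimes> Y) \<otimes> Z) (X \<otimes> (Y \<otimes> Z))"
    and Assoc_iso: "X \<in> Obj \<C> \<Longrightarrow> Y \<in> Obj \<C> \<Longrightarrow> Z \<in> Obj \<C> \<Longrightarrow> is_iso \<C> (Assoc \<C> X Y Z)"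
    and Assoc_natural: "f \<in> Hom \<C> X X' \<Longrightarrow> g \<in> Hom \<C> Y Y' \<Longrightarrow> h \<in> Hom \<C> Z Z' \<Longrightarrow>
      Assoc \<C> X' Y' Z' \<cdot> ((f \<boxtimes> g) \<boxtimes> h) = (f \<boxtimes> (g \<boxtimes> h)) \<cdot> Assoc \<C> X Y Z"
    and LUnit_Hom: "X \<in> Obj \<C> \<Longrightarrow> LUnit \<C> X \<in> Hom \<C> (Unit \<C> \<otimes> X) X"
    and LUnit_iso: "X \<in> Obj \<C> \<Longrightarrow> is_iso \<C> (LUnit \<C> X)"
    and LUnit_natural: "f \<in> Hom \<C> X Y \<Longrightarrow>
      LUnit \<C> Y \<cdot> (Ident \<C> (Unit \<C>) \<boxtimes> f) = f \<cdot> LUnit \<C> X"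
    and RUnit_Hom: "X \<in> Obj \<C> \<Longrightarrow> RUnit \<C> X \<in> Hom \<C> (X \<otimes> Unit \<C>) X"
    and RUnit_iso: "X \<in> Obj \<C> \<Longrightarrow> is_iso \<C> (RUnit \<C> X)"
    and RUnit_natural: "f \<in> Hom \<C> X Y \<Longrightarrow>
      RUnit \<C> Y \<cdot> (f \<boxtimes> Ident \<C> (Unit \<C>)) = f \<cdot> RUnit \<C> X"
    and pentagon: "W \<in> Obj \<C> \<Longrightarrow> X \<in> Obj \<C> \<Longrightarrow> Y \<in> Obj \<C> \<Longrightarrow> Z \<in> Obj \<C> \<Longrightarrow>
      Assoc \<C> W X (Y \<otimes> Z) \<cdot> Assoc \<C> (W \<otimes> X) Y Z =
      (Ident \<C> W \<boxtimes> Assoc \<C> X Y Z) \<cdot> Assoc \<C> W (X \<otimes> Y) Z \<cdot> (Assoc \<C> W X Y \<boxtimes> Ident \<C> Z)"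
    and triangle: "X \<in> Obj \<C> \<Longrightarrow> Y \<in> Obj \<C> \<Longrightarrow>
      (Ident \<C> X \<boxtimes> LUnit \<C> Y) \<cdot> Assoc \<C> X (Unit \<C>) Y = RUnit \<C> X \<boxtimes> Ident \<C> Y"

record ('o, 'a, 'p, 'b) modcat = "('p, 'b) cat" +
  Act :: "'o \<Rightarrow> 'p \<Rightarrow> 'p"  (infixr "\<odot>\<index>" 70)
  ActA :: "'a \<Rightarrow> 'b \<Rightarrow> 'b"  (infixr "\<boxdot>\<index>" 70)
  MAssoc :: "'o \<Rightarrow> 'o \<Rightarrow> 'p \<Rightarrow> 'b"
  MUnit :: "'p \<Rightarrow> 'b"

locale module_category =
  monoidal_category \<C> + M: category \<M> + act: bifunctor \<C> \<M> \<M> "Act \<M>" "ActA \<M>"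
  for \<C> :: "('o, 'a, 'y) moncat_scheme" and \<M> :: "('o, 'a, 'p, 'b, 'z) modcat_scheme" +
  assumes MAssoc_Hom: "X \<in> Obj \<C> \<Longrightarrow> Y \<in> Obj \<C> \<Longrightarrow> N \<in> Obj \<M> \<Longrightarrow>
      MAssoc \<M> X Y N \<in> Hom \<M> ((X \<otimes>\<^bsub>\<C>\<^esub> Y) \<odot>\<^bsub>\<M>\<^esub> N) (X \<odot>\<^bsub>\<M>\<^esub> (Y \<odot>\<^bsub>\<M>\<^esub> N))"
    and MAssoc_iso: "X \<in> Obj \<C> \<Longrightarrow> Y \<in> Obj \<C> \<Longrightarrow> N \<in> Obj \<M> \<Longrightarrow> is_iso \<M> (MAssoc \<M> X Y N)"
    and MAssoc_natural: "f \<in> Hom \<C> X X' \<Longrightarrow> g \<in> Hom \<C> Y Y' \<Longrightarrow> h \<in> Hom \<M> N N' \<Longrightarrow>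
      MAssoc \<M> X' Y' N' \<cdot>\<^bsub>\<M>\<^esub> ((f \<boxtimes>\<^bsub>\<C>\<^esub> g) \<boxdot>\<^bsub>\<M>\<^esub> h) =
      (f \<boxdot>\<^bsub>\<M>\<^esub> (g \<boxdot>\<^bsub>\<M>\<^esub> h)) \<cdot>\<^bsub>\<M>\<^esub> MAssoc \<M> X Y N"
    and MUnit_Hom: "N \<in> Obj \<M> \<Longrightarrow> MUnit \<M> N \<in> Hom \<M> (Unit \<C> \<odot>\<^bsub>\<M>\<^esub> N) N"
    and MUnit_iso: "N \<in> Obj \<M> \<Longrightarrow> is_iso \<M> (MUnit \<M> N)"
    and MUnit_natural: "h \<in> Hom \<M> N N' \<Longrightarrow>
      MUnit \<M> N' \<cdot>\<^bsub>\<M>\<^esub> (Ident \<C> (Unit \<C>) \<boxdot>\<^bsub>\<M>\<^esub> h) = h \<cdot>\<^bsub>\<M>\<^esub> MUnit \<M> N"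
    and M_pentagon: "X \<in> Obj \<C> \<Longrightarrow> Y \<in> Obj \<C> \<Longrightarrow> Z \<in> Obj \<C> \<Longrightarrow> N \<in> Obj \<M> \<Longrightarrow>
      MAssoc \<M> X Y (Z \<odot>\<^bsub>\<M>\<^esub> N) \<cdot>\<^bsub>\<M>\<^esub> MAssoc \<M> (X \<otimes>\<^bsub>\<C>\<^esub> Y) Z N =
      (Ident \<C> X \<boxdot>\<^bsub>\<M>\<^esub> MAssoc \<M> Y Z N) \<cdot>\<^bsub>\<M>\<^esub> MAssoc \<M> X (Y \<otimes>\<^bsub>\<C>\<^esub> Z) N
        \<cdot>\<^bsub>\<M>\<^esub> (Assoc \<C> X Y Z \<boxdot>\<^bsub>\<M>\<^esub> Ident \<M> N)"
    and M_triangle: "X \<in> Obj \<C> \<Longrightarrow> N \<in> Obj \<M> \<Longrightarrow>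
      (Ident \<C> X \<boxdot>\<^bsub>\<M>\<^esub> MUnit \<M> N) \<cdot>\<^bsub>\<M>\<^esub> MAssoc \<M> X (Unit \<C>) N =
      RUnit \<C> X \<boxdot>\<^bsub>\<M>\<^esub> Ident \<M> N"


section \<open>Bimonads and comodule-monads\<close>

record ('o, 'a) bimonad = "('o, 'a) monad" +
  Psi :: "'o \<Rightarrow> 'o \<Rightarrow> 'a"
  Psi0 :: "'a"

locale is_bimonad =
  monoidal_category \<C> + cat_monad \<C> T
  for \<C> :: "('o, 'a, 'y) moncat_scheme" (structure) and T :: "('o, 'a, 'z) bimonad_scheme" +
  assumes Psi_Hom: "X \<in> Obj \<C> \<Longrightarrow> Y \<in> Obj \<C> \<Longrightarrow>
      Psi T X Y \<in> Hom \<C> (Fo T (X \<otimes> Y)) (Fo T X \<otimes> Fo T Y)"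
    and Psi_natural: "f \<in> Hom \<C> X X' \<Longrightarrow> g \<in> Hom \<C> Y Y' \<Longrightarrow>
      (Fa T f \<boxtimes> Fa T g) \<cdot> Psi T X Y = Psi T X' Y' \<cdot> Fa T (f \<boxtimes> g)"
    and Psi0_Hom: "Psi0 T \<in> Hom \<C> (Fo T (Unit \<C>)) (Unit \<C>)"
    and Psi_coassoc: "X \<in> Obj \<C> \<Longrightarrow> Y \<in> Obj \<C> \<Longrightarrow> Z \<in> Obj \<C> \<Longrightarrow>
      (Ident \<C> (Fo T X) \<boxtimes> Psi T Y Z) \<cdot> Psi T X (Y \<otimes> Z) \<cdot> Fa T (Assoc \<C> X Y Z) =
      Assoc \<C> (Fo T X) (Fo T Y) (Fo T Z) \<cdot> (Psi T X Y \<boxtimes> Ident \<C> (Fo T Z)) \<cdot> Psi T (X \<otimes> Y) Z"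
    and Psi_counit_left: "X \<in> Obj \<C> \<Longrightarrow>
      LUnit \<C> (Fo T X) \<cdot> (Psi0 T \<boxtimes> Ident \<C> (Fo T X)) \<cdot> Psi T (Unit \<C>) X = Fa T (LUnit \<C> X)"
    and Psi_counit_right: "X \<in> Obj \<C> \<Longrightarrow>
      RUnit \<C> (Fo T X) \<cdot> (Ident \<C> (Fo T X) \<boxtimes> Psi0 T) \<cdot> Psi T X (Unit \<C>) = Fa T (RUnit \<C> X)"
    and Mu_Psi: "X \<in> Obj \<C> \<Longrightarrow> Y \<in> Obj \<C> \<Longrightarrow>
      Psi T X Y \<cdot> Mu T (X \<otimes> Y) = (Mu T X \<boxtimes> Mu T Y) \<cdot> Psi T (Fo T X) (Fo T Y) \<cdot> Fa T (Psi T X Y)"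
    and Mu_Psi0: "Psi0 T \<cdot> Mu T (Unit \<C>) = Psi0 T \<cdot> Fa T (Psi0 T)"
    and Iota_Psi: "X \<in> Obj \<C> \<Longrightarrow> Y \<in> Obj \<C> \<Longrightarrow> Psi T X Y \<cdot> Iota T (X \<otimes> Y) = Iota T X \<boxtimes> Iota T Y"
    and Iota_Psi0: "Psi0 T \<cdot> Iota T (Unit \<C>) = Ident \<C> (Unit \<C>)"

record ('o, 'p, 'b) comodule_monad = "('p, 'b) monad" +
  Chi :: "'o \<Rightarrow> 'p \<Rightarrow> 'b"

locale is_comodule_monad =
  is_bimonad \<C> T + module_category \<C> \<M> + S: cat_monad \<M> S
  for \<C> :: "('o, 'a, 'w) moncat_scheme" and T :: "('o, 'a, 'x) bimonad_scheme"
    and \<M> :: "('o, 'a, 'p, 'b, 'y) modcat_scheme" and S :: "('o, 'p, 'b, 'z) comodule_monad_scheme" +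
  assumes Chi_Hom: "X \<in> Obj \<C> \<Longrightarrow> N \<in> Obj \<M> \<Longrightarrow>
      Chi S X N \<in> Hom \<M> (Fo S (X \<odot>\<^bsub>\<M>\<^esub> N)) (Fo T X \<odot>\<^bsub>\<M>\<^esub> Fo S N)"
    and Chi_natural: "f \<in> Hom \<C> X X' \<Longrightarrow> h \<in> Hom \<M> N N' \<Longrightarrow>
      (Fa T f \<boxdot>\<^bsub>\<M>\<^esub> Fa S h) \<cdot>\<^bsub>\<M>\<^esub> Chi S X N = Chi S X' N' \<cdot>\<^bsub>\<M>\<^esub> Fa S (f \<boxdot>\<^bsub>\<M>\<^esub> h)"
    and Chi_coassoc: "X \<in> Obj \<C> \<Longrightarrow> Y \<in> Obj \<C> \<Longrightarrow> N \<in> Obj \<M> \<Longrightarrow>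
      (Ident \<C> (Fo T X) \<boxdot>\<^bsub>\<M>\<^esub> Chi S Y N) \<cdot>\<^bsub>\<M>\<^esub> Chi S X (Y \<odot>\<^bsub>\<M>\<^esub> N) \<cdot>\<^bsub>\<M>\<^esub> Fa S (MAssoc \<M> X Y N) =
      MAssoc \<M> (Fo T X) (Fo T Y) (Fo S N) \<cdot>\<^bsub>\<M>\<^esub> (Psi T X Y \<boxdot>\<^bsub>\<M>\<^esub> Ident \<M> (Fo S N))
        \<cdot>\<^bsub>\<M>\<^esub> Chi S (X \<otimes>\<^bsub>\<C>\<^esub> Y) N"
    and Chi_counit: "N \<in> Obj \<M> \<Longrightarrow>
      MUnit \<M> (Fo S N) \<cdot>\<^bsub>\<M>\<^esub> (Psi0 T \<boxdot>\<^bsub>\<M>\<^esub> Ident \<M> (Fo S N)) \<cdot>\<^bsub>\<M>\<^esub> Chi S (Unit \<C>) N =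
      Fa S (MUnit \<M> N)"
    and Mu_Chi: "X \<in> Obj \<C> \<Longrightarrow> N \<in> Obj \<M> \<Longrightarrow>
      Chi S X N \<cdot>\<^bsub>\<M>\<^esub> Mu S (X \<odot>\<^bsub>\<M>\<^esub> N) =
      (Mu T X \<boxdot>\<^bsub>\<M>\<^esub> Mu S N) \<cdot>\<^bsub>\<M>\<^esub> Chi S (Fo T X) (Fo S N) \<cdot>\<^bsub>\<M>\<^esub> Fa S (Chi S X N)"
    and Iota_Chi: "X \<in> Obj \<C> \<Longrightarrow> N \<in> Obj \<M> \<Longrightarrow>
      Chi S X N \<cdot>\<^bsub>\<M>\<^esub> Iota S (X \<odot>\<^bsub>\<M>\<^esub> N) = Iota T X \<boxdot>\<^bsub>\<M>\<^esub> Iota S N"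

definition galois_map ::
  "('o, 'a, 'w) moncat_scheme \<Rightarrow> ('o, 'a, 'x) bimonad_scheme \<Rightarrow>
   ('o, 'a, 'p, 'b, 'y) modcat_scheme \<Rightarrow> ('o, 'p, 'b, 'z) comodule_monad_scheme \<Rightarrow> 'o \<Rightarrow> 'p \<Rightarrow> 'b" where
  "galois_map \<C> T \<M> S X N =
    (Ident \<C> (Fo T X) \<boxdot>\<^bsub>\<M>\<^esub> Mu S N) \<cdot>\<^bsub>\<M>\<^esub> Chi S X (Fo S N)"


section \<open>Comonoids and comodules\<close>

record ('o, 'a) comonoid =
  Carr :: "'o"
  Comult :: "'a"
  Counit :: "'a"

locale is_comonoid =
  monoidal_category \<C>
  for \<C> :: "('o, 'a, 'y) moncat_scheme" (structure) and C :: "('o, 'a, 'z) comonoid_scheme" +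
  assumes Carr_Obj: "Carr C \<in> Obj \<C>"
    and Comult_Hom: "Comult C \<in> Hom \<C> (Carr C) (Carr C \<otimes> Carr C)"
    and Counit_Hom: "Counit C \<in> Hom \<C> (Carr C) (Unit \<C>)"
    and Comult_coassoc:
      "Assoc \<C> (Carr C) (Carr C) (Carr C) \<cdot> (Comult C \<boxtimes> Ident \<C> (Carr C)) \<cdot> Comult C =
       (Ident \<C> (Carr C) \<boxtimes> Comult C) \<cdot> Comult C"
    and Counit_left:
      "LUnit \<C> (Carr C) \<cdot> (Counit C \<boxtimes> Ident \<C> (Carr C)) \<cdot> Comult C = Ident \<C> (Carr C)"
    and Counit_right:
      "RUnit \<C> (Carr C) \<cdot> (Ident \<C> (Carr C) \<boxtimes> Counit C) \<cdot> Comult C = Ident \<C> (Carr C)"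

text \<open>The comonoid \<open>Z = T(C)\<close>.\<close>

definition free_comonoid ::
  "('o, 'a, 'w) moncat_scheme \<Rightarrow> ('o, 'a, 'x) bimonad_scheme \<Rightarrow> ('o, 'a, 'y) comonoid_scheme \<Rightarrow>
   ('o, 'a) comonoid" where
  "free_comonoid \<C> T C =
    \<lparr>Carr = Fo T (Carr C),
     Comult = Psi T (Carr C) (Carr C) \<cdot>\<^bsub>\<C>\<^esub> Fa T (Comult C),
     Counit = Psi0 T \<cdot>\<^bsub>\<C>\<^esub> Fa T (Counit C)\<rparr>"

text \<open>The comonad \<open>N \<mapsto> C \<cdot> N\<close> on \<open>\<M>\<close>: functor, comultiplication and counit.\<close>

definition hat ::
  "('o, 'a, 'w) moncat_scheme \<Rightarrow> ('o, 'a, 'p, 'b, 'x) modcat_scheme \<Rightarrow> ('o, 'a, 'y) comonoid_scheme \<Rightarrow>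
   ('p, 'b, 'p, 'b) func" where
  "hat \<C> \<M> C =
    \<lparr>Fo = (\<lambda>N. Carr C \<odot>\<^bsub>\<M>\<^esub> N), Fa = (\<lambda>f. Ident \<C> (Carr C) \<boxdot>\<^bsub>\<M>\<^esub> f)\<rparr>"

definition hat_comult ::
  "('o, 'a, 'p, 'b, 'x) modcat_scheme \<Rightarrow> ('o, 'a, 'y) comonoid_scheme \<Rightarrow> 'p \<Rightarrow> 'b" where
  "hat_comult \<M> C N = MAssoc \<M> (Carr C) (Carr C) N \<cdot>\<^bsub>\<M>\<^esub> (Comult C \<boxdot>\<^bsub>\<M>\<^esub> Ident \<M> N)"

definition hat_counit ::
  "('o, 'a, 'p, 'b, 'x) modcat_scheme \<Rightarrow> ('o, 'a, 'y) comonoid_scheme \<Rightarrow> 'p \<Rightarrow> 'b" where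
  "hat_counit \<M> C N = MUnit \<M> N \<cdot>\<^bsub>\<M>\<^esub> (Counit C \<boxdot>\<^bsub>\<M>\<^esub> Ident \<M> N)"

definition is_comodule ::
  "('o, 'a, 'w) moncat_scheme \<Rightarrow> ('o, 'a, 'p, 'b, 'x) modcat_scheme \<Rightarrow> ('o, 'a, 'y) comonoid_scheme \<Rightarrow>
   'p \<Rightarrow> 'b \<Rightarrow> bool" where
  "is_comodule \<C> \<M> C N c \<longleftrightarrow> N \<in> Obj \<M> \<and> c \<in> Hom \<M> N (Carr C \<odot>\<^bsub>\<M>\<^esub> N) \<and>
    hat_comult \<M> C N \<cdot>\<^bsub>\<M>\<^esub> c = Fa (hat \<C> \<M> C) c \<cdot>\<^bsub>\<M>\<^esub> c \<and>
    hat_counit \<M> C N \<cdot>\<^bsub>\<M>\<^esub> c = Ident \<M> N"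

definition is_comodule_map ::
  "('o, 'a, 'w) moncat_scheme \<Rightarrow> ('o, 'a, 'p, 'b, 'x) modcat_scheme \<Rightarrow> ('o, 'a, 'y) comonoid_scheme \<Rightarrow>
   'b \<Rightarrow> 'b \<Rightarrow> 'b \<Rightarrow> bool" where
  "is_comodule_map \<C> \<M> C c c' f \<longleftrightarrow> c' \<cdot>\<^bsub>\<M>\<^esub> f = Fa (hat \<C> \<M> C) f \<cdot>\<^bsub>\<M>\<^esub> c"

type_synonym ('p, 'b) comod = "'p \<times> 'b"
type_synonym ('p, 'b) comod_arr = "('p, 'b) comod \<times> 'b \<times> ('p, 'b) comod"

definition comodule_cat ::
  "('o, 'a, 'w) moncat_scheme \<Rightarrow> ('o, 'a, 'p, 'b, 'x) modcat_scheme \<Rightarrow> ('o, 'a, 'y) comonoid_scheme \<Rightarrow>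
   (('p, 'b) comod, ('p, 'b) comod_arr) cat" where
  "comodule_cat \<C> \<M> C = struct_cat \<M> {(N, c). is_comodule \<C> \<M> C N c} fst
    (\<lambda>(_, c) (_, c') f. is_comodule_map \<C> \<M> C c c' f)"

definition cofree_comodule ::
  "('o, 'a, 'w) moncat_scheme \<Rightarrow> ('o, 'a, 'p, 'b, 'x) modcat_scheme \<Rightarrow> ('o, 'a, 'y) comonoid_scheme \<Rightarrow>
   ('p, 'b, ('p, 'b) comod, ('p, 'b) comod_arr) func" where
  "cofree_comodule \<C> \<M> C =
    \<lparr>Fo = (\<lambda>N. (Carr C \<odot>\<^bsub>\<M>\<^esub> N, hat_comult \<M> C N)),
     Fa = (\<lambda>f. ((Carr C \<odot>\<^bsub>\<M>\<^esub> Dom \<M> f, hat_comult \<M> C (Dom \<M> f)),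
                Fa (hat \<C> \<M> C) f,
                (Carr C \<odot>\<^bsub>\<M>\<^esub> Cod \<M> f, hat_comult \<M> C (Cod \<M> f))))\<rparr>"


section \<open>Hopf modules\<close>

text \<open>
  Below \<open>Z = free_comonoid \<C> T C\<close>; its \<open>T\<close>-algebra structure is \<open>\<mu>\<^sub>C\<close>, written
  \<open>Mu T (Carr C)\<close>.
\<close>

type_synonym ('p, 'b) hopfmod = "'p \<times> 'b \<times> 'b"
type_synonym ('p, 'b) hopfmod_arr = "('p, 'b) hopfmod \<times> 'b \<times> ('p, 'b) hopfmod"

definition is_hopf_module ::
  "('o, 'a, 'v) moncat_scheme \<Rightarrow> ('o, 'a, 'w) bimonad_scheme \<Rightarrow> ('o, 'a, 'p, 'b, 'x) modcat_scheme \<Rightarrow>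
   ('o, 'p, 'b, 'y) comodule_monad_scheme \<Rightarrow> ('o, 'a, 'z) comonoid_scheme \<Rightarrow>
   'p \<Rightarrow> 'b \<Rightarrow> 'b \<Rightarrow> bool" where
  "is_hopf_module \<C> T \<M> S C N \<sigma> \<zeta> \<longleftrightarrow>
    is_algebra \<M> S N \<sigma> \<and> is_comodule \<C> \<M> (free_comonoid \<C> T C) N \<zeta> \<and>
    \<zeta> \<cdot>\<^bsub>\<M>\<^esub> \<sigma> = (Mu T (Carr C) \<boxdot>\<^bsub>\<M>\<^esub> \<sigma>) \<cdot>\<^bsub>\<M>\<^esub> Chi S (Fo T (Carr C)) N \<cdot>\<^bsub>\<M>\<^esub> Fa S \<zeta>"

definition hopf_cat ::
  "('o, 'a, 'v) moncat_scheme \<Rightarrow> ('o, 'a, 'w) bimonad_scheme \<Rightarrow> ('o, 'a, 'p, 'b, 'x) modcat_scheme \<Rightarrow>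
   ('o, 'p, 'b, 'y) comodule_monad_scheme \<Rightarrow> ('o, 'a, 'z) comonoid_scheme \<Rightarrow>
   (('p, 'b) hopfmod, ('p, 'b) hopfmod_arr) cat" where
  "hopf_cat \<C> T \<M> S C = struct_cat \<M> {(N, \<sigma>, \<zeta>). is_hopf_module \<C> T \<M> S C N \<sigma> \<zeta>} fst
    (\<lambda>(_, \<sigma>, \<zeta>) (_, \<sigma>', \<zeta>') f. is_algebra_map \<M> S \<sigma> \<sigma>' f \<and>
      is_comodule_map \<C> \<M> (free_comonoid \<C> T C) \<zeta> \<zeta>' f)"

definition functor_A ::
  "('o, 'p, 'b, 'y) comodule_monad_scheme \<Rightarrow> ('o, 'a, 'p, 'b, 'x) modcat_scheme \<Rightarrow>
   ('o, 'a, 'z) comonoid_scheme \<Rightarrow>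
   (('p, 'b) comod, ('p, 'b) comod_arr, ('p, 'b) hopfmod, ('p, 'b) hopfmod_arr) func" where
  "functor_A S \<M> C =
    (let Ao = (\<lambda>(N, c). (Fo S N, Mu S N, Chi S (Carr C) N \<cdot>\<^bsub>\<M>\<^esub> Fa S c))
     in \<lparr>Fo = Ao, Fa = (\<lambda>(x, f, y). (Ao x, Fa S f, Ao y))\<rparr>)"

text \<open>
  The pair of arrows \<open>C \<cdot> N \<rightarrow> C \<cdot> (Z \<cdot> N)\<close> between cofree comodules whose equalizer is
  the value of the second functor at \<open>(N, \<sigma>, \<zeta>)\<close>.
\<close>

definition B_left ::
  "('o, 'a, 'v) moncat_scheme \<Rightarrow> ('o, 'a, 'w) bimonad_scheme \<Rightarrow> ('o, 'a, 'p, 'b, 'x) modcat_scheme \<Rightarrow>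
   ('o, 'a, 'z) comonoid_scheme \<Rightarrow> ('p, 'b) hopfmod \<Rightarrow> ('p, 'b) comod_arr" where
  "B_left \<C> T \<M> C = (\<lambda>(N, \<sigma>, \<zeta>).
    (Fo (cofree_comodule \<C> \<M> C) N,
     (Ident \<C> (Carr C) \<boxdot>\<^bsub>\<M>\<^esub> (Iota T (Carr C) \<boxdot>\<^bsub>\<M>\<^esub> Ident \<M> N))
       \<cdot>\<^bsub>\<M>\<^esub> MAssoc \<M> (Carr C) (Carr C) N
       \<cdot>\<^bsub>\<M>\<^esub> (Comult C \<boxdot>\<^bsub>\<M>\<^esub> Ident \<M> N),
     Fo (cofree_comodule \<C> \<M> C) (Fo T (Carr C) \<odot>\<^bsub>\<M>\<^esub> N)))"

definition B_right ::
  "('o, 'a, 'v) moncat_scheme \<Rightarrow> ('o, 'a, 'w) bimonad_scheme \<Rightarrow> ('o, 'a, 'p, 'b, 'x) modcat_scheme \<Rightarrow>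
   ('o, 'a, 'z) comonoid_scheme \<Rightarrow> ('p, 'b) hopfmod \<Rightarrow> ('p, 'b) comod_arr" where
  "B_right \<C> T \<M> C = (\<lambda>(N, \<sigma>, \<zeta>).
    (Fo (cofree_comodule \<C> \<M> C) N,
     Ident \<C> (Carr C) \<boxdot>\<^bsub>\<M>\<^esub> \<zeta>,
     Fo (cofree_comodule \<C> \<M> C) (Fo T (Carr C) \<odot>\<^bsub>\<M>\<^esub> N)))"

definition B_equalizers_exist ::
  "('o, 'a, 'v) moncat_scheme \<Rightarrow> ('o, 'a, 'w) bimonad_scheme \<Rightarrow> ('o, 'a, 'p, 'b, 'x) modcat_scheme \<Rightarrow>
   ('o, 'p, 'b, 'y) comodule_monad_scheme \<Rightarrow> ('o, 'a, 'z) comonoid_scheme \<Rightarrow> bool" where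
  "B_equalizers_exist \<C> T \<M> S C \<longleftrightarrow>
    (\<forall>H \<in> Obj (hopf_cat \<C> T \<M> S C).
      \<exists>e. is_equalizer (comodule_cat \<C> \<M> C) (B_left \<C> T \<M> C H) (B_right \<C> T \<M> C H) e)"

text \<open>
  A choice of equalizers.  This, and the functor, unit and counit built on it, are meaningful
  only when the equalizers exist.
\<close>

definition B_equalizer ::
  "('o, 'a, 'v) moncat_scheme \<Rightarrow> ('o, 'a, 'w) bimonad_scheme \<Rightarrow> ('o, 'a, 'p, 'b, 'x) modcat_scheme \<Rightarrow>
   ('o, 'a, 'z) comonoid_scheme \<Rightarrow> ('p, 'b) hopfmod \<Rightarrow> ('p, 'b) comod_arr" where
  "B_equalizer \<C> T \<M> C H =
    (SOME e. is_equalizer (comodule_cat \<C> \<M> C) (B_left \<C> T \<M> C H) (B_right \<C> T \<M> C H) e)"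

text \<open>On arrows the functor is determined by the universal property of the chosen equalizers.\<close>

definition functor_B ::
  "('o, 'a, 'v) moncat_scheme \<Rightarrow> ('o, 'a, 'w) bimonad_scheme \<Rightarrow> ('o, 'a, 'p, 'b, 'x) modcat_scheme \<Rightarrow>
   ('o, 'a, 'z) comonoid_scheme \<Rightarrow>
   (('p, 'b) hopfmod, ('p, 'b) hopfmod_arr, ('p, 'b) comod, ('p, 'b) comod_arr) func" where
  "functor_B \<C> T \<M> C =
    (let MC = comodule_cat \<C> \<M> C; eq = B_equalizer \<C> T \<M> C
     in \<lparr>Fo = (\<lambda>H. Dom MC (eq H)),
         Fa = (\<lambda>(H, h, H'). THE u. u \<in> Hom MC (Dom MC (eq H)) (Dom MC (eq H')) \<and>
            eq H' \<cdot>\<^bsub>MC\<^esub> u = Fa (cofree_comodule \<C> \<M> C) h \<cdot>\<^bsub>MC\<^esub> eq H)\<rparr>)"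

definition AB_unit ::
  "('o, 'a, 'v) moncat_scheme \<Rightarrow> ('o, 'a, 'w) bimonad_scheme \<Rightarrow> ('o, 'a, 'p, 'b, 'x) modcat_scheme \<Rightarrow>
   ('o, 'p, 'b, 'y) comodule_monad_scheme \<Rightarrow> ('o, 'a, 'z) comonoid_scheme \<Rightarrow>
   ('p, 'b) comod \<Rightarrow> ('p, 'b) comod_arr" where
  "AB_unit \<C> T \<M> S C = (\<lambda>(N, c).
    (let MC = comodule_cat \<C> \<M> C; H = Fo (functor_A S \<M> C) (N, c)
     in THE u. u \<in> Hom MC (N, c) (Fo (functor_B \<C> T \<M> C) H) \<and>
          B_equalizer \<C> T \<M> C H \<cdot>\<^bsub>MC\<^esub> u =
          ((N, c), (Ident \<C> (Carr C) \<boxdot>\<^bsub>\<M>\<^esub> Iota S N) \<cdot>\<^bsub>\<M>\<^esub> c,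
           Fo (cofree_comodule \<C> \<M> C) (Fo S N))))"

definition AB_counit ::
  "('o, 'a, 'v) moncat_scheme \<Rightarrow> ('o, 'a, 'w) bimonad_scheme \<Rightarrow> ('o, 'a, 'p, 'b, 'x) modcat_scheme \<Rightarrow>
   ('o, 'p, 'b, 'y) comodule_monad_scheme \<Rightarrow> ('o, 'a, 'z) comonoid_scheme \<Rightarrow>
   ('p, 'b) hopfmod \<Rightarrow> ('p, 'b) hopfmod_arr" where
  "AB_counit \<C> T \<M> S C = (\<lambda>(N, \<sigma>, \<zeta>).
    (Fo (functor_A S \<M> C) (Fo (functor_B \<C> T \<M> C) (N, \<sigma>, \<zeta>)),
     \<sigma> \<cdot>\<^bsub>\<M>\<^esub> Fa S (hat_counit \<M> C N) \<cdot>\<^bsub>\<M>\<^esub> Fa S (underlying (B_equalizer \<C> T \<M> C (N, \<sigma>, \<zeta>))),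
     (N, \<sigma>, \<zeta>)))"

end

theory Submission
  imports Defs
begin

text \<open>
  The monoidal structure enters only through a few natural transformations on \<open>\<M>\<close>. Put \<open>G = C \<cdot> -\<close> and
  \<open>H = Z \<cdot> -\<close>. The transformation \<open>\<tau> = (\<mu>\<^sub>C \<cdot> id) \<chi>\<^bsub>Z,-\<^esub> : S H \<rightarrow> H S\<close> is a mixed distributive law of the
  monad \<open>S\<close> over the comonad \<open>H\<close>, Hopf modules are the modules over it, and \<open>j = \<iota>\<^sub>C \<cdot> id : G \<rightarrow> H\<close> is a
  morphism of comonads with \<open>\<chi>\<^bsub>C,-\<^esub> = \<tau> S(j)\<close>. The first functor sends a \<open>G\<close>-coalgebra to the free
  \<open>S\<close>-algebra on it, with the coaction induced along \<open>j\<close>; the second one is its right adjoint, an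
  equalizer of \<open>(G j) \<delta>\<close> and \<open>G \<zeta>\<close>. The Galois map extends to all algebras as
  \<open>\<gamma>\<^bsub>N,\<sigma>\<^esub> = (H \<sigma>) \<chi>\<^bsub>C,N\<^esub> : S G N \<rightarrow> H N\<close>, and the theorem is proved at this level of generality
  (\<open>equivalence_iff_galois\<close>).
  
  Suppose that \<open>\<gamma>\<close> is invertible on free algebras. An algebra is a split coequalizer in \<open>\<M>\<close> of free
  ones, so \<open>\<gamma>\<close> is invertible on all algebras (\<open>galois_iso_of_free\<close>). Along \<open>\<gamma>\<close>, the image under \<open>S\<close> of the
  pair \<open>(G j) \<delta>, G \<zeta>\<close> becomes the pair \<open>\<delta>', H \<zeta> : H N \<rightarrow> H H N\<close> (\<open>galois_left\<close>, \<open>galois_right\<close>), and that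
  pair is split in the category of algebras by \<open>\<zeta> : N \<rightarrow> H N\<close>. Hence the pair is \<open>S\<close>-split, and it is
  coreflexive by means of the counit of \<open>H\<close>. Its equalizer \<open>e\<close> therefore exists, is preserved by \<open>G\<close>, \<open>G\<^sup>2\<close>
  and \<open>S\<close>, and lifts to coalgebras (\<open>equalizer_lifts\<close>). Now \<open>S e\<close> and \<open>\<gamma>\<^sup>-\<^sup>1 \<zeta>\<close> are equalizers of the same
  pair, and the comparison between them is the counit of the adjunction, which is thus invertible
  (\<open>counit_iso_of_galois_iso\<close>). By a triangle identity \<open>S\<close> sends the unit to an isomorphism, so the unit
  is invertible because \<open>S\<close> is conservative.
  
  Conversely, evaluate the counit at the cofree module \<open>H N\<close> on an algebra \<open>N\<close>. There the equalizer is
  known, because it is split: it is \<open>(G j) \<delta> : G N \<rightarrow> G H N\<close> (\<open>cofree_equalizer\<close>). Under this identification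
  the counit is \<open>\<gamma>\<^bsub>N,\<sigma>\<^esub>\<close>, so \<open>\<gamma>\<close> is invertible when the counit is (\<open>galois_iso_of_counit_iso\<close>).
\<close>

section \<open>Composition in categories\<close>

lemma Hom_iff: "f \<in> Hom \<A> X Y \<longleftrightarrow> f \<in> Arr \<A> \<and> Dom \<A> f = X \<and> Cod \<A> f = Y"
  by (simp add: Hom_def)

context category
begin

lemma Ident_simps [simp]:
  assumes "X \<in> Obj \<A>"
  shows "Ident \<A> X \<in> Arr \<A>" "Dom \<A> (Ident \<A> X) = X" "Cod \<A> (Ident \<A> X) = X"
  using Ident_Hom[OF assms] by (simp_all add: Hom_iff)

lemma Comp_simps [simp]:
  assumes "f \<in> Arr \<A>" "g \<in> Arr \<A>" "Dom \<A> g = Cod \<A> f"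
  shows "g \<cdot> f \<in> Arr \<A>" "Dom \<A> (g \<cdot> f) = Dom \<A> f" "Cod \<A> (g \<cdot> f) = Cod \<A> g"
  using Comp_Hom[of f "Dom \<A> f" "Cod \<A> f" g "Cod \<A> g"] assms by (simp_all add: Hom_iff)

lemma Dom_Cod_Obj [simp]:
  assumes "f \<in> Arr \<A>"
  shows "Dom \<A> f \<in> Obj \<A>" "Cod \<A> f \<in> Obj \<A>"
  using assms Dom_Obj Cod_Obj by auto

lemma Ident_left [simp]: "f \<in> Arr \<A> \<Longrightarrow> Cod \<A> f = Y \<Longrightarrow> Ident \<A> Y \<cdot> f = f"
  using Comp_Ident_left[of f "Dom \<A> f" Y] by (simp add: Hom_iff)

lemma Ident_right [simp]: "f \<in> Arr \<A> \<Longrightarrow> Dom \<A> f = X \<Longrightarrow> f \<cdot> Ident \<A> X = f"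
  using Comp_Ident_right[of f X "Cod \<A> f"] by (simp add: Hom_iff)

lemma comp_assoc [simp]:
  assumes "f \<in> Arr \<A>" "g \<in> Arr \<A>" "h \<in> Arr \<A>" "Dom \<A> g = Cod \<A> f" "Dom \<A> h = Cod \<A> g"
  shows "(h \<cdot> g) \<cdot> f = h \<cdot> (g \<cdot> f)"
  using Comp_assoc[of f "Dom \<A> f" "Cod \<A> f" g "Cod \<A> g" h "Cod \<A> h"] assms by (simp add: Hom_iff)

text \<open>
  Composites are kept associated to the right.  This rule turns an equation for a composite of two
  arrows into one that rewrites the same two arrows at the head of a longer composite.
\<close>

lemma comp_reduce:
  assumes "b \<cdot> a = c" "a \<in> Arr \<A>" "b \<in> Arr \<A>" "Dom \<A> b = Cod \<A> a" "x \<in> Arr \<A>" "Dom \<A> a = Cod \<A> x"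
  shows "b \<cdot> (a \<cdot> x) = c \<cdot> x"
  using assms comp_assoc[of x a b] by simp

lemma is_isoI:
  assumes "f \<in> Hom \<A> X Y" "g \<in> Hom \<A> Y X" "g \<cdot> f = Ident \<A> X" "f \<cdot> g = Ident \<A> Y"
  shows "is_iso \<A> f"
  using assms by (auto simp: is_iso_def Hom_iff)

lemma is_isoE:
  assumes "is_iso \<A> f"
  obtains g where "f \<in> Arr \<A>" "g \<in> Arr \<A>" "Dom \<A> g = Cod \<A> f" "Cod \<A> g = Dom \<A> f"
    "g \<cdot> f = Ident \<A> (Dom \<A> f)" "f \<cdot> g = Ident \<A> (Cod \<A> f)"
  using assms by (auto simp: is_iso_def Hom_iff)

lemma is_iso_comp:
  assumes "is_iso \<A> f" "is_iso \<A> g" "Dom \<A> g = Cod \<A> f"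
  shows "is_iso \<A> (g \<cdot> f)"
proof -
  obtain f' where f: "f \<in> Arr \<A>" "f' \<in> Arr \<A>" "Dom \<A> f' = Cod \<A> f" "Cod \<A> f' = Dom \<A> f"
    "f' \<cdot> f = Ident \<A> (Dom \<A> f)" "f \<cdot> f' = Ident \<A> (Cod \<A> f)" using assms(1) by (rule is_isoE)
  obtain g' where g: "g \<in> Arr \<A>" "g' \<in> Arr \<A>" "Dom \<A> g' = Cod \<A> g" "Cod \<A> g' = Dom \<A> g"
    "g' \<cdot> g = Ident \<A> (Dom \<A> g)" "g \<cdot> g' = Ident \<A> (Cod \<A> g)" using assms(2) by (rule is_isoE)
  show ?thesis
    by (rule is_isoI[of _ "Dom \<A> f" "Cod \<A> g" "f' \<cdot> g'"])
      (simp_all add: f g assms(3) Hom_iff f(6)[THEN comp_reduce] g(5)[THEN comp_reduce])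
qed

lemma iso_cancel_left:
  assumes "is_iso \<A> f" "f \<cdot> u = f \<cdot> v" "u \<in> Arr \<A>" "v \<in> Arr \<A>" "Cod \<A> u = Dom \<A> f" "Cod \<A> v = Dom \<A> f"
  shows "u = v"
proof -
  obtain g where g: "f \<in> Arr \<A>" "g \<in> Arr \<A>" "Dom \<A> g = Cod \<A> f" "g \<cdot> f = Ident \<A> (Dom \<A> f)"
    using assms(1) by (rule is_isoE)
  have "g \<cdot> (f \<cdot> u) = g \<cdot> (f \<cdot> v)" using assms(2) by simp
  then show ?thesis using g(1-3) assms(3-) by (simp add: g(4)[THEN comp_reduce])
qed

lemma iso_cancel_right:
  assumes "is_iso \<A> f" "u \<cdot> f = v \<cdot> f" "u \<in> Arr \<A>" "v \<in> Arr \<A>" "Dom \<A> u = Cod \<A> f" "Dom \<A> v = Cod \<A> f"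
  shows "u = v"
proof -
  obtain g where g: "f \<in> Arr \<A>" "g \<in> Arr \<A>" "Dom \<A> g = Cod \<A> f" "Cod \<A> g = Dom \<A> f"
    "f \<cdot> g = Ident \<A> (Cod \<A> f)"
    using assms(1) by (rule is_isoE)
  have "(u \<cdot> f) \<cdot> g = (v \<cdot> f) \<cdot> g" using assms(2) by simp
  then show ?thesis using g assms(3-) by simp
qed

end

context cat_functor
begin

lemma Fo_in_Obj [simp]: "X \<in> Obj \<A> \<Longrightarrow> Fo F X \<in> Obj \<B>"
  by (rule Fo_Obj)

lemma Fa_simps [simp]:
  assumes "f \<in> Arr \<A>"
  shows "Fa F f \<in> Arr \<B>" "Dom \<B> (Fa F f) = Fo F (Dom \<A> f)" "Cod \<B> (Fa F f) = Fo F (Cod \<A> f)"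
  using Fa_Hom[of f "Dom \<A> f" "Cod \<A> f"] assms by (simp_all add: Hom_iff)

lemma Fa_on_Ident [simp]: "X \<in> Obj \<A> \<Longrightarrow> Fa F (Ident \<A> X) = Ident \<B> (Fo F X)"
  by (rule Fa_Ident)

lemma Fa_on_Comp [simp]:
  assumes "f \<in> Arr \<A>" "g \<in> Arr \<A>" "Dom \<A> g = Cod \<A> f"
  shows "Fa F (g \<cdot>\<^bsub>\<A>\<^esub> f) = Fa F g \<cdot>\<^bsub>\<B>\<^esub> Fa F f"
  using Fa_Comp[of f "Dom \<A> f" "Cod \<A> f" g "Cod \<A> g"] assms by (simp add: Hom_iff)

lemma Fa_eq:
  assumes "g \<cdot>\<^bsub>\<A>\<^esub> f = k" "f \<in> Arr \<A>" "g \<in> Arr \<A>" "Dom \<A> g = Cod \<A> f"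
  shows "Fa F g \<cdot>\<^bsub>\<B>\<^esub> Fa F f = Fa F k"
  using assms Fa_on_Comp[of f g] by simp

lemma preserves_iso:
  assumes "is_iso \<A> f"
  shows "is_iso \<B> (Fa F f)"
proof -
  obtain g where g: "f \<in> Arr \<A>" "g \<in> Arr \<A>" "Dom \<A> g = Cod \<A> f" "Cod \<A> g = Dom \<A> f"
    "g \<cdot>\<^bsub>\<A>\<^esub> f = Ident \<A> (Dom \<A> f)" "f \<cdot>\<^bsub>\<A>\<^esub> g = Ident \<A> (Cod \<A> f)"
    using assms by (rule A.is_isoE)
  show ?thesis
    by (rule B.is_isoI[of _ "Fo F (Dom \<A> f)" "Fo F (Cod \<A> f)" "Fa F g"])
      (simp_all add: Hom_iff g g(5,6)[THEN Fa_eq])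
qed

end

section \<open>Equalizers and split coforks\<close>

lemma is_equalizer_sym: "is_equalizer \<A> f g e \<Longrightarrow> is_equalizer \<A> g f e"
  by (auto simp: is_equalizer_def parallel_pair_def)

lemma split_coforkI:
  assumes "f \<in> Arr \<A>" "g \<in> Arr \<A>" "Dom \<A> g = Dom \<A> f" "Cod \<A> g = Cod \<A> f" "e \<in> Arr \<A>"
    "Cod \<A> e = Dom \<A> f" "f \<cdot>\<^bsub>\<A>\<^esub> e = g \<cdot>\<^bsub>\<A>\<^esub> e"
    and "p \<in> Arr \<A>" "Dom \<A> p = Dom \<A> f" "Cod \<A> p = Dom \<A> e" "p \<cdot>\<^bsub>\<A>\<^esub> e = Ident \<A> (Dom \<A> e)"
    and "q \<in> Arr \<A>" "Dom \<A> q = Cod \<A> f" "Cod \<A> q = Dom \<A> f" "q \<cdot>\<^bsub>\<A>\<^esub> f = Ident \<A> (Dom \<A> f)"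
    and "e \<cdot>\<^bsub>\<A>\<^esub> p = q \<cdot>\<^bsub>\<A>\<^esub> g"
  shows "split_cofork \<A> e f g"
proof -
  have "p \<in> Hom \<A> (Dom \<A> f) (Dom \<A> e)" "q \<in> Hom \<A> (Cod \<A> f) (Dom \<A> f)"
    using assms by (simp_all add: Hom_iff)
  with assms show ?thesis unfolding split_cofork_def parallel_pair_def by (metis (no_types))
qed

context category
begin

lemma equalizer_simps:
  assumes "is_equalizer \<A> f g e"
  shows "f \<in> Arr \<A>" "g \<in> Arr \<A>" "Dom \<A> g = Dom \<A> f" "Cod \<A> g = Cod \<A> f" "e \<in> Arr \<A>"
    "Cod \<A> e = Dom \<A> f" "f \<cdot> e = g \<cdot> e"
  using assms by (auto simp: is_equalizer_def parallel_pair_def)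

lemma equalizer_universal:
  assumes "is_equalizer \<A> f g e" "h \<in> Arr \<A>" "Cod \<A> h = Dom \<A> f" "f \<cdot> h = g \<cdot> h"
  shows "\<exists>!u. u \<in> Hom \<A> (Dom \<A> h) (Dom \<A> e) \<and> e \<cdot> u = h"
  using assms(1)[unfolded is_equalizer_def] assms(2-) by blast

lemma equalizer_mono:
  assumes "is_equalizer \<A> f g e" "u \<in> Arr \<A>" "v \<in> Arr \<A>" "Cod \<A> u = Dom \<A> e" "Cod \<A> v = Dom \<A> e"
    "e \<cdot> u = e \<cdot> v"
  shows "u = v"
proof -
  note e = equalizer_simps[OF assms(1)]
  have d: "Dom \<A> u = Dom \<A> v"
    using arg_cong[OF assms(6), of "Dom \<A>"] assms(2-5) e by simp
  have "f \<cdot> (e \<cdot> v) = g \<cdot> (e \<cdot> v)"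
    using assms(2-5) e e(7)[THEN comp_reduce, of v] by simp
  then have "\<exists>!w. w \<in> Hom \<A> (Dom \<A> (e \<cdot> v)) (Dom \<A> e) \<and> e \<cdot> w = e \<cdot> v"
    using assms(3,5) e by - (rule equalizer_universal[OF assms(1)], simp_all)
  moreover have "u \<in> Hom \<A> (Dom \<A> (e \<cdot> v)) (Dom \<A> e)" "v \<in> Hom \<A> (Dom \<A> (e \<cdot> v)) (Dom \<A> e)"
    using assms(2-5) e d by (simp_all add: Hom_iff)
  ultimately show ?thesis using assms(6) by blast
qed

lemma equalizer_factor:
  assumes "is_equalizer \<A> f g e" "h \<in> Arr \<A>" "Cod \<A> h = Dom \<A> f" "f \<cdot> h = g \<cdot> h"
  obtains u where "u \<in> Arr \<A>" "Dom \<A> u = Dom \<A> h" "Cod \<A> u = Dom \<A> e" "e \<cdot> u = h"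
  using equalizer_universal[OF assms] unfolding Hom_iff by blast

lemma is_equalizerI:
  assumes "f \<in> Arr \<A>" "g \<in> Arr \<A>" "Dom \<A> g = Dom \<A> f" "Cod \<A> g = Cod \<A> f" "e \<in> Arr \<A>"
    "Cod \<A> e = Dom \<A> f" "f \<cdot> e = g \<cdot> e"
    and "\<And>h. h \<in> Arr \<A> \<Longrightarrow> Cod \<A> h = Dom \<A> f \<Longrightarrow> f \<cdot> h = g \<cdot> h \<Longrightarrow>
      \<exists>u. u \<in> Arr \<A> \<and> Dom \<A> u = Dom \<A> h \<and> Cod \<A> u = Dom \<A> e \<and> e \<cdot> u = h"
    and "\<And>u v. u \<in> Arr \<A> \<Longrightarrow> v \<in> Arr \<A> \<Longrightarrow> Dom \<A> u = Dom \<A> v \<Longrightarrow> Cod \<A> u = Dom \<A> e \<Longrightarrow>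
      Cod \<A> v = Dom \<A> e \<Longrightarrow> e \<cdot> u = e \<cdot> v \<Longrightarrow> u = v"
  shows "is_equalizer \<A> f g e"
  unfolding is_equalizer_def parallel_pair_def
proof (intro conjI ballI impI)
  fix h assume h: "h \<in> Arr \<A>" "Cod \<A> h = Dom \<A> f \<and> f \<cdot> h = g \<cdot> h"
  then obtain u where "u \<in> Arr \<A> \<and> Dom \<A> u = Dom \<A> h \<and> Cod \<A> u = Dom \<A> e \<and> e \<cdot> u = h"
    using assms(8) by blast
  then have u: "u \<in> Arr \<A>" "Dom \<A> u = Dom \<A> h" "Cod \<A> u = Dom \<A> e" "e \<cdot> u = h" by simp_all
  show "\<exists>!u. u \<in> Hom \<A> (Dom \<A> h) (Dom \<A> e) \<and> e \<cdot> u = h"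
  proof (rule ex1I[of _ u])
    fix v assume "v \<in> Hom \<A> (Dom \<A> h) (Dom \<A> e) \<and> e \<cdot> v = h"
    then show "v = u" using u by - (rule assms(9), simp_all add: Hom_iff)
  qed (simp add: Hom_iff u)
qed (use assms in auto)

lemma equalizer_comp_iso:
  assumes e: "is_equalizer \<A> f g e" and w: "is_iso \<A> w" "Cod \<A> w = Dom \<A> e"
  shows "is_equalizer \<A> f g (e \<cdot> w)"
proof -
  note E = equalizer_simps[OF e]
  obtain v where v: "w \<in> Arr \<A>" "v \<in> Arr \<A>" "Dom \<A> v = Cod \<A> w" "Cod \<A> v = Dom \<A> w"
    "v \<cdot> w = Ident \<A> (Dom \<A> w)" "w \<cdot> v = Ident \<A> (Cod \<A> w)"
    using w(1) by (rule is_isoE)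
  show ?thesis
  proof (rule is_equalizerI)
    fix h assume h: "h \<in> Arr \<A>" "Cod \<A> h = Dom \<A> f" "f \<cdot> h = g \<cdot> h"
    obtain u where u: "u \<in> Arr \<A>" "Dom \<A> u = Dom \<A> h" "Cod \<A> u = Dom \<A> e" "e \<cdot> u = h"
      using equalizer_factor[OF e h] .
    then show "\<exists>u. u \<in> Arr \<A> \<and> Dom \<A> u = Dom \<A> h \<and> Cod \<A> u = Dom \<A> (e \<cdot> w) \<and> (e \<cdot> w) \<cdot> u = h"
      using E v w v(6)[THEN comp_reduce, of u] by (intro exI[of _ "v \<cdot> u"]) simp
  next
    fix u u' assume u: "u \<in> Arr \<A>" "u' \<in> Arr \<A>" "Dom \<A> u = Dom \<A> u'" "Cod \<A> u = Dom \<A> (e \<cdot> w)"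
      "Cod \<A> u' = Dom \<A> (e \<cdot> w)" "(e \<cdot> w) \<cdot> u = (e \<cdot> w) \<cdot> u'"
    then have "w \<cdot> u = w \<cdot> u'" using E v w by - (rule equalizer_mono[OF e], simp_all)
    then show "u = u'" using u E v w by - (rule iso_cancel_left[OF w(1)], simp_all)
  qed (use E v w E(7)[THEN comp_reduce, of w] in simp_all)
qed

lemma equalizers_isomorphic:
  assumes e: "is_equalizer \<A> f g e" and e': "is_equalizer \<A> f g e'"
  obtains w where "is_iso \<A> w" "Dom \<A> w = Dom \<A> e'" "Cod \<A> w = Dom \<A> e" "e \<cdot> w = e'"
proof -
  note E = equalizer_simps[OF e] and E' = equalizer_simps[OF e']
  have "Cod \<A> e' = Dom \<A> f" "Cod \<A> e = Dom \<A> f" using E E' by simp_all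
  note factor = equalizer_factor[OF e E'(5) this(1) E'(7)] equalizer_factor[OF e' E(5) this(2) E(7)]
  obtain w where w: "w \<in> Arr \<A>" "Dom \<A> w = Dom \<A> e'" "Cod \<A> w = Dom \<A> e" "e \<cdot> w = e'"
    by (rule factor(1))
  obtain v where v: "v \<in> Arr \<A>" "Dom \<A> v = Dom \<A> e" "Cod \<A> v = Dom \<A> e'" "e' \<cdot> v = e"
    by (rule factor(2))
  have "e' \<cdot> (v \<cdot> w) = e' \<cdot> Ident \<A> (Dom \<A> e')"
    using v(4)[THEN comp_reduce, of w] w v E E' by simp
  then have 1: "v \<cdot> w = Ident \<A> (Dom \<A> e')" using w v E' by - (rule equalizer_mono[OF e'], simp_all)
  have "e \<cdot> (w \<cdot> v) = e \<cdot> Ident \<A> (Dom \<A> e)"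
    using w(4)[THEN comp_reduce, of v] w v E E' by simp
  then have 2: "w \<cdot> v = Ident \<A> (Dom \<A> e)" using w v E by - (rule equalizer_mono[OF e], simp_all)
  have "is_iso \<A> w" using 1 2 w v by (intro is_isoI[of w "Dom \<A> e'" "Dom \<A> e" v]) (auto simp: Hom_iff)
  then show thesis using that w by blast
qed

text \<open>An arrow \<open>h\<close> that equalizes the pair factors through \<open>p \<cdot> h\<close>, because \<open>e \<cdot> p = q \<cdot> g\<close>
  and \<open>q \<cdot> f = 1\<close>.\<close>

lemma split_cofork_equalizer:
  assumes "split_cofork \<A> e f g"
  shows "is_equalizer \<A> f g e"
proof -
  obtain p q where c: "f \<in> Arr \<A>" "g \<in> Arr \<A>" "Dom \<A> f = Dom \<A> g" "Cod \<A> f = Cod \<A> g" "e \<in> Arr \<A>"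
    "Cod \<A> e = Dom \<A> g" "f \<cdot> e = g \<cdot> e" "p \<in> Arr \<A>" "Dom \<A> p = Dom \<A> g" "Cod \<A> p = Dom \<A> e"
    "q \<in> Arr \<A>" "Dom \<A> q = Cod \<A> g" "Cod \<A> q = Dom \<A> g" "p \<cdot> e = Ident \<A> (Dom \<A> e)"
    "q \<cdot> f = Ident \<A> (Dom \<A> g)" "e \<cdot> p = q \<cdot> g"
    using assms by (auto simp: split_cofork_def parallel_pair_def Hom_iff)
  show ?thesis
  proof (rule is_equalizerI)
    fix h assume h: "h \<in> Arr \<A>" "Cod \<A> h = Dom \<A> f" "f \<cdot> h = g \<cdot> h"
    have "e \<cdot> (p \<cdot> h) = q \<cdot> (g \<cdot> h)" using c h c(16)[THEN comp_reduce, of h] by simp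
    also have "\<dots> = h" using c h c(15)[THEN comp_reduce, of h] unfolding h(3)[symmetric] by simp
    finally show "\<exists>u. u \<in> Arr \<A> \<and> Dom \<A> u = Dom \<A> h \<and> Cod \<A> u = Dom \<A> e \<and> e \<cdot> u = h"
      using c h by (intro exI[of _ "p \<cdot> h"]) simp
  next
    fix u v assume u: "u \<in> Arr \<A>" "v \<in> Arr \<A>" "Cod \<A> u = Dom \<A> e"
      "Cod \<A> v = Dom \<A> e" "e \<cdot> u = e \<cdot> v"
    have "p \<cdot> (e \<cdot> u) = p \<cdot> (e \<cdot> v)" using u(5) by simp
    then show "u = v" using u(1-4) c(1-13) by (simp add: c(14) c(14)[THEN comp_reduce])
  qed (use c in simp_all)
qed

text \<open>
  If \<open>a\<close>, \<open>b\<close> identify the pair \<open>f'\<close>, \<open>g'\<close> with \<open>f\<close>, \<open>g\<close>, then \<open>a\<^sup>-\<^sup>1 e\<close> is split by \<open>p a\<close> and \<open>a\<^sup>-\<^sup>1 q b\<close>.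
  This carries a splitting across the Galois map.
\<close>

lemma split_cofork_transport:
  assumes "split_cofork \<A> e f g"
    and a: "is_iso \<A> a" "Cod \<A> a = Dom \<A> f" and b: "is_iso \<A> b" "Cod \<A> b = Cod \<A> f"
    and f': "f' \<in> Hom \<A> (Dom \<A> a) (Dom \<A> b)" "b \<cdot> f' = f \<cdot> a"
    and g': "g' \<in> Hom \<A> (Dom \<A> a) (Dom \<A> b)" "b \<cdot> g' = g \<cdot> a"
  shows "\<exists>e'. split_cofork \<A> e' f' g'"
proof -
  obtain p q where c: "f \<in> Arr \<A>" "g \<in> Arr \<A>" "Dom \<A> f = Dom \<A> g" "Cod \<A> f = Cod \<A> g" "e \<in> Arr \<A>"
    "Cod \<A> e = Dom \<A> g" "f \<cdot> e = g \<cdot> e" "p \<in> Arr \<A>" "Dom \<A> p = Dom \<A> g" "Cod \<A> p = Dom \<A> e"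
    "q \<in> Arr \<A>" "Dom \<A> q = Cod \<A> g" "Cod \<A> q = Dom \<A> g" "p \<cdot> e = Ident \<A> (Dom \<A> e)"
    "q \<cdot> f = Ident \<A> (Dom \<A> g)" "e \<cdot> p = q \<cdot> g"
    using assms(1) by (auto simp: split_cofork_def parallel_pair_def Hom_iff)
  obtain a' where a': "a \<in> Arr \<A>" "a' \<in> Arr \<A>" "Dom \<A> a' = Cod \<A> a" "Cod \<A> a' = Dom \<A> a"
    "a' \<cdot> a = Ident \<A> (Dom \<A> a)" "a \<cdot> a' = Ident \<A> (Cod \<A> a)" using a(1) by (rule is_isoE)
  have bA: "b \<in> Arr \<A>" using b(1) by (simp add: is_iso_def)
  have h: "f' \<in> Arr \<A>" "Dom \<A> f' = Dom \<A> a" "Cod \<A> f' = Dom \<A> b"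
    "g' \<in> Arr \<A>" "Dom \<A> g' = Dom \<A> a" "Cod \<A> g' = Dom \<A> b" using f' g' by (simp_all add: Hom_iff)
  have "b \<cdot> (f' \<cdot> (a' \<cdot> e)) = b \<cdot> (g' \<cdot> (a' \<cdot> e))"
    using f'(2)[THEN comp_reduce, of "a' \<cdot> e"] g'(2)[THEN comp_reduce, of "a' \<cdot> e"]
      a'(6)[THEN comp_reduce, of e] a' bA b a h c by simp
  then have eq: "f' \<cdot> (a' \<cdot> e) = g' \<cdot> (a' \<cdot> e)"
    using a a' h c by - (rule iso_cancel_left[OF b(1)], simp_all)
  have "split_cofork \<A> (a' \<cdot> e) f' g'"
    unfolding split_cofork_def parallel_pair_def
  proof (intro conjI)
    show "\<exists>p\<in>Hom \<A> (Dom \<A> f') (Dom \<A> (a' \<cdot> e)). \<exists>q\<in>Hom \<A> (Cod \<A> f') (Dom \<A> f').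
      p \<cdot> (a' \<cdot> e) = Ident \<A> (Dom \<A> (a' \<cdot> e)) \<and> q \<cdot> f' = Ident \<A> (Dom \<A> f') \<and> (a' \<cdot> e) \<cdot> p = q \<cdot> g'"
    proof (rule bexI[of _ "p \<cdot> a"], rule bexI[of _ "a' \<cdot> (q \<cdot> b)"], intro conjI)
      show "(p \<cdot> a) \<cdot> (a' \<cdot> e) = Ident \<A> (Dom \<A> (a' \<cdot> e))"
        using a'(6)[THEN comp_reduce, of e] a a' c by simp
      show "(a' \<cdot> (q \<cdot> b)) \<cdot> f' = Ident \<A> (Dom \<A> f')"
        using f'(2) c(15)[THEN comp_reduce, of a] a b bA a' c h by simp
      show "(a' \<cdot> e) \<cdot> (p \<cdot> a) = (a' \<cdot> (q \<cdot> b)) \<cdot> g'"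
        using g'(2) c(16)[THEN comp_reduce, of a] a b bA a' c h by simp
    qed (use a a' b bA h c in \<open>simp_all add: Hom_iff\<close>)
  qed (use eq a a' b bA h c in simp_all)
  then show ?thesis by blast
qed

end

section \<open>Categories of structured objects\<close>

lemma struct_cat_simps [simp]:
  "Obj (struct_cat \<A> Ob U P) = Ob"
  "(x, f, y) \<in> Arr (struct_cat \<A> Ob U P) \<longleftrightarrow>
     x \<in> Ob \<and> y \<in> Ob \<and> f \<in> Hom \<A> (U x) (U y) \<and> P x y f"
  "Dom (struct_cat \<A> Ob U P) (x, f, y) = x"
  "Cod (struct_cat \<A> Ob U P) (x, f, y) = y"
  "Ident (struct_cat \<A> Ob U P) x = (x, Ident \<A> (U x), x)"
  "(y', g, z) \<cdot>\<^bsub>struct_cat \<A> Ob U P\<^esub> (x, f, y) = (x, g \<cdot>\<^bsub>\<A>\<^esub> f, z)"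
  by (simp_all add: struct_cat_def)

lemma category_struct_cat:
  assumes "category \<A>"
    and "\<And>x. x \<in> Ob \<Longrightarrow> U x \<in> Obj \<A>"
    and "\<And>x. x \<in> Ob \<Longrightarrow> P x x (Ident \<A> (U x))"
    and "\<And>x y z f g. x \<in> Ob \<Longrightarrow> y \<in> Ob \<Longrightarrow> z \<in> Ob \<Longrightarrow> f \<in> Hom \<A> (U x) (U y) \<Longrightarrow> g \<in> Hom \<A> (U y) (U z) \<Longrightarrow>
      P x y f \<Longrightarrow> P y z g \<Longrightarrow> P x z (g \<cdot>\<^bsub>\<A>\<^esub> f)"
  shows "category (struct_cat \<A> Ob U P)"
proof -
  interpret category \<A> by fact
  show ?thesis
  proof
    fix X Y Z f g
    assume "f \<in> Hom (struct_cat \<A> Ob U P) X Y" "g \<in> Hom (struct_cat \<A> Ob U P) Y Z"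
    then show "g \<cdot>\<^bsub>struct_cat \<A> Ob U P\<^esub> f \<in> Hom (struct_cat \<A> Ob U P) X Z"
      by (cases f; cases g) (auto simp: Hom_iff[of _ "struct_cat \<A> Ob U P"] intro: Comp_Hom assms(4))
  qed (auto simp: Hom_iff Ident_simps[OF assms(2)] assms(3))
qed

lemma struct_cat_iso_underlying:
  assumes "is_iso (struct_cat \<A> Ob U P) (x, f, y)"
  shows "is_iso \<A> f"
  using assms by (auto simp: is_iso_def Hom_iff)

section \<open>Monads and comonads\<close>

lemma natural_transformationD:
  assumes "natural_transformation \<A> \<B> F G t"
  shows "X \<in> Obj \<A> \<Longrightarrow> t X \<in> Hom \<B> (Fo F X) (Fo G X)"
    and "f \<in> Arr \<A> \<Longrightarrow> Cod \<A> f = Y \<Longrightarrow> t Y \<cdot>\<^bsub>\<B>\<^esub> Fa F f = Fa G f \<cdot>\<^bsub>\<B>\<^esub> t (Dom \<A> f)"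
  using assms by (auto simp: natural_transformation_def)

context cat_monad
begin

lemma Mu_simps [simp]:
  assumes "X \<in> Obj \<A>"
  shows "Mu S X \<in> Arr \<A>" "Dom \<A> (Mu S X) = Fo S (Fo S X)" "Cod \<A> (Mu S X) = Fo S X"
  using natural_transformationD(1)[OF Mu_natural assms] by (simp_all add: Hom_iff comp_func_def)

lemma Iota_simps [simp]:
  assumes "X \<in> Obj \<A>"
  shows "Iota S X \<in> Arr \<A>" "Dom \<A> (Iota S X) = X" "Cod \<A> (Iota S X) = Fo S X"
  using natural_transformationD(1)[OF Iota_natural assms] by (simp_all add: Hom_iff id_func_def)

lemma Mu_nat: "f \<in> Arr \<A> \<Longrightarrow> Cod \<A> f = Y \<Longrightarrow>
    Mu S Y \<cdot>\<^bsub>\<A>\<^esub> Fa S (Fa S f) = Fa S f \<cdot>\<^bsub>\<A>\<^esub> Mu S (Dom \<A> f)"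
  using natural_transformationD(2)[OF Mu_natural] by (simp add: comp_func_def)

lemma Iota_nat: "f \<in> Arr \<A> \<Longrightarrow> Cod \<A> f = Y \<Longrightarrow>
    Iota S Y \<cdot>\<^bsub>\<A>\<^esub> f = Fa S f \<cdot>\<^bsub>\<A>\<^esub> Iota S (Dom \<A> f)"
  using natural_transformationD(2)[OF Iota_natural] by (simp add: id_func_def)

end

locale cat_comonad = cat_functor \<A> \<A> G
  for \<A> :: "('o, 'a, 'y) cat_scheme" and G :: "('o, 'a, 'o, 'a, 'z) func_scheme" +
  fixes \<delta> \<epsilon> :: "'o \<Rightarrow> 'a"
  assumes comult_natural: "natural_transformation \<A> \<A> G (comp_func G G) \<delta>"
    and counit_natural: "natural_transformation \<A> \<A> G id_func \<epsilon>"
    and comult_coassoc: "N \<in> Obj \<A> \<Longrightarrow> \<delta> (Fo G N) \<cdot>\<^bsub>\<A>\<^esub> \<delta> N = Fa G (\<delta> N) \<cdot>\<^bsub>\<A>\<^esub> \<delta> N"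
    and counit_comult: "N \<in> Obj \<A> \<Longrightarrow> \<epsilon> (Fo G N) \<cdot>\<^bsub>\<A>\<^esub> \<delta> N = Ident \<A> (Fo G N)"
    and Fa_counit_comult: "N \<in> Obj \<A> \<Longrightarrow> Fa G (\<epsilon> N) \<cdot>\<^bsub>\<A>\<^esub> \<delta> N = Ident \<A> (Fo G N)"
begin

lemma comult_simps [simp]:
  assumes "X \<in> Obj \<A>"
  shows "\<delta> X \<in> Arr \<A>" "Dom \<A> (\<delta> X) = Fo G X" "Cod \<A> (\<delta> X) = Fo G (Fo G X)"
  using natural_transformationD(1)[OF comult_natural assms] by (simp_all add: Hom_iff comp_func_def)

lemma counit_simps [simp]:
  assumes "X \<in> Obj \<A>"
  shows "\<epsilon> X \<in> Arr \<A>" "Dom \<A> (\<epsilon> X) = Fo G X" "Cod \<A> (\<epsilon> X) = X"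
  using natural_transformationD(1)[OF counit_natural assms] by (simp_all add: Hom_iff id_func_def)

lemma comult_nat: "f \<in> Arr \<A> \<Longrightarrow> Cod \<A> f = Y \<Longrightarrow>
    \<delta> Y \<cdot>\<^bsub>\<A>\<^esub> Fa G f = Fa G (Fa G f) \<cdot>\<^bsub>\<A>\<^esub> \<delta> (Dom \<A> f)"
  using natural_transformationD(2)[OF comult_natural] by (simp add: comp_func_def)

lemma counit_nat: "f \<in> Arr \<A> \<Longrightarrow> Cod \<A> f = Y \<Longrightarrow>
    \<epsilon> Y \<cdot>\<^bsub>\<A>\<^esub> Fa G f = f \<cdot>\<^bsub>\<A>\<^esub> \<epsilon> (Dom \<A> f)"
  using natural_transformationD(2)[OF counit_natural] by (simp add: id_func_def)

definition is_coalgebra :: "'o \<Rightarrow> 'a \<Rightarrow> bool" where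
  "is_coalgebra N c \<longleftrightarrow> N \<in> Obj \<A> \<and> c \<in> Hom \<A> N (Fo G N) \<and>
    \<delta> N \<cdot>\<^bsub>\<A>\<^esub> c = Fa G c \<cdot>\<^bsub>\<A>\<^esub> c \<and> \<epsilon> N \<cdot>\<^bsub>\<A>\<^esub> c = Ident \<A> N"

definition coalgebra_cat :: "('o \<times> 'a, ('o \<times> 'a) \<times> 'a \<times> ('o \<times> 'a)) cat" where
  "coalgebra_cat = struct_cat \<A> {(N, c). is_coalgebra N c} fst
    (\<lambda>(_, c) (_, c') f. c' \<cdot>\<^bsub>\<A>\<^esub> f = Fa G f \<cdot>\<^bsub>\<A>\<^esub> c)"

lemma is_coalgebra_simps:
  assumes "is_coalgebra N c"
  shows "N \<in> Obj \<A>" "c \<in> Arr \<A>" "Dom \<A> c = N" "Cod \<A> c = Fo G N"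
    "\<delta> N \<cdot>\<^bsub>\<A>\<^esub> c = Fa G c \<cdot>\<^bsub>\<A>\<^esub> c" "\<epsilon> N \<cdot>\<^bsub>\<A>\<^esub> c = Ident \<A> N"
  using assms by (auto simp: is_coalgebra_def Hom_iff)

lemma cofree_coalgebra: "N \<in> Obj \<A> \<Longrightarrow> is_coalgebra (Fo G N) (\<delta> N)"
  by (simp add: is_coalgebra_def Hom_iff comult_coassoc counit_comult)

end

section \<open>Equalizers of coalgebras\<close>

context cat_comonad
begin

lemma coalgebra_cat_simps [simp]:
  "(N, c) \<in> Obj coalgebra_cat \<longleftrightarrow> is_coalgebra N c"
  "((N, c), f, (N', c')) \<in> Arr coalgebra_cat \<longleftrightarrow>
    is_coalgebra N c \<and> is_coalgebra N' c' \<and> f \<in> Hom \<A> N N' \<and> c' \<cdot>\<^bsub>\<A>\<^esub> f = Fa G f \<cdot>\<^bsub>\<A>\<^esub> c"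
  "Dom coalgebra_cat (X, f, Y) = X"
  "Cod coalgebra_cat (X, f, Y) = Y"
  "Ident coalgebra_cat X = (X, Ident \<A> (fst X), X)"
  "(Y', g, Z) \<cdot>\<^bsub>coalgebra_cat\<^esub> (X, f, Y) = (X, g \<cdot>\<^bsub>\<A>\<^esub> f, Z)"
  by (simp_all add: coalgebra_cat_def)

lemma category_coalgebra_cat: "category coalgebra_cat"
  unfolding coalgebra_cat_def
proof (rule category_struct_cat)
  show "category \<A>" by (rule A.category_axioms)
qed (auto simp: is_coalgebra_simps Hom_iff, metis A.comp_assoc A.comp_reduce Fa_on_Comp Fa_simps is_coalgebra_simps)

sublocale CG: category coalgebra_cat
  by (rule category_coalgebra_cat)

lemma coalgebra_arr_cases:
  assumes "t \<in> Arr coalgebra_cat"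
  obtains N c f N' c' where "t = ((N, c), f, (N', c'))" "is_coalgebra N c" "is_coalgebra N' c'"
    "f \<in> Arr \<A>" "Dom \<A> f = N" "Cod \<A> f = N'" "c' \<cdot>\<^bsub>\<A>\<^esub> f = Fa G f \<cdot>\<^bsub>\<A>\<^esub> c"
  using assms by (cases t) (auto simp: Hom_iff)

lemma coalgebra_iso:
  assumes "((N, c), f, (N', c')) \<in> Arr coalgebra_cat" "is_iso \<A> f"
  shows "is_iso coalgebra_cat ((N, c), f, (N', c'))"
proof -
  have f: "is_coalgebra N c" "is_coalgebra N' c'" "f \<in> Arr \<A>" "Dom \<A> f = N" "Cod \<A> f = N'"
    "c' \<cdot>\<^bsub>\<A>\<^esub> f = Fa G f \<cdot>\<^bsub>\<A>\<^esub> c"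
    using assms(1) by (auto simp: Hom_iff)
  note c = is_coalgebra_simps[OF f(1)] is_coalgebra_simps[OF f(2)]
  obtain g where g: "g \<in> Arr \<A>" "Dom \<A> g = N'" "Cod \<A> g = N"
    "g \<cdot>\<^bsub>\<A>\<^esub> f = Ident \<A> N" "f \<cdot>\<^bsub>\<A>\<^esub> g = Ident \<A> N'"
    using assms(2) f(3-5) by (auto elim: A.is_isoE)
  have "(c \<cdot>\<^bsub>\<A>\<^esub> g) \<cdot>\<^bsub>\<A>\<^esub> f = (Fa G g \<cdot>\<^bsub>\<A>\<^esub> c') \<cdot>\<^bsub>\<A>\<^esub> f"
    using c(1-4,7-10) f(3-6) g by (simp add: Fa_eq[OF g(4), THEN A.comp_reduce])
  then have "c \<cdot>\<^bsub>\<A>\<^esub> g = Fa G g \<cdot>\<^bsub>\<A>\<^esub> c'"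
    using c(1-4,7-10) f(3-5) g by - (rule A.iso_cancel_right[OF assms(2)], simp_all)
  then show ?thesis
    using f g by (intro CG.is_isoI[of _ "(N, c)" "(N', c')" "((N', c'), g, (N, c))"]) (auto simp: Hom_iff)
qed

text \<open>
  The coaction on the equalizer \<open>e\<close> is induced from that of its codomain because \<open>G\<close> sends \<open>e\<close> to an
  equalizer again; coassociativity holds because \<open>G\<^sup>2\<close> sends \<open>e\<close> to a monomorphism.
\<close>

lemma equalizer_lifts:
  assumes f: "((N, c), f, (N', c')) \<in> Arr coalgebra_cat" and g: "((N, c), g, (N', c')) \<in> Arr coalgebra_cat"
    and e: "is_equalizer \<A> f g e" and Ge: "is_equalizer \<A> (Fa G f) (Fa G g) (Fa G e)"
    and GGe: "is_equalizer \<A> (Fa G (Fa G f)) (Fa G (Fa G g)) (Fa G (Fa G e))"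
  shows "\<exists>d. is_equalizer coalgebra_cat ((N, c), f, (N', c')) ((N, c), g, (N', c')) ((Dom \<A> e, d), e, (N, c))"
proof -
  let ?E = "Dom \<A> e"
  have F: "is_coalgebra N c" "is_coalgebra N' c'" "f \<in> Arr \<A>" "Dom \<A> f = N" "Cod \<A> f = N'"
    "c' \<cdot>\<^bsub>\<A>\<^esub> f = Fa G f \<cdot>\<^bsub>\<A>\<^esub> c" "g \<in> Arr \<A>" "Dom \<A> g = N" "Cod \<A> g = N'"
    "c' \<cdot>\<^bsub>\<A>\<^esub> g = Fa G g \<cdot>\<^bsub>\<A>\<^esub> c"
    using f g by (auto simp: Hom_iff)
  note c = is_coalgebra_simps[OF F(1)] and c' = is_coalgebra_simps[OF F(2)]
  have e': "e \<in> Arr \<A>" "Cod \<A> e = N" "f \<cdot>\<^bsub>\<A>\<^esub> e = g \<cdot>\<^bsub>\<A>\<^esub> e"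
    using A.equalizer_simps[OF e] F by simp_all
  have "Fa G f \<cdot>\<^bsub>\<A>\<^esub> (c \<cdot>\<^bsub>\<A>\<^esub> e) = c' \<cdot>\<^bsub>\<A>\<^esub> (f \<cdot>\<^bsub>\<A>\<^esub> e)"
    using F(3-5) c(1-4) c'(1-4) e'(1,2) by (simp add: F(6)[THEN A.comp_reduce])
  also have "\<dots> = Fa G g \<cdot>\<^bsub>\<A>\<^esub> (c \<cdot>\<^bsub>\<A>\<^esub> e)"
    unfolding e'(3) using F(7-9) c(1-4) c'(1-4) e'(1,2) by (simp add: F(10)[THEN A.comp_reduce])
  finally have *: "Fa G f \<cdot>\<^bsub>\<A>\<^esub> (c \<cdot>\<^bsub>\<A>\<^esub> e) = Fa G g \<cdot>\<^bsub>\<A>\<^esub> (c \<cdot>\<^bsub>\<A>\<^esub> e)" .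
  obtain d where d: "d \<in> Arr \<A>" "Dom \<A> d = ?E" "Cod \<A> d = Fo G ?E" "Fa G e \<cdot>\<^bsub>\<A>\<^esub> d = c \<cdot>\<^bsub>\<A>\<^esub> e"
    using A.equalizer_factor[OF Ge _ _ *] F(3,4) c(1-4) e' by auto
  note ty = c(1-4) c'(1-4) e'(1,2) d(1-3)
  have "Fa G (Fa G e) \<cdot>\<^bsub>\<A>\<^esub> (\<delta> ?E \<cdot>\<^bsub>\<A>\<^esub> d) = \<delta> N \<cdot>\<^bsub>\<A>\<^esub> (Fa G e \<cdot>\<^bsub>\<A>\<^esub> d)"
    using ty by (simp add: comult_nat[of e N, THEN A.comp_reduce])
  also have "\<dots> = Fa G c \<cdot>\<^bsub>\<A>\<^esub> (c \<cdot>\<^bsub>\<A>\<^esub> e)"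
    using ty by (simp add: d(4) c(5)[THEN A.comp_reduce])
  also have "\<dots> = Fa G (c \<cdot>\<^bsub>\<A>\<^esub> e) \<cdot>\<^bsub>\<A>\<^esub> d"
    using ty by (simp add: d(4))
  also have "\<dots> = Fa G (Fa G e) \<cdot>\<^bsub>\<A>\<^esub> (Fa G d \<cdot>\<^bsub>\<A>\<^esub> d)"
    unfolding d(4)[symmetric] using ty by simp
  finally have "\<delta> ?E \<cdot>\<^bsub>\<A>\<^esub> d = Fa G d \<cdot>\<^bsub>\<A>\<^esub> d"
    using ty by - (rule A.equalizer_mono[OF GGe], simp_all)
  moreover have "e \<cdot>\<^bsub>\<A>\<^esub> (\<epsilon> ?E \<cdot>\<^bsub>\<A>\<^esub> d) = e \<cdot>\<^bsub>\<A>\<^esub> Ident \<A> ?E"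
  proof -
    have "e \<cdot>\<^bsub>\<A>\<^esub> (\<epsilon> ?E \<cdot>\<^bsub>\<A>\<^esub> d) = \<epsilon> N \<cdot>\<^bsub>\<A>\<^esub> (Fa G e \<cdot>\<^bsub>\<A>\<^esub> d)"
      using ty by (simp add: counit_nat[of e N, THEN A.comp_reduce])
    also have "\<dots> = e" using ty by (simp add: d(4) c(6)[THEN A.comp_reduce])
    finally show ?thesis using ty by simp
  qed
  then have "\<epsilon> ?E \<cdot>\<^bsub>\<A>\<^esub> d = Ident \<A> ?E" using ty by - (rule A.equalizer_mono[OF e], simp_all)
  ultimately have coalg: "is_coalgebra ?E d" using ty by (simp add: is_coalgebra_def Hom_iff)
  have "is_equalizer coalgebra_cat ((N, c), f, (N', c')) ((N, c), g, (N', c')) ((?E, d), e, (N, c))"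
  proof (rule CG.is_equalizerI)
    fix t assume t: "t \<in> Arr coalgebra_cat" "Cod coalgebra_cat t = Dom coalgebra_cat ((N, c), f, (N', c'))"
      and eq: "((N, c), f, (N', c')) \<cdot>\<^bsub>coalgebra_cat\<^esub> t = ((N, c), g, (N', c')) \<cdot>\<^bsub>coalgebra_cat\<^esub> t"
    obtain K k h where h: "t = ((K, k), h, (N, c))" "is_coalgebra K k" "h \<in> Arr \<A>" "Dom \<A> h = K"
      "Cod \<A> h = N" "c \<cdot>\<^bsub>\<A>\<^esub> h = Fa G h \<cdot>\<^bsub>\<A>\<^esub> k"
      using t by (auto elim!: coalgebra_arr_cases)
    note k = is_coalgebra_simps[OF h(2)]
    have "f \<cdot>\<^bsub>\<A>\<^esub> h = g \<cdot>\<^bsub>\<A>\<^esub> h" using eq by (simp add: h)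
    then obtain u where u: "u \<in> Arr \<A>" "Dom \<A> u = K" "Cod \<A> u = ?E" "e \<cdot>\<^bsub>\<A>\<^esub> u = h"
      using A.equalizer_factor[OF e h(3)] h F by auto
    have "Fa G e \<cdot>\<^bsub>\<A>\<^esub> (d \<cdot>\<^bsub>\<A>\<^esub> u) = c \<cdot>\<^bsub>\<A>\<^esub> h"
      using ty u(1-3) by (simp add: d(4)[THEN A.comp_reduce] u(4))
    also have "\<dots> = Fa G (e \<cdot>\<^bsub>\<A>\<^esub> u) \<cdot>\<^bsub>\<A>\<^esub> k" by (simp add: h(6) u(4))
    also have "\<dots> = Fa G e \<cdot>\<^bsub>\<A>\<^esub> (Fa G u \<cdot>\<^bsub>\<A>\<^esub> k)" using ty u(1-3) k(1-4) by simp
    finally have "d \<cdot>\<^bsub>\<A>\<^esub> u = Fa G u \<cdot>\<^bsub>\<A>\<^esub> k"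
      using ty u(1-3) k(1-4) by - (rule A.equalizer_mono[OF Ge], simp_all)
    then show "\<exists>u. u \<in> Arr coalgebra_cat \<and> Dom coalgebra_cat u = Dom coalgebra_cat t \<and>
        Cod coalgebra_cat u = Dom coalgebra_cat ((?E, d), e, (N, c)) \<and>
        ((?E, d), e, (N, c)) \<cdot>\<^bsub>coalgebra_cat\<^esub> u = t"
      using u h coalg by (intro exI[of _ "((K, k), u, (?E, d))"]) (simp add: Hom_iff)
  next
    fix u v assume "u \<in> Arr coalgebra_cat" "v \<in> Arr coalgebra_cat"
      "Dom coalgebra_cat u = Dom coalgebra_cat v"
      "Cod coalgebra_cat u = Dom coalgebra_cat ((?E, d), e, (N, c))"
      "Cod coalgebra_cat v = Dom coalgebra_cat ((?E, d), e, (N, c))"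
      "((?E, d), e, (N, c)) \<cdot>\<^bsub>coalgebra_cat\<^esub> u = ((?E, d), e, (N, c)) \<cdot>\<^bsub>coalgebra_cat\<^esub> v"
    then show "u = v" by (auto elim!: coalgebra_arr_cases intro: A.equalizer_mono[OF e])
  qed (use f g F e' ty coalg d in \<open>simp_all add: Hom_iff\<close>)
  then show ?thesis by blast
qed

end

section \<open>Algebras of a monad\<close>

lemma is_algebra_simps:
  assumes "is_algebra \<A> S N \<sigma>"
  shows "N \<in> Obj \<A>" "\<sigma> \<in> Arr \<A>" "Dom \<A> \<sigma> = Fo S N" "Cod \<A> \<sigma> = N"
    "\<sigma> \<cdot>\<^bsub>\<A>\<^esub> Fa S \<sigma> = \<sigma> \<cdot>\<^bsub>\<A>\<^esub> Mu S N" "\<sigma> \<cdot>\<^bsub>\<A>\<^esub> Iota S N = Ident \<A> N"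
  using assms by (auto simp: is_algebra_def Hom_iff)

context cat_monad
begin

lemma free_algebra_is_algebra: "N \<in> Obj \<A> \<Longrightarrow> is_algebra \<A> S (Fo S N) (Mu S N)"
  by (simp add: is_algebra_def Hom_iff Mu_assoc Mu_Iota_left)

lemma algebra_map_comp:
  assumes "is_algebra \<A> S N \<sigma>" "is_algebra \<A> S N' \<sigma>'" "is_algebra \<A> S N'' \<sigma>''"
    and f: "f \<in> Hom \<A> N N'" "f \<cdot>\<^bsub>\<A>\<^esub> \<sigma> = \<sigma>' \<cdot>\<^bsub>\<A>\<^esub> Fa S f" and g: "g \<in> Hom \<A> N' N''" "g \<cdot>\<^bsub>\<A>\<^esub> \<sigma>' = \<sigma>'' \<cdot>\<^bsub>\<A>\<^esub> Fa S g"
  shows "(g \<cdot>\<^bsub>\<A>\<^esub> f) \<cdot>\<^bsub>\<A>\<^esub> \<sigma> = \<sigma>'' \<cdot>\<^bsub>\<A>\<^esub> Fa S (g \<cdot>\<^bsub>\<A>\<^esub> f)"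
  using is_algebra_simps(1-4)[OF assms(1)] is_algebra_simps(1-4)[OF assms(2)]
    is_algebra_simps(1-4)[OF assms(3)] f(1) g(1) by (simp add: Hom_iff f(2) g(2)[THEN A.comp_reduce])

lemma algebra_map_inverse:
  assumes "is_algebra \<A> S N \<sigma>" "is_algebra \<A> S N' \<sigma>'" and iso: "is_iso \<A> f"
    and f: "f \<in> Hom \<A> N N'" "f \<cdot>\<^bsub>\<A>\<^esub> \<sigma> = \<sigma>' \<cdot>\<^bsub>\<A>\<^esub> Fa S f"
    and g: "g \<in> Hom \<A> N' N" "g \<cdot>\<^bsub>\<A>\<^esub> f = Ident \<A> N" "f \<cdot>\<^bsub>\<A>\<^esub> g = Ident \<A> N'"
  shows "g \<cdot>\<^bsub>\<A>\<^esub> \<sigma>' = \<sigma> \<cdot>\<^bsub>\<A>\<^esub> Fa S g"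
proof (rule A.iso_cancel_left[OF iso])
  have "Fa S f \<cdot>\<^bsub>\<A>\<^esub> Fa S g = Ident \<A> (Fo S N')"
    using f(1) g(1) is_algebra_simps(1)[OF assms(2)] by (simp add: Hom_iff Fa_eq[OF g(3)])
  then show "f \<cdot>\<^bsub>\<A>\<^esub> (g \<cdot>\<^bsub>\<A>\<^esub> \<sigma>') = f \<cdot>\<^bsub>\<A>\<^esub> (\<sigma> \<cdot>\<^bsub>\<A>\<^esub> Fa S g)"
    using is_algebra_simps(1-4)[OF assms(1)] is_algebra_simps(1-4)[OF assms(2)] f(1) g(1)
    by (simp add: Hom_iff f(2)[THEN A.comp_reduce] g(3)[THEN A.comp_reduce])
qed (use is_algebra_simps(1-4)[OF assms(1)] is_algebra_simps(1-4)[OF assms(2)] f(1) g(1) in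
    \<open>simp_all add: Hom_iff\<close>)

lemma algebra_cat_simps [simp]:
  "(N, \<sigma>) \<in> Obj (algebra_cat \<A> S) \<longleftrightarrow> is_algebra \<A> S N \<sigma>"
  "((N, \<sigma>), f, (N', \<sigma>')) \<in> Arr (algebra_cat \<A> S) \<longleftrightarrow>
    is_algebra \<A> S N \<sigma> \<and> is_algebra \<A> S N' \<sigma>' \<and> f \<in> Hom \<A> N N' \<and> f \<cdot>\<^bsub>\<A>\<^esub> \<sigma> = \<sigma>' \<cdot>\<^bsub>\<A>\<^esub> Fa S f"
  "Dom (algebra_cat \<A> S) (X, f, Y) = X"
  "Cod (algebra_cat \<A> S) (X, f, Y) = Y"
  "Ident (algebra_cat \<A> S) X = (X, Ident \<A> (fst X), X)"
  "(Y', g, Z) \<cdot>\<^bsub>algebra_cat \<A> S\<^esub> (X, f, Y) = (X, g \<cdot>\<^bsub>\<A>\<^esub> f, Z)"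
  by (simp_all add: algebra_cat_def is_algebra_map_def)

lemma category_algebra_cat: "category (algebra_cat \<A> S)"
  unfolding algebra_cat_def
proof (rule category_struct_cat)
  show "category \<A>" by (rule A.category_axioms)
  fix x assume "x \<in> {(N, \<sigma>). is_algebra \<A> S N \<sigma>}"
  then show "fst x \<in> Obj \<A>"
    "(\<lambda>(_, \<sigma>) (_, \<sigma>') f. is_algebra_map \<A> S \<sigma> \<sigma>' f) x x (Ident \<A> (fst x))"
    using is_algebra_simps(1-4)[of \<A> S "fst x" "snd x"] by (auto simp: is_algebra_map_def)
next
  fix x y z f g
  assume "x \<in> {(N, \<sigma>). is_algebra \<A> S N \<sigma>}" "y \<in> {(N, \<sigma>). is_algebra \<A> S N \<sigma>}"
    "z \<in> {(N, \<sigma>). is_algebra \<A> S N \<sigma>}" "f \<in> Hom \<A> (fst x) (fst y)" "g \<in> Hom \<A> (fst y) (fst z)"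
    "(\<lambda>(_, \<sigma>) (_, \<sigma>') f. is_algebra_map \<A> S \<sigma> \<sigma>' f) x y f"
    "(\<lambda>(_, \<sigma>) (_, \<sigma>') f. is_algebra_map \<A> S \<sigma> \<sigma>' f) y z g"
  then show "(\<lambda>(_, \<sigma>) (_, \<sigma>') f. is_algebra_map \<A> S \<sigma> \<sigma>' f) x z (g \<cdot>\<^bsub>\<A>\<^esub> f)"
    using algebra_map_comp[of "fst x" "snd x" "fst y" "snd y" "fst z" "snd z" f g]
    by (auto simp: is_algebra_map_def)
qed

sublocale AA: category "algebra_cat \<A> S"
  by (rule category_algebra_cat)

lemma algebra_iso:
  assumes "((N, \<sigma>), f, (N', \<sigma>')) \<in> Arr (algebra_cat \<A> S)" "is_iso \<A> f"
  shows "is_iso (algebra_cat \<A> S) ((N, \<sigma>), f, (N', \<sigma>'))"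
proof -
  have f: "is_algebra \<A> S N \<sigma>" "is_algebra \<A> S N' \<sigma>'" "f \<in> Hom \<A> N N'" "f \<cdot>\<^bsub>\<A>\<^esub> \<sigma> = \<sigma>' \<cdot>\<^bsub>\<A>\<^esub> Fa S f"
    using assms(1) by auto
  obtain g where g: "g \<in> Hom \<A> N' N" "g \<cdot>\<^bsub>\<A>\<^esub> f = Ident \<A> N" "f \<cdot>\<^bsub>\<A>\<^esub> g = Ident \<A> N'"
    using assms(2) f(3) by (auto simp: Hom_iff elim: A.is_isoE)
  have "g \<cdot>\<^bsub>\<A>\<^esub> \<sigma>' = \<sigma> \<cdot>\<^bsub>\<A>\<^esub> Fa S g" by (rule algebra_map_inverse[OF f(1,2) assms(2) f(3,4) g])
  then show ?thesis
    using f g by (intro AA.is_isoI[of _ "(N, \<sigma>)" "(N', \<sigma>')" "((N', \<sigma>'), g, (N, \<sigma>))"])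
      (auto simp: Hom_iff[of _ "algebra_cat \<A> S"])
qed

end

section \<open>Modules over a mixed distributive law\<close>

text \<open>
  The axioms say that \<open>\<tau>\<close> lifts the comonad \<open>H\<close> to \<open>S\<close>-algebras; the modules below are the coalgebras of
  the lifted comonad.
\<close>

locale mixed_distributive_law =
  category \<A> + S: cat_monad \<A> S + H: cat_comonad \<A> H \<delta>' \<epsilon>'
  for \<A> :: "('o, 'a, 'x) cat_scheme" (structure) and S :: "('o, 'a, 'y) monad_scheme"
    and H :: "('o, 'a, 'o, 'a, 'z) func_scheme" and \<delta>' \<epsilon>' :: "'o \<Rightarrow> 'a" +
  fixes \<tau> :: "'o \<Rightarrow> 'a"
  assumes law_natural: "natural_transformation \<A> \<A> (comp_func S H) (comp_func H S) \<tau>"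
    and law_Mu: "N \<in> Obj \<A> \<Longrightarrow> \<tau> N \<cdot> Mu S (Fo H N) = Fa H (Mu S N) \<cdot> \<tau> (Fo S N) \<cdot> Fa S (\<tau> N)"
    and law_Iota: "N \<in> Obj \<A> \<Longrightarrow> \<tau> N \<cdot> Iota S (Fo H N) = Fa H (Iota S N)"
    and law_comult: "N \<in> Obj \<A> \<Longrightarrow> \<delta>' (Fo S N) \<cdot> \<tau> N = Fa H (\<tau> N) \<cdot> \<tau> (Fo H N) \<cdot> Fa S (\<delta>' N)"
    and law_counit: "N \<in> Obj \<A> \<Longrightarrow> \<epsilon>' (Fo S N) \<cdot> \<tau> N = Fa S (\<epsilon>' N)"
begin

lemma law_simps [simp]:
  assumes "X \<in> Obj \<A>"
  shows "\<tau> X \<in> Arr \<A>" "Dom \<A> (\<tau> X) = Fo S (Fo H X)" "Cod \<A> (\<tau> X) = Fo H (Fo S X)"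
  using natural_transformationD(1)[OF law_natural assms] by (simp_all add: Hom_iff comp_func_def)

lemma law_nat: "f \<in> Arr \<A> \<Longrightarrow> Cod \<A> f = Y \<Longrightarrow>
    \<tau> Y \<cdot> Fa S (Fa H f) = Fa H (Fa S f) \<cdot> \<tau> (Dom \<A> f)"
  using natural_transformationD(2)[OF law_natural] by (simp add: comp_func_def)

lemmas law_push = law_nat law_nat[THEN comp_reduce]
lemmas counit'_push = H.counit_nat H.counit_nat[THEN comp_reduce]
lemmas comult'_push = H.comult_nat H.comult_nat[THEN comp_reduce]

definition is_mixed_module :: "'o \<Rightarrow> 'a \<Rightarrow> 'a \<Rightarrow> bool" where
  "is_mixed_module N \<sigma> \<zeta> \<longleftrightarrow> is_algebra \<A> S N \<sigma> \<and> H.is_coalgebra N \<zeta> \<and>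
    \<zeta> \<cdot> \<sigma> = Fa H \<sigma> \<cdot> \<tau> N \<cdot> Fa S \<zeta>"

definition mixed_cat :: "('o \<times> 'a \<times> 'a, ('o \<times> 'a \<times> 'a) \<times> 'a \<times> ('o \<times> 'a \<times> 'a)) cat" where
  "mixed_cat = struct_cat \<A> {(N, \<sigma>, \<zeta>). is_mixed_module N \<sigma> \<zeta>} fst
    (\<lambda>(_, \<sigma>, \<zeta>) (_, \<sigma>', \<zeta>') f. is_algebra_map \<A> S \<sigma> \<sigma>' f \<and> \<zeta>' \<cdot> f = Fa H f \<cdot> \<zeta>)"

text \<open>
  The value of the lifted comonad at an algebra. Its associativity combines \<open>law_Mu\<close> with the
  associativity of \<open>\<sigma>\<close>, and its unit law combines \<open>law_Iota\<close> with that of \<open>\<sigma>\<close>.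
\<close>

lemma lifted_algebra:
  assumes "is_algebra \<A> S N \<sigma>"
  shows "is_algebra \<A> S (Fo H N) (Fa H \<sigma> \<cdot> \<tau> N)"
proof -
  note a = is_algebra_simps[OF assms]
  have "\<tau> N \<cdot> (Fa S (Fa H \<sigma>) \<cdot> Fa S (\<tau> N)) = Fa H (Fa S \<sigma>) \<cdot> (\<tau> (Fo S N) \<cdot> Fa S (\<tau> N))"
    using a(1-4) by (simp add: law_push)
  moreover have "Fa H \<sigma> \<cdot> (Fa H (Fa S \<sigma>) \<cdot> (\<tau> (Fo S N) \<cdot> Fa S (\<tau> N))) =
      Fa H \<sigma> \<cdot> (Fa H (Mu S N) \<cdot> (\<tau> (Fo S N) \<cdot> Fa S (\<tau> N)))"
    using a(1-4) by (simp add: H.Fa_eq[OF a(5)] H.Fa_eq[OF a(5), THEN comp_reduce])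
  moreover have "Fa H \<sigma> \<cdot> (\<tau> N \<cdot> Iota S (Fo H N)) = Ident \<A> (Fo H N)"
    using a(1-4) by (simp add: law_Iota H.Fa_eq[OF a(6)])
  ultimately show ?thesis
    using a(1-4) by (simp add: is_algebra_def Hom_iff law_Mu)
qed

lemma cofree_mixed_module:
  assumes "is_algebra \<A> S N \<sigma>"
  shows "is_mixed_module (Fo H N) (Fa H \<sigma> \<cdot> \<tau> N) (\<delta>' N)"
  using is_algebra_simps(1-4)[OF assms]
  by (simp add: is_mixed_module_def lifted_algebra[OF assms] H.cofree_coalgebra comult'_push law_comult)

end

section \<open>Change of comonad\<close>

text \<open>
  The transformation \<open>\<kappa>\<close> is determined by \<open>\<tau>\<close> and \<open>j\<close>. It is a parameter of its own because for Hopf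
  modules it is \<open>\<chi>\<^bsub>C,-\<^esub>\<close>, the primitive datum, from which the functors and the Galois map are built.
\<close>

locale comonad_change =
  mixed_distributive_law \<A> S H \<delta>' \<epsilon>' \<tau> + G: cat_comonad \<A> G \<delta> \<epsilon>
  for \<A> :: "('o, 'a, 'x) cat_scheme" (structure) and S :: "('o, 'a, 'y) monad_scheme"
    and H :: "('o, 'a, 'o, 'a, 'z) func_scheme" and \<delta>' \<epsilon>' \<tau>
    and G :: "('o, 'a, 'o, 'a, 'w) func_scheme" and \<delta> \<epsilon> +
  fixes j \<kappa> :: "'o \<Rightarrow> 'a"
  assumes change_natural: "natural_transformation \<A> \<A> G H j"
    and change_comult: "N \<in> Obj \<A> \<Longrightarrow> \<delta>' N \<cdot> j N = Fa H (j N) \<cdot> j (Fo G N) \<cdot> \<delta> N"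
    and change_counit: "N \<in> Obj \<A> \<Longrightarrow> \<epsilon>' N \<cdot> j N = \<epsilon> N"
    and \<kappa>_eq: "N \<in> Obj \<A> \<Longrightarrow> \<kappa> N = \<tau> N \<cdot> Fa S (j N)"
begin

lemma change_simps [simp]:
  assumes "X \<in> Obj \<A>"
  shows "j X \<in> Arr \<A>" "Dom \<A> (j X) = Fo G X" "Cod \<A> (j X) = Fo H X"
  using natural_transformationD(1)[OF change_natural assms] by (simp_all add: Hom_iff)

lemma change_nat: "f \<in> Arr \<A> \<Longrightarrow> Cod \<A> f = Y \<Longrightarrow> j Y \<cdot> Fa G f = Fa H f \<cdot> j (Dom \<A> f)"
  using natural_transformationD(2)[OF change_natural] by simp

lemma \<kappa>_simps [simp]:
  assumes "X \<in> Obj \<A>"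
  shows "\<kappa> X \<in> Arr \<A>" "Dom \<A> (\<kappa> X) = Fo S (Fo G X)" "Cod \<A> (\<kappa> X) = Fo H (Fo S X)"
  using assms by (simp_all add: \<kappa>_eq)

lemma \<kappa>_nat:
  assumes "f \<in> Arr \<A>" "Cod \<A> f = Y"
  shows "\<kappa> Y \<cdot> Fa S (Fa G f) = Fa H (Fa S f) \<cdot> \<kappa> (Dom \<A> f)"
proof -
  have "Fa S (j Y) \<cdot> Fa S (Fa G f) = Fa S (Fa H f) \<cdot> Fa S (j (Dom \<A> f))"
    using assms by (subst S.Fa_eq[OF change_nat[OF assms]]) auto
  then show ?thesis using assms by (auto simp add: \<kappa>_eq law_push)
qed

lemma \<kappa>_comult:
  assumes "N \<in> Obj \<A>"
  shows "\<delta>' (Fo S N) \<cdot> \<kappa> N = Fa H (\<kappa> N) \<cdot> \<kappa> (Fo G N) \<cdot> Fa S (\<delta> N)"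
proof -
  have "Fa S (\<delta>' N) \<cdot> Fa S (j N) = Fa S (Fa H (j N)) \<cdot> (Fa S (j (Fo G N)) \<cdot> Fa S (\<delta> N))"
    using assms by (simp add: S.Fa_eq[OF change_comult])
  then have "\<delta>' (Fo S N) \<cdot> (\<tau> N \<cdot> Fa S (j N)) =
      Fa H (\<tau> N) \<cdot> (\<tau> (Fo H N) \<cdot> (Fa S (Fa H (j N)) \<cdot> (Fa S (j (Fo G N)) \<cdot> Fa S (\<delta> N))))"
    using assms by (simp add: law_comult[THEN comp_reduce])
  then show ?thesis using assms by (simp add: \<kappa>_eq law_push)
qed

lemma \<kappa>_counit:
  assumes "N \<in> Obj \<A>"
  shows "\<epsilon>' (Fo S N) \<cdot> \<kappa> N = Fa S (\<epsilon> N)"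
  using assms by (simp add: \<kappa>_eq law_counit[THEN comp_reduce] S.Fa_eq[OF change_counit])

lemma \<kappa>_Mu:
  assumes "N \<in> Obj \<A>"
  shows "\<kappa> N \<cdot> Mu S (Fo G N) = Fa H (Mu S N) \<cdot> \<tau> (Fo S N) \<cdot> Fa S (\<kappa> N)"
  using assms S.Mu_nat[of "j N" "Fo H N", symmetric] 
  by (simp add: \<kappa>_eq law_Mu[THEN comp_reduce])

lemma \<kappa>_Iota:
  assumes "N \<in> Obj \<A>"
  shows "\<kappa> N \<cdot> Iota S (Fo G N) = Fa H (Iota S N) \<cdot> j N"
  using assms S.Iota_nat[of "j N" "Fo H N", symmetric]
  by (simp add: \<kappa>_eq law_Iota[THEN comp_reduce])

lemmas \<kappa>_push = \<kappa>_nat \<kappa>_nat[THEN comp_reduce]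

text \<open>
  At the free algebra \<open>(S N, \<mu>\<^sub>N)\<close> this is the usual Galois map; the extension to all algebras is the
  canonical transformation from the comonad \<open>S G\<close> on algebras to the lift of \<open>H\<close>.
\<close>

definition galois :: "'o \<Rightarrow> 'a \<Rightarrow> 'a" where
  "galois N \<sigma> = Fa H \<sigma> \<cdot> \<kappa> N"

lemma galois_simps [simp]:
  assumes "is_algebra \<A> S N \<sigma>"
  shows "galois N \<sigma> \<in> Arr \<A>" "Dom \<A> (galois N \<sigma>) = Fo S (Fo G N)" "Cod \<A> (galois N \<sigma>) = Fo H N"
  using is_algebra_simps(1-4)[OF assms] by (simp_all add: galois_def)

lemma galois_nat:
  assumes "is_algebra \<A> S N \<sigma>" "is_algebra \<A> S N' \<sigma>'" "h \<in> Arr \<A>" "Dom \<A> h = N" "Cod \<A> h = N'"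
    and h: "h \<cdot> \<sigma> = \<sigma>' \<cdot> Fa S h"
  shows "galois N' \<sigma>' \<cdot> Fa S (Fa G h) = Fa H h \<cdot> galois N \<sigma>"
proof -
  note a = is_algebra_simps(1-4)[OF assms(1)] is_algebra_simps(1-4)[OF assms(2)] assms(3-5)
  have *: "Fa H h \<cdot> Fa H \<sigma> = Fa H \<sigma>' \<cdot> Fa H (Fa S h)"
    using a by (simp add: H.Fa_eq[OF h])
  show ?thesis using a by (simp add: galois_def \<kappa>_push *[THEN comp_reduce])
qed

lemma galois_algebra_map:
  assumes "is_algebra \<A> S N \<sigma>"
  shows "galois N \<sigma> \<cdot> Mu S (Fo G N) = (Fa H \<sigma> \<cdot> \<tau> N) \<cdot> Fa S (galois N \<sigma>)"
proof -
  note a = is_algebra_simps[OF assms]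
  have "Fa H \<sigma> \<cdot> Fa H (Mu S N) = Fa H \<sigma> \<cdot> Fa H (Fa S \<sigma>)"
    using a(1-4) by (simp add: H.Fa_eq[OF a(5)])
  from this[THEN comp_reduce, of "\<tau> (Fo S N) \<cdot> Fa S (\<kappa> N)"]
  have "Fa H \<sigma> \<cdot> (Fa H (Mu S N) \<cdot> (\<tau> (Fo S N) \<cdot> Fa S (\<kappa> N))) =
      Fa H \<sigma> \<cdot> (Fa H (Fa S \<sigma>) \<cdot> (\<tau> (Fo S N) \<cdot> Fa S (\<kappa> N)))"
    using a(1-4) by simp
  then show ?thesis using a(1-4) by (simp add: galois_def \<kappa>_Mu law_push)
qed

lemma galois_counit:
  assumes "is_algebra \<A> S N \<sigma>"
  shows "\<epsilon>' N \<cdot> galois N \<sigma> = \<sigma> \<cdot> Fa S (\<epsilon> N)"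
  using is_algebra_simps(1-4)[OF assms] by (simp add: galois_def counit'_push \<kappa>_counit)

text \<open>
  Under the Galois map, \<open>S\<close> of the pair that defines the right adjoint becomes the pair \<open>\<delta>'\<close>, \<open>H \<zeta>\<close>,
  which every \<open>H\<close>-coalgebra splits.
\<close>

lemma galois_left:
  assumes "is_algebra \<A> S N \<sigma>"
  shows "galois (Fo H N) (Fa H \<sigma> \<cdot> \<tau> N) \<cdot> Fa S (Fa G (j N) \<cdot> \<delta> N) = \<delta>' N \<cdot> galois N \<sigma>"
proof -
  note a = is_algebra_simps[OF assms]
  have *: "Fa H (\<tau> N) \<cdot> Fa H (Fa S (j N)) = Fa H (\<kappa> N)"
    using a(1) by (simp add: \<kappa>_eq)
  have "galois (Fo H N) (Fa H \<sigma> \<cdot> \<tau> N) \<cdot> Fa S (Fa G (j N) \<cdot> \<delta> N) =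
      Fa H (Fa H \<sigma>) \<cdot> (Fa H (\<kappa> N) \<cdot> (\<kappa> (Fo G N) \<cdot> Fa S (\<delta> N)))"
    using a(1-4) by (simp add: galois_def \<kappa>_push *[THEN comp_reduce])
  also have "\<dots> = \<delta>' N \<cdot> galois N \<sigma>"
    using a(1-4) by (simp add: galois_def comult'_push \<kappa>_comult)
  finally show ?thesis .
qed

lemma galois_right:
  assumes "is_mixed_module N \<sigma> \<zeta>"
  shows "galois (Fo H N) (Fa H \<sigma> \<cdot> \<tau> N) \<cdot> Fa S (Fa G \<zeta>) = Fa H \<zeta> \<cdot> galois N \<sigma>"
proof (rule galois_nat)
  show "is_algebra \<A> S N \<sigma>" "is_algebra \<A> S (Fo H N) (Fa H \<sigma> \<cdot> \<tau> N)"
    using assms by (auto simp: is_mixed_module_def intro: lifted_algebra)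
  then show "\<zeta> \<in> Arr \<A>" "Dom \<A> \<zeta> = N" "Cod \<A> \<zeta> = Fo H N" "\<zeta> \<cdot> \<sigma> = (Fa H \<sigma> \<cdot> \<tau> N) \<cdot> Fa S \<zeta>"
    using assms H.is_coalgebra_simps[of N \<zeta>] is_algebra_simps(1-4)[of \<A> S N \<sigma>]
    by (auto simp: is_mixed_module_def)
qed

text \<open>
  An algebra is a coequalizer of free ones, and this coequalizer is split in \<open>\<A>\<close>; hence a Galois map
  is a retract of the Galois map of a free algebra.
\<close>

lemma galois_iso_of_free:
  assumes free: "\<And>N. N \<in> Obj \<A> \<Longrightarrow> is_iso \<A> (galois (Fo S N) (Mu S N))"
    and alg: "is_algebra \<A> S N \<sigma>"
  shows "is_iso \<A> (galois N \<sigma>)"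
proof -
  note a = is_algebra_simps[OF alg]
  define \<gamma> where "\<gamma> = galois (Fo S N) (Mu S N)"
  define \<gamma>2 where "\<gamma>2 = galois (Fo S (Fo S N)) (Mu S (Fo S N))"
  note fr = S.free_algebra_is_algebra[OF a(1)] S.free_algebra_is_algebra[OF S.Fo_in_Obj[OF a(1)]]
  have \<gamma>: "\<gamma> \<in> Arr \<A>" "Dom \<A> \<gamma> = Fo S (Fo G (Fo S N))" "Cod \<A> \<gamma> = Fo H (Fo S N)"
    unfolding \<gamma>_def using fr by simp_all
  have \<gamma>2: "\<gamma>2 \<in> Arr \<A>" "Dom \<A> \<gamma>2 = Fo S (Fo G (Fo S (Fo S N)))" "Cod \<A> \<gamma>2 = Fo H (Fo S (Fo S N))"
    unfolding \<gamma>2_def using fr by simp_all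
  obtain \<beta> where \<beta>: "\<beta> \<in> Arr \<A>" "Dom \<A> \<beta> = Fo H (Fo S N)" "Cod \<A> \<beta> = Fo S (Fo G (Fo S N))"
    "\<beta> \<cdot> \<gamma> = Ident \<A> (Fo S (Fo G (Fo S N)))" "\<gamma> \<cdot> \<beta> = Ident \<A> (Fo H (Fo S N))"
    using is_isoE[OF free[OF a(1)]] \<gamma> unfolding \<gamma>_def[symmetric] by metis
  obtain \<beta>2 where \<beta>2: "\<beta>2 \<in> Arr \<A>" "Dom \<A> \<beta>2 = Fo H (Fo S (Fo S N))"
    "Cod \<A> \<beta>2 = Fo S (Fo G (Fo S (Fo S N)))" "\<beta>2 \<cdot> \<gamma>2 = Ident \<A> (Fo S (Fo G (Fo S (Fo S N))))"
    "\<gamma>2 \<cdot> \<beta>2 = Ident \<A> (Fo H (Fo S (Fo S N)))"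
    using is_isoE[OF free[OF S.Fo_in_Obj[OF a(1)]]] \<gamma>2 unfolding \<gamma>2_def[symmetric] by metis
  have n1: "galois N \<sigma> \<cdot> Fa S (Fa G \<sigma>) = Fa H \<sigma> \<cdot> \<gamma>"
    unfolding \<gamma>_def using a by (intro galois_nat fr alg) simp_all
  have n2: "\<gamma> \<cdot> Fa S (Fa G (Fa S \<sigma>)) = Fa H (Fa S \<sigma>) \<cdot> \<gamma>2"
    unfolding \<gamma>_def \<gamma>2_def using a(1-4) S.Mu_nat[of \<sigma> N] by (intro galois_nat fr) simp_all
  have n3: "\<gamma> \<cdot> Fa S (Fa G (Mu S N)) = Fa H (Mu S N) \<cdot> \<gamma>2"
    unfolding \<gamma>_def \<gamma>2_def using a(1) S.Mu_assoc[of N] by (intro galois_nat fr) simp_all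
  have inv_nat: "\<beta> \<cdot> Fa H f = Fa S (Fa G f) \<cdot> \<beta>2"
    if f: "f \<in> Arr \<A>" "Dom \<A> f = Fo S (Fo S N)" "Cod \<A> f = Fo S N" "\<gamma> \<cdot> Fa S (Fa G f) = Fa H f \<cdot> \<gamma>2" for f
  proof (rule iso_cancel_left)
    show "is_iso \<A> \<gamma>" using free[OF a(1)] unfolding \<gamma>_def .
    show "\<gamma> \<cdot> (\<beta> \<cdot> Fa H f) = \<gamma> \<cdot> (Fa S (Fa G f) \<cdot> \<beta>2)"
      using f \<gamma> \<gamma>2 \<beta>(1-3) \<beta>2(1-3) a(1)
      by (simp add: \<beta>(5)[THEN comp_reduce] f(4)[THEN comp_reduce] \<beta>2(5))
  qed (use f \<gamma> \<beta>(1-3) \<beta>2(1-3) a(1) in simp_all)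
  note ty = a(1-4) \<gamma> \<gamma>2 \<beta>(1-3) \<beta>2(1-3)
  \<comment> \<open>Go up to the free algebra along the section \<open>\<iota>\<close> of \<open>\<sigma>\<close>, invert there, and come back along \<open>\<sigma>\<close>.\<close>
  let ?i = "Fa S (Fa G \<sigma>) \<cdot> (\<beta> \<cdot> Fa H (Iota S N))"
  have r: "galois N \<sigma> \<cdot> ?i = Ident \<A> (Fo H N)"
    using ty alg by (simp add: n1[THEN comp_reduce] \<beta>(5)[THEN comp_reduce] H.Fa_eq[OF a(6)])
  \<comment> \<open>\<open>S G \<sigma>\<close> is a split epimorphism, so it suffices to precompose the other composite with it. The two algebra
    maps \<open>S \<sigma>\<close> and \<open>\<mu>\<close> from \<open>S S N\<close> to \<open>S N\<close> are interchanged by the associativity of \<open>\<sigma>\<close>.\<close>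
  have "(?i \<cdot> galois N \<sigma>) \<cdot> Fa S (Fa G \<sigma>) =
      Fa S (Fa G \<sigma>) \<cdot> (\<beta> \<cdot> ((Fa H (Iota S N) \<cdot> Fa H \<sigma>) \<cdot> \<gamma>))"
    using ty alg n1 by simp
  also have "Fa H (Iota S N) \<cdot> Fa H \<sigma> = Fa H (Fa S \<sigma>) \<cdot> Fa H (Iota S (Fo S N))"
    using ty by (simp add: H.Fa_eq[OF S.Iota_nat])
  also have "Fa S (Fa G \<sigma>) \<cdot> (\<beta> \<cdot> ((Fa H (Fa S \<sigma>) \<cdot> Fa H (Iota S (Fo S N))) \<cdot> \<gamma>)) =
      (Fa S (Fa G \<sigma>) \<cdot> Fa S (Fa G (Fa S \<sigma>))) \<cdot> (\<beta>2 \<cdot> (Fa H (Iota S (Fo S N)) \<cdot> \<gamma>))"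
    using ty by (simp add: inv_nat[OF _ _ _ n2, THEN comp_reduce])
  also have "Fa S (Fa G \<sigma>) \<cdot> Fa S (Fa G (Fa S \<sigma>)) = Fa S (Fa G \<sigma>) \<cdot> Fa S (Fa G (Mu S N))"
    using ty by (simp add: S.Fa_eq[OF G.Fa_eq[OF a(5)]])
  also have "(Fa S (Fa G \<sigma>) \<cdot> Fa S (Fa G (Mu S N))) \<cdot> (\<beta>2 \<cdot> (Fa H (Iota S (Fo S N)) \<cdot> \<gamma>)) =
      Fa S (Fa G \<sigma>) \<cdot> (\<beta> \<cdot> (Fa H (Mu S N) \<cdot> (Fa H (Iota S (Fo S N)) \<cdot> \<gamma>)))"
    using ty by (simp add: inv_nat[OF _ _ _ n3, THEN comp_reduce])
  also have "\<dots> = Fa S (Fa G \<sigma>)"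
    using ty by (simp add: H.Fa_eq[OF S.Mu_Iota_left, THEN comp_reduce] \<beta>(4))
  finally have l: "(?i \<cdot> galois N \<sigma>) \<cdot> Fa S (Fa G \<sigma>) = Ident \<A> (Fo S (Fo G N)) \<cdot> Fa S (Fa G \<sigma>)"
    using ty by simp
  have s: "Fa S (Fa G \<sigma>) \<cdot> Fa S (Fa G (Iota S N)) = Ident \<A> (Fo S (Fo G N))"
    using ty by (simp add: S.Fa_eq[OF G.Fa_eq[OF a(6)]])
  have "?i \<cdot> galois N \<sigma> = ((?i \<cdot> galois N \<sigma>) \<cdot> Fa S (Fa G \<sigma>)) \<cdot> Fa S (Fa G (Iota S N))"
    using ty alg by (simp add: s)
  also have "\<dots> = Ident \<A> (Fo S (Fo G N))" unfolding l using ty by (simp add: s)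
  finally show ?thesis
    using r ty alg by (intro is_isoI[of _ "Fo S (Fo G N)" "Fo H N" ?i]) (simp_all add: Hom_iff)
qed

end

section \<open>The adjunction between coalgebras and modules\<close>

context mixed_distributive_law
begin

lemma is_mixed_module_simps:
  assumes "is_mixed_module N \<sigma> \<zeta>"
  shows "is_algebra \<A> S N \<sigma>" "H.is_coalgebra N \<zeta>" "\<zeta> \<cdot> \<sigma> = Fa H \<sigma> \<cdot> \<tau> N \<cdot> Fa S \<zeta>"
  using assms by (auto simp: is_mixed_module_def)

lemma mixed_cat_simps [simp]:
  "(N, \<sigma>, \<zeta>) \<in> Obj mixed_cat \<longleftrightarrow> is_mixed_module N \<sigma> \<zeta>"
  "((N, \<sigma>, \<zeta>), f, (N', \<sigma>', \<zeta>')) \<in> Arr mixed_cat \<longleftrightarrow>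
    is_mixed_module N \<sigma> \<zeta> \<and> is_mixed_module N' \<sigma>' \<zeta>' \<and> f \<in> Hom \<A> N N' \<and>
    f \<cdot> \<sigma> = \<sigma>' \<cdot> Fa S f \<and> \<zeta>' \<cdot> f = Fa H f \<cdot> \<zeta>"
  "Dom mixed_cat (X, f, Y) = X"
  "Cod mixed_cat (X, f, Y) = Y"
  "Ident mixed_cat X = (X, Ident \<A> (fst X), X)"
  "(Y', g, Z) \<cdot>\<^bsub>mixed_cat\<^esub> (X, f, Y) = (X, g \<cdot> f, Z)"
  by (simp_all add: mixed_cat_def is_algebra_map_def)

lemma mixed_arr_cases:
  assumes "t \<in> Arr mixed_cat"
  obtains N \<sigma> \<zeta> f N' \<sigma>' \<zeta>' where "t = ((N, \<sigma>, \<zeta>), f, (N', \<sigma>', \<zeta>'))" "is_mixed_module N \<sigma> \<zeta>"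
    "is_mixed_module N' \<sigma>' \<zeta>'" "f \<in> Arr \<A>" "Dom \<A> f = N" "Cod \<A> f = N'"
    "f \<cdot> \<sigma> = \<sigma>' \<cdot> Fa S f" "\<zeta>' \<cdot> f = Fa H f \<cdot> \<zeta>"
  using assms by (cases t) (auto simp: Hom_iff)

lemma category_mixed_cat: "category mixed_cat"
  unfolding mixed_cat_def
proof (rule category_struct_cat)
  show "category \<A>" by (rule category_axioms)
  fix x assume "x \<in> {(N, \<sigma>, \<zeta>). is_mixed_module N \<sigma> \<zeta>}"
  then obtain N \<sigma> \<zeta> where x: "x = (N, \<sigma>, \<zeta>)" "is_mixed_module N \<sigma> \<zeta>" by auto
  note m = is_mixed_module_simps[OF x(2)]
  note a = is_algebra_simps(1-4)[OF m(1)] H.is_coalgebra_simps(1-4)[OF m(2)]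
  show "fst x \<in> Obj \<A>" using a x by simp
  show "(\<lambda>(_, \<sigma>, \<zeta>) (_, \<sigma>', \<zeta>') f. is_algebra_map \<A> S \<sigma> \<sigma>' f \<and> \<zeta>' \<cdot> f = Fa H f \<cdot> \<zeta>) x x (Ident \<A> (fst x))"
    using a x by (simp add: is_algebra_map_def)
  fix y z f g assume "y \<in> {(N, \<sigma>, \<zeta>). is_mixed_module N \<sigma> \<zeta>}" "z \<in> {(N, \<sigma>, \<zeta>). is_mixed_module N \<sigma> \<zeta>}"
    and fg: "f \<in> Hom \<A> (fst x) (fst y)" "g \<in> Hom \<A> (fst y) (fst z)"
    "(\<lambda>(_, \<sigma>, \<zeta>) (_, \<sigma>', \<zeta>') f. is_algebra_map \<A> S \<sigma> \<sigma>' f \<and> \<zeta>' \<cdot> f = Fa H f \<cdot> \<zeta>) x y f"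
    "(\<lambda>(_, \<sigma>, \<zeta>) (_, \<sigma>', \<zeta>') f. is_algebra_map \<A> S \<sigma> \<sigma>' f \<and> \<zeta>' \<cdot> f = Fa H f \<cdot> \<zeta>) y z g"
  then obtain N' \<sigma>' \<zeta>' N'' \<sigma>'' \<zeta>'' where y: "y = (N', \<sigma>', \<zeta>')" "is_mixed_module N' \<sigma>' \<zeta>'"
    "z = (N'', \<sigma>'', \<zeta>'')" "is_mixed_module N'' \<sigma>'' \<zeta>''" by auto
  note m' = is_mixed_module_simps(1,2)[OF y(2)] is_mixed_module_simps(1,2)[OF y(4)]
  note a' = H.is_coalgebra_simps(1-4)[OF m'(2)] H.is_coalgebra_simps(1-4)[OF m'(4)]
  have h: "f \<in> Hom \<A> N N'" "g \<in> Hom \<A> N' N''" "f \<cdot> \<sigma> = \<sigma>' \<cdot> Fa S f" "g \<cdot> \<sigma>' = \<sigma>'' \<cdot> Fa S g"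
    "\<zeta>' \<cdot> f = Fa H f \<cdot> \<zeta>" "\<zeta>'' \<cdot> g = Fa H g \<cdot> \<zeta>'"
    using fg x y by (simp_all add: is_algebra_map_def)
  have "\<zeta>'' \<cdot> g \<cdot> f = Fa H (g \<cdot> f) \<cdot> \<zeta>"
    using a a' h(1,2) by (simp add: Hom_iff h(5) h(6)[THEN comp_reduce])
  with S.algebra_map_comp[OF m(1) m'(1,3) h(1,3,2,4)]
  show "(\<lambda>(_, \<sigma>, \<zeta>) (_, \<sigma>', \<zeta>') f. is_algebra_map \<A> S \<sigma> \<sigma>' f \<and> \<zeta>' \<cdot> f = Fa H f \<cdot> \<zeta>) x z (g \<cdot> f)"
    using x y by (simp add: is_algebra_map_def)
qed

sublocale MM: category mixed_cat
  by (rule category_mixed_cat)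

lemma mixed_iso:
  assumes "((N, \<sigma>, \<zeta>), f, (N', \<sigma>', \<zeta>')) \<in> Arr mixed_cat" "is_iso \<A> f"
  shows "is_iso mixed_cat ((N, \<sigma>, \<zeta>), f, (N', \<sigma>', \<zeta>'))"
proof -
  have f: "is_mixed_module N \<sigma> \<zeta>" "is_mixed_module N' \<sigma>' \<zeta>'" "f \<in> Arr \<A>" "Dom \<A> f = N"
    "Cod \<A> f = N'" "f \<cdot> \<sigma> = \<sigma>' \<cdot> Fa S f" "\<zeta>' \<cdot> f = Fa H f \<cdot> \<zeta>"
    using assms(1) by (auto simp: Hom_iff)
  note m = is_mixed_module_simps(1,2)[OF f(1)] is_mixed_module_simps(1,2)[OF f(2)]
  note a = H.is_coalgebra_simps(1-4)[OF m(2)] H.is_coalgebra_simps(1-4)[OF m(4)]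
  obtain g where g: "g \<in> Arr \<A>" "Dom \<A> g = N'" "Cod \<A> g = N" "g \<cdot> f = Ident \<A> N" "f \<cdot> g = Ident \<A> N'"
    using assms(2) f(3-5) by (auto elim: is_isoE)
  have "(\<zeta> \<cdot> g) \<cdot> f = (Fa H g \<cdot> \<zeta>') \<cdot> f"
    using a f(3-5) g by (simp add: f(7) H.Fa_eq[OF g(4), THEN comp_reduce])
  then have "\<zeta> \<cdot> g = Fa H g \<cdot> \<zeta>'"
    using a f(3-5) g by - (rule iso_cancel_right[OF assms(2)], simp_all)
  moreover have "g \<cdot> \<sigma>' = \<sigma> \<cdot> Fa S g"
    using f g by (intro S.algebra_map_inverse[OF m(1,3) assms(2)]) (auto simp: Hom_iff)
  ultimately show ?thesis
    using f g by (intro MM.is_isoI[of _ "(N, \<sigma>, \<zeta>)" "(N', \<sigma>', \<zeta>')" "((N', \<sigma>', \<zeta>'), g, (N, \<sigma>, \<zeta>))"])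
      (auto simp: Hom_iff)
qed

end

context comonad_change
begin

abbreviation CC where "CC \<equiv> G.coalgebra_cat"

text \<open>
  The pair whose equalizer defines the right adjoint, as arrows between cofree coalgebras.
\<close>

definition left_arrow where
  "left_arrow = (\<lambda>(N, \<sigma> :: 'a, \<zeta> :: 'a).
    ((Fo G N, \<delta> N), Fa G (j N) \<cdot> \<delta> N, (Fo G (Fo H N), \<delta> (Fo H N))))"

definition right_arrow where
  "right_arrow = (\<lambda>(N, \<sigma> :: 'a, \<zeta>).
    ((Fo G N, \<delta> N), Fa G \<zeta>, (Fo G (Fo H N), \<delta> (Fo H N))))"

definition cofree_arrow where
  "cofree_arrow h = ((Fo G (Dom \<A> h), \<delta> (Dom \<A> h)), Fa G h, (Fo G (Cod \<A> h), \<delta> (Cod \<A> h)))"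

definition equalizers_exist where
  "equalizers_exist \<longleftrightarrow> (\<forall>X \<in> Obj mixed_cat. \<exists>e. is_equalizer CC (left_arrow X) (right_arrow X) e)"

text \<open>
  A choice of equalizers, meaningful when they exist; so are the functor and the transformations built
  on it.
\<close>

definition equalizer_of where
  "equalizer_of X = (SOME e. is_equalizer CC (left_arrow X) (right_arrow X) e)"

definition left_adjoint where
  "left_adjoint = (let Lo = (\<lambda>(N, c). (Fo S N, Mu S N, \<kappa> N \<cdot> Fa S c))
     in \<lparr>Fo = Lo, Fa = (\<lambda>(x, f, y). (Lo x, Fa S f, Lo y))\<rparr>)"

definition right_adjoint where
  "right_adjoint = \<lparr>Fo = (\<lambda>X. Dom CC (equalizer_of X)),
     Fa = (\<lambda>(X, h, Y). THE u. u \<in> Hom CC (Dom CC (equalizer_of X)) (Dom CC (equalizer_of Y)) \<and>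
       equalizer_of Y \<cdot>\<^bsub>CC\<^esub> u = cofree_arrow h \<cdot>\<^bsub>CC\<^esub> equalizer_of X)\<rparr>"

definition adj_unit where
  "adj_unit = (\<lambda>(N, c). let X = Fo left_adjoint (N, c) in
    THE u. u \<in> Hom CC (N, c) (Fo right_adjoint X) \<and>
      equalizer_of X \<cdot>\<^bsub>CC\<^esub> u = ((N, c), Fa G (Iota S N) \<cdot> c, (Fo G (Fo S N), \<delta> (Fo S N))))"

definition adj_counit where
  "adj_counit = (\<lambda>(N, \<sigma>, \<zeta>).
    (Fo left_adjoint (Fo right_adjoint (N, \<sigma>, \<zeta>)),
     \<sigma> \<cdot> Fa S (\<epsilon> N) \<cdot> Fa S (underlying (equalizer_of (N, \<sigma>, \<zeta>))),
     (N, \<sigma>, \<zeta>)))"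

lemmas comult_push = G.comult_nat G.comult_nat[THEN comp_reduce]

lemma left_right_arrow:
  assumes "is_mixed_module N \<sigma> \<zeta>"
  shows "left_arrow (N, \<sigma>, \<zeta>) \<in> Arr CC" "right_arrow (N, \<sigma>, \<zeta>) \<in> Arr CC"
proof -
  note z = H.is_coalgebra_simps[OF is_mixed_module_simps(2)[OF assms]]
  show "left_arrow (N, \<sigma>, \<zeta>) \<in> Arr CC" "right_arrow (N, \<sigma>, \<zeta>) \<in> Arr CC"
    using z(1-4) by (simp_all add: left_arrow_def right_arrow_def G.cofree_coalgebra Hom_iff
      comult_push G.comult_coassoc)
qed

text \<open>Both arrows are retracted by \<open>G \<epsilon>'\<close>.\<close>

lemma coreflexive_left_right:
  assumes "is_mixed_module N \<sigma> \<zeta>"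
  shows "coreflexive_pair \<A> (Fa G (j N) \<cdot> \<delta> N) (Fa G \<zeta>)"
proof -
  note z = H.is_coalgebra_simps[OF is_mixed_module_simps(2)[OF assms]]
  have "Fa G (\<epsilon>' N) \<cdot> (Fa G (j N) \<cdot> \<delta> N) = Ident \<A> (Fo G N)"
    using z(1) by (simp add: G.Fa_eq[OF change_counit, THEN comp_reduce] G.Fa_counit_comult)
  moreover have "Fa G (\<epsilon>' N) \<cdot> Fa G \<zeta> = Ident \<A> (Fo G N)"
    using z(1-4) by (simp add: G.Fa_eq[OF z(6)])
  ultimately show ?thesis
    using z(1-4) unfolding coreflexive_pair_def parallel_pair_def
    by (intro conjI bexI[of _ "Fa G (\<epsilon>' N)"]) (simp_all add: Hom_iff)
qed

text \<open>
  The coaction is that of the lifted comonad on the free algebra, transported along \<open>j\<close>; coassociativity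
  and compatibility with \<open>\<mu>\<close> are \<open>\<kappa>_comult\<close> and \<open>\<kappa>_Mu\<close> applied to a coaction \<open>c\<close>.
\<close>

lemma left_adjoint_object:
  assumes "G.is_coalgebra N c"
  shows "is_mixed_module (Fo S N) (Mu S N) (\<kappa> N \<cdot> Fa S c)"
proof -
  note c = G.is_coalgebra_simps[OF assms]
  have *: "Fa S (\<delta> N) \<cdot> Fa S c = Fa S (Fa G c) \<cdot> Fa S c"
    using c(1-4) by (simp add: S.Fa_eq[OF c(5)])
  have "\<delta>' (Fo S N) \<cdot> (\<kappa> N \<cdot> Fa S c) = Fa H (\<kappa> N) \<cdot> (\<kappa> (Fo G N) \<cdot> (Fa S (\<delta> N) \<cdot> Fa S c))"
    using c(1-4) by (simp add: \<kappa>_comult[THEN comp_reduce])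
  also have "\<dots> = Fa H (\<kappa> N \<cdot> Fa S c) \<cdot> (\<kappa> N \<cdot> Fa S c)"
    unfolding * using c(1-4) by (simp add: \<kappa>_push)
  finally have 1: "\<delta>' (Fo S N) \<cdot> (\<kappa> N \<cdot> Fa S c) = Fa H (\<kappa> N \<cdot> Fa S c) \<cdot> (\<kappa> N \<cdot> Fa S c)" .
  have 2: "\<epsilon>' (Fo S N) \<cdot> (\<kappa> N \<cdot> Fa S c) = Ident \<A> (Fo S N)"
    using c(1-4) by (simp add: \<kappa>_counit[THEN comp_reduce] S.Fa_eq[OF c(6)])
  have 3: "(\<kappa> N \<cdot> Fa S c) \<cdot> Mu S N = Fa H (Mu S N) \<cdot> \<tau> (Fo S N) \<cdot> Fa S (\<kappa> N \<cdot> Fa S c)"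
    using c(1-4) S.Mu_nat[of c "Fo G N", symmetric] by (simp add: \<kappa>_Mu[THEN comp_reduce])
  show ?thesis
    using 1 2 3 c(1-4) by (simp add: is_mixed_module_def S.free_algebra_is_algebra H.is_coalgebra_def Hom_iff)
qed

lemma left_adjoint_simps:
  "Fo left_adjoint (N, c) = (Fo S N, Mu S N, \<kappa> N \<cdot> Fa S c)"
  "Fa left_adjoint (x, f, y) = (Fo left_adjoint x, Fa S f, Fo left_adjoint y)"
  by (simp_all add: left_adjoint_def Let_def)

lemma left_adjoint_functor: "cat_functor CC mixed_cat left_adjoint"
proof
  fix X assume "X \<in> Obj CC"
  then show "Fo left_adjoint X \<in> Obj mixed_cat"
    by (cases X) (simp add: left_adjoint_simps left_adjoint_object)
  show "Fa left_adjoint (Ident CC X) = Ident mixed_cat (Fo left_adjoint X)"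
    using \<open>X \<in> Obj CC\<close> G.is_coalgebra_simps(1)
    by (cases X) (auto simp: left_adjoint_simps)
next
  fix t X Y assume t: "t \<in> Hom CC X Y"
  then obtain N c f N' c' where f: "t = ((N, c), f, (N', c'))" "G.is_coalgebra N c" "G.is_coalgebra N' c'"
    "f \<in> Arr \<A>" "Dom \<A> f = N" "Cod \<A> f = N'" "c' \<cdot> f = Fa G f \<cdot> c"
    by (auto simp: Hom_iff[of _ CC] elim: G.coalgebra_arr_cases)
  note c = G.is_coalgebra_simps(1-4)[OF f(2)] G.is_coalgebra_simps(1-4)[OF f(3)]
  have "(\<kappa> N' \<cdot> Fa S c') \<cdot> Fa S f = Fa H (Fa S f) \<cdot> (\<kappa> N \<cdot> Fa S c)"
    using c f(4-6) by (simp add: S.Fa_eq[OF f(7)] \<kappa>_push)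
  then have "Fa left_adjoint t \<in> Arr mixed_cat"
    using f c S.Mu_nat[of f N'] by (simp add: left_adjoint_simps left_adjoint_object Hom_iff)
  then show "Fa left_adjoint t \<in> Hom mixed_cat (Fo left_adjoint X) (Fo left_adjoint Y)"
    using t f by (auto simp: Hom_iff left_adjoint_simps)
next
  fix t X Y t' Z assume "t \<in> Hom CC X Y" "t' \<in> Hom CC Y Z"
  then show "Fa left_adjoint (t' \<cdot>\<^bsub>CC\<^esub> t) = Fa left_adjoint t' \<cdot>\<^bsub>mixed_cat\<^esub> Fa left_adjoint t"
    by (auto simp: Hom_iff[of _ CC] left_adjoint_simps elim!: G.coalgebra_arr_cases)
qed

text \<open>
  Here \<open>e\<close> equalizes the pair that defines the right adjoint, and \<open>k = \<sigma> (S \<epsilon>) (S e)\<close> is the component of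
  the counit. The arrow \<open>g = \<gamma> (S e)\<close> satisfies \<open>\<delta>' g = (H \<zeta>) g\<close>, and applying \<open>\<epsilon>'\<close> to both sides gives
  \<open>g = \<zeta> (\<epsilon>' g) = \<zeta> k\<close>.
\<close>

lemma counit_galois:
  assumes m: "is_mixed_module N \<sigma> \<zeta>" and e: "e \<in> Arr \<A>" "Cod \<A> e = Fo G N"
    and eq: "(Fa G (j N) \<cdot> \<delta> N) \<cdot> e = Fa G \<zeta> \<cdot> e"
  shows "\<zeta> \<cdot> (\<sigma> \<cdot> Fa S (\<epsilon> N) \<cdot> Fa S e) = galois N \<sigma> \<cdot> Fa S e"
proof -
  note a = is_mixed_module_simps[OF m]
  note s = is_algebra_simps(1-4)[OF a(1)] and z = H.is_coalgebra_simps[OF a(2)]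
  note g = lifted_algebra[OF a(1)]
  let ?g = "galois N \<sigma> \<cdot> Fa S e"
  have "\<delta>' N \<cdot> ?g = galois (Fo H N) (Fa H \<sigma> \<cdot> \<tau> N) \<cdot> Fa S ((Fa G (j N) \<cdot> \<delta> N) \<cdot> e)"
    using s e a(1) g galois_left[OF a(1), THEN comp_reduce, of "Fa S e"] by simp
  also have "\<dots> = Fa H \<zeta> \<cdot> ?g"
    unfolding eq using s z(1-4) e a(1) g galois_right[OF m, THEN comp_reduce, of "Fa S e"] by simp
  finally have *: "\<delta>' N \<cdot> ?g = Fa H \<zeta> \<cdot> ?g" .
  have "?g = \<epsilon>' (Fo H N) \<cdot> (\<delta>' N \<cdot> ?g)"
    using s e a(1) by (simp add: H.counit_comult[THEN comp_reduce])
  also have "\<dots> = \<zeta> \<cdot> (\<epsilon>' N \<cdot> ?g)"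
    unfolding * using s z(1-4) e a(1) by (simp add: counit'_push)
  also have "\<epsilon>' N \<cdot> ?g = \<sigma> \<cdot> Fa S (\<epsilon> N) \<cdot> Fa S e"
    using s e a(1) by (simp add: galois_counit[THEN comp_reduce])
  finally show ?thesis by simp
qed

text \<open>
  The counit is a map of algebras because it is \<open>\<sigma>\<close> after \<open>S\<close> of an arrow, and it respects the coactions
  because both sides of the equation agree with the expression in \<open>counit_galois\<close>.
\<close>

lemma counit_mixed_map:
  assumes m: "is_mixed_module N \<sigma> \<zeta>" and E: "G.is_coalgebra E c"
    and e: "e \<in> Arr \<A>" "Dom \<A> e = E" "Cod \<A> e = Fo G N" "\<delta> N \<cdot> e = Fa G e \<cdot> c"
    and eq: "(Fa G (j N) \<cdot> \<delta> N) \<cdot> e = Fa G \<zeta> \<cdot> e"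
  shows "((Fo S E, Mu S E, \<kappa> E \<cdot> Fa S c), \<sigma> \<cdot> Fa S (\<epsilon> N) \<cdot> Fa S e, (N, \<sigma>, \<zeta>)) \<in> Arr mixed_cat"
proof -
  note a = is_mixed_module_simps[OF m]
  note s = is_algebra_simps[OF a(1)] and z = H.is_coalgebra_simps(1-4)[OF a(2)]
    and c = G.is_coalgebra_simps[OF E]
  let ?k = "\<sigma> \<cdot> Fa S (\<epsilon> N) \<cdot> Fa S e"
  have "?k \<cdot> Mu S E = \<sigma> \<cdot> Fa S ?k"
    using s(1-4) e(1-3) c(1)
      S.Mu_nat[of e "Fo G N", symmetric] S.Mu_nat[of "\<epsilon> N" N, THEN comp_reduce, of "Fa S (Fa S e)", symmetric]
    by (simp add: s(5)[THEN comp_reduce])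
  moreover have "\<zeta> \<cdot> ?k = Fa H ?k \<cdot> (\<kappa> E \<cdot> Fa S c)"
  proof -
    have 1: "Fa S (Fa G e) \<cdot> Fa S c = Fa S (\<delta> N) \<cdot> Fa S e"
      using e(1-3) c(1-4) s(1) by (simp add: S.Fa_eq[OF e(4)[symmetric]])
    have 2: "Fa S (Fa G (\<epsilon> N)) \<cdot> Fa S (\<delta> N) = Ident \<A> (Fo S (Fo G N))"
      using s(1) by (simp add: S.Fa_eq[OF G.Fa_counit_comult])
    have "Fa H ?k \<cdot> (\<kappa> E \<cdot> Fa S c) =
        Fa H \<sigma> \<cdot> (\<kappa> N \<cdot> (Fa S (Fa G (\<epsilon> N)) \<cdot> (Fa S (Fa G e) \<cdot> Fa S c)))"
      using s(1-4) e(1-3) c(1-4) by (simp add: \<kappa>_push)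
    also have "\<dots> = galois N \<sigma> \<cdot> Fa S e"
      unfolding 1 using s(1-4) e(1-3) by (simp add: galois_def 2[THEN comp_reduce])
    finally show ?thesis using counit_galois[OF m e(1,3) eq] by simp
  qed
  ultimately show ?thesis
    using m left_adjoint_object[OF E] s(1-4) e(1-3) c(1-4) by (simp add: Hom_iff)
qed

end

context comonad_change
begin

lemma cofree_arrow_in:
  "h \<in> Arr \<A> \<Longrightarrow> cofree_arrow h \<in> Arr CC"
  by (simp add: cofree_arrow_def G.cofree_coalgebra Hom_iff comult_push)

lemma arrow_ends [simp]:
  "Dom CC (left_arrow (N, \<sigma>, \<zeta>)) = (Fo G N, \<delta> N)"
  "Cod CC (left_arrow (N, \<sigma>, \<zeta>)) = (Fo G (Fo H N), \<delta> (Fo H N))"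
  "Dom CC (right_arrow (N, \<sigma>, \<zeta>)) = (Fo G N, \<delta> N)"
  "Cod CC (right_arrow (N, \<sigma>, \<zeta>)) = (Fo G (Fo H N), \<delta> (Fo H N))"
  "Dom CC (cofree_arrow h) = (Fo G (Dom \<A> h), \<delta> (Dom \<A> h))"
  "Cod CC (cofree_arrow h) = (Fo G (Cod \<A> h), \<delta> (Cod \<A> h))"
  by (simp_all add: left_arrow_def right_arrow_def cofree_arrow_def)

text \<open>
  A map \<open>h\<close> of modules induces a map of the defining pairs, hence of their equalizers; this is the action
  of the right adjoint on arrows.
\<close>

lemma cofree_arrow_left_right:
  assumes h: "((N, \<sigma>, \<zeta>), h, (N', \<sigma>', \<zeta>')) \<in> Arr mixed_cat"
  shows "left_arrow (N', \<sigma>', \<zeta>') \<cdot>\<^bsub>CC\<^esub> cofree_arrow h = cofree_arrow (Fa H h) \<cdot>\<^bsub>CC\<^esub> left_arrow (N, \<sigma>, \<zeta>)"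
    and "right_arrow (N', \<sigma>', \<zeta>') \<cdot>\<^bsub>CC\<^esub> cofree_arrow h = cofree_arrow (Fa H h) \<cdot>\<^bsub>CC\<^esub> right_arrow (N, \<sigma>, \<zeta>)"
proof -
  have m: "is_mixed_module N \<sigma> \<zeta>" "is_mixed_module N' \<sigma>' \<zeta>'" "h \<in> Arr \<A>" "Dom \<A> h = N"
    "Cod \<A> h = N'" "\<zeta>' \<cdot> h = Fa H h \<cdot> \<zeta>" using h by (simp_all add: Hom_iff)
  note z = H.is_coalgebra_simps(1-4)[OF is_mixed_module_simps(2)[OF m(1)]]
    H.is_coalgebra_simps(1-4)[OF is_mixed_module_simps(2)[OF m(2)]]
  have 1: "Fa G (j N') \<cdot> Fa G (Fa G h) = Fa G (Fa H h) \<cdot> Fa G (j N)"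
    using z m(3-5) by (simp add: G.Fa_eq[OF change_nat])
  show "left_arrow (N', \<sigma>', \<zeta>') \<cdot>\<^bsub>CC\<^esub> cofree_arrow h = cofree_arrow (Fa H h) \<cdot>\<^bsub>CC\<^esub> left_arrow (N, \<sigma>, \<zeta>)"
    using z m(3-5) by (simp add: left_arrow_def cofree_arrow_def comult_push 1[THEN comp_reduce])
  show "right_arrow (N', \<sigma>', \<zeta>') \<cdot>\<^bsub>CC\<^esub> cofree_arrow h = cofree_arrow (Fa H h) \<cdot>\<^bsub>CC\<^esub> right_arrow (N, \<sigma>, \<zeta>)"
    using z m(3-5) by (simp add: right_arrow_def cofree_arrow_def G.Fa_eq[OF m(6)])
qed

text \<open>
  The arrow \<open>(G \<iota>) c\<close> from a coalgebra into \<open>G (S N)\<close>, whose factorization through the equalizer is the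
  unit of the adjunction.
\<close>

definition unit_arrow where
  "unit_arrow = (\<lambda>(N, c). ((N, c), Fa G (Iota S N) \<cdot> c, (Fo G (Fo S N), \<delta> (Fo S N))))"

lemma unit_arrow_in:
  assumes "G.is_coalgebra N c"
  shows "unit_arrow (N, c) \<in> Arr CC"
  using G.is_coalgebra_simps[OF assms] assms
  by (simp add: unit_arrow_def G.cofree_coalgebra Hom_iff comult_push)

text \<open>
  Both composites equal \<open>G(H \<iota>) G(j) (G c) c\<close>: on one side by coassociativity of \<open>c\<close>, on the other by
  \<open>\<kappa>_Iota\<close>.
\<close>

lemma unit_arrow_fork:
  assumes "G.is_coalgebra N c"
  shows "left_arrow (Fo left_adjoint (N, c)) \<cdot>\<^bsub>CC\<^esub> unit_arrow (N, c) =
    right_arrow (Fo left_adjoint (N, c)) \<cdot>\<^bsub>CC\<^esub> unit_arrow (N, c)"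
proof -
  note c = G.is_coalgebra_simps[OF assms]
  have 1: "Fa G (\<kappa> N) \<cdot> (Fa G (Fa S c) \<cdot> Fa G (Iota S N)) = Fa G (Fa H (Iota S N)) \<cdot> (Fa G (j N) \<cdot> Fa G c)"
  proof -
    have "Fa S c \<cdot> Iota S N = Iota S (Fo G N) \<cdot> c" using c(1-4) S.Iota_nat[of c "Fo G N"] by simp
    then have "\<kappa> N \<cdot> (Fa S c \<cdot> Iota S N) = Fa H (Iota S N) \<cdot> (j N \<cdot> c)"
      using c(1-4) by (simp add: \<kappa>_Iota[THEN comp_reduce])
    then have "Fa G (\<kappa> N \<cdot> (Fa S c \<cdot> Iota S N)) = Fa G (Fa H (Iota S N) \<cdot> (j N \<cdot> c))" by simp
    then show ?thesis using c(1-4) by simp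
  qed
  have 2: "Fa G (j (Fo S N)) \<cdot> Fa G (Fa G (Iota S N)) = Fa G (Fa H (Iota S N)) \<cdot> Fa G (j N)"
    using c(1-4) by (simp add: G.Fa_eq[OF change_nat])
  have "(Fa G (j (Fo S N)) \<cdot> \<delta> (Fo S N)) \<cdot> (Fa G (Iota S N) \<cdot> c) =
      (Fa G (\<kappa> N) \<cdot> (Fa G (Fa S c) \<cdot> Fa G (Iota S N))) \<cdot> c"
    unfolding 1 using c(1-4) by (simp add: comult_push c(5) 2[THEN comp_reduce])
  then show ?thesis
    using c(1-4) by (simp add: left_arrow_def right_arrow_def left_adjoint_simps unit_arrow_def)
qed

end

locale comonad_change_equalizers = comonad_change +
  assumes exist: "equalizers_exist"
begin

lemma equalizer_of_is_equalizer:
  assumes "X \<in> Obj mixed_cat"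
  shows "is_equalizer CC (left_arrow X) (right_arrow X) (equalizer_of X)"
  using exist assms unfolding equalizers_exist_def equalizer_of_def by (metis someI_ex)

lemma equalizer_of_cases:
  assumes "is_mixed_module N \<sigma> \<zeta>"
  obtains E c e where "equalizer_of (N, \<sigma>, \<zeta>) = ((E, c), e, (Fo G N, \<delta> N))" "G.is_coalgebra E c" "e \<in> Arr \<A>"
    "Dom \<A> e = E" "Cod \<A> e = Fo G N" "\<delta> N \<cdot> e = Fa G e \<cdot> c" "(Fa G (j N) \<cdot> \<delta> N) \<cdot> e = Fa G \<zeta> \<cdot> e"
proof -
  note q = G.CG.equalizer_simps[OF equalizer_of_is_equalizer, of "(N, \<sigma>, \<zeta>)"]
  have x: "(N, \<sigma>, \<zeta>) \<in> Obj mixed_cat" using assms by simp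
  show thesis
    using q(5-7)[OF x] that
    by (auto elim!: G.coalgebra_arr_cases simp: left_arrow_def right_arrow_def)
qed

lemma equalizer_of_simps [simp]:
  assumes "X \<in> Obj mixed_cat"
  shows "equalizer_of X \<in> Arr CC" "Cod CC (equalizer_of X) = (Fo G (fst X), \<delta> (fst X))"
    "Dom CC (equalizer_of X) = Fo right_adjoint X"
  using G.CG.equalizer_simps[OF equalizer_of_is_equalizer[OF assms]]
  by (cases X; simp add: right_adjoint_def)+

lemma right_adjoint_object: "X \<in> Obj mixed_cat \<Longrightarrow> Fo right_adjoint X \<in> Obj CC"
  using G.CG.Dom_Cod_Obj(1)[OF equalizer_of_simps(1)] equalizer_of_simps(3) by metis

lemma equalizer_of_mono:
  assumes "X \<in> Obj mixed_cat" "u \<in> Hom CC Z (Fo right_adjoint X)" "v \<in> Hom CC Z (Fo right_adjoint X)"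
    "equalizer_of X \<cdot>\<^bsub>CC\<^esub> u = equalizer_of X \<cdot>\<^bsub>CC\<^esub> v"
  shows "u = v"
  using assms by - (rule G.CG.equalizer_mono[OF equalizer_of_is_equalizer[OF assms(1)]], simp_all add: Hom_iff)

lemma equalizer_of_factor:
  assumes "X \<in> Obj mixed_cat" "t \<in> Hom CC Z (Fo G (fst X), \<delta> (fst X))"
    "left_arrow X \<cdot>\<^bsub>CC\<^esub> t = right_arrow X \<cdot>\<^bsub>CC\<^esub> t"
  shows "\<exists>!u. u \<in> Hom CC Z (Fo right_adjoint X) \<and> equalizer_of X \<cdot>\<^bsub>CC\<^esub> u = t"
  using G.CG.equalizer_universal[OF equalizer_of_is_equalizer[OF assms(1)], of t] assms
  by (cases X) (simp add: Hom_iff)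

lemma right_adjoint_arrow:
  assumes h: "(X, h, Y) \<in> Arr mixed_cat"
  shows "Fa right_adjoint (X, h, Y) \<in> Hom CC (Fo right_adjoint X) (Fo right_adjoint Y)"
    and "equalizer_of Y \<cdot>\<^bsub>CC\<^esub> Fa right_adjoint (X, h, Y) = cofree_arrow h \<cdot>\<^bsub>CC\<^esub> equalizer_of X"
proof -
  obtain N \<sigma> \<zeta> N' \<sigma>' \<zeta>' where XY: "X = (N, \<sigma>, \<zeta>)" "Y = (N', \<sigma>', \<zeta>')"
    by (cases X; cases Y) auto
  have X: "X \<in> Obj mixed_cat" "Y \<in> Obj mixed_cat" and A: "h \<in> Arr \<A>" "Dom \<A> h = N" "Cod \<A> h = N'"
    using h by (simp_all add: XY Hom_iff)
  have m: "is_mixed_module N \<sigma> \<zeta>" "is_mixed_module N' \<sigma>' \<zeta>'" using X by (simp_all add: XY)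
  note ch = cofree_arrow_in[OF A(1)] cofree_arrow_in[OF H.Fa_simps(1)[OF A(1)]]
  note lr = left_right_arrow[OF m(1)] left_right_arrow[OF m(2)]
  note sq = cofree_arrow_left_right[OF h[unfolded XY]]
  note e = equalizer_of_simps[OF X(1), unfolded XY] and q = G.CG.equalizer_simps(7)[OF equalizer_of_is_equalizer[OF X(1)], unfolded XY]
  have "left_arrow Y \<cdot>\<^bsub>CC\<^esub> (cofree_arrow h \<cdot>\<^bsub>CC\<^esub> equalizer_of X) = cofree_arrow (Fa H h) \<cdot>\<^bsub>CC\<^esub> (left_arrow X \<cdot>\<^bsub>CC\<^esub> equalizer_of X)"
    using e(1,2) A ch lr unfolding XY by (simp add: sq(1)[THEN G.CG.comp_reduce])
  also have "\<dots> = right_arrow Y \<cdot>\<^bsub>CC\<^esub> (cofree_arrow h \<cdot>\<^bsub>CC\<^esub> equalizer_of X)"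
    using e(1,2) A ch lr q unfolding XY by (simp add: sq(2)[THEN G.CG.comp_reduce])
  finally have "\<exists>!u. u \<in> Hom CC (Fo right_adjoint X) (Fo right_adjoint Y) \<and>
      equalizer_of Y \<cdot>\<^bsub>CC\<^esub> u = cofree_arrow h \<cdot>\<^bsub>CC\<^esub> equalizer_of X"
    using X A ch by (intro equalizer_of_factor) (simp_all add: Hom_iff XY)
  from theI'[OF this]
  have "Fa right_adjoint (X, h, Y) \<in> Hom CC (Fo right_adjoint X) (Fo right_adjoint Y) \<and>
      equalizer_of Y \<cdot>\<^bsub>CC\<^esub> Fa right_adjoint (X, h, Y) = cofree_arrow h \<cdot>\<^bsub>CC\<^esub> equalizer_of X"
    by (simp add: right_adjoint_def)
  then show "Fa right_adjoint (X, h, Y) \<in> Hom CC (Fo right_adjoint X) (Fo right_adjoint Y)"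
    "equalizer_of Y \<cdot>\<^bsub>CC\<^esub> Fa right_adjoint (X, h, Y) = cofree_arrow h \<cdot>\<^bsub>CC\<^esub> equalizer_of X" by simp_all
qed

lemma cofree_arrow_Ident:
  "N \<in> Obj \<A> \<Longrightarrow> cofree_arrow (Ident \<A> N) = Ident CC (Fo G N, \<delta> N)"
  by (simp add: cofree_arrow_def)

lemma cofree_arrow_comp:
  "f \<in> Arr \<A> \<Longrightarrow> g \<in> Arr \<A> \<Longrightarrow> Dom \<A> g = Cod \<A> f \<Longrightarrow>
    cofree_arrow (g \<cdot> f) = cofree_arrow g \<cdot>\<^bsub>CC\<^esub> cofree_arrow f"
  by (simp add: cofree_arrow_def)

lemma right_adjoint_functor: "cat_functor mixed_cat CC right_adjoint"
proof
  fix X assume X: "X \<in> Obj mixed_cat"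
  show "Fo right_adjoint X \<in> Obj CC" using right_adjoint_object[OF X] .
  obtain N \<sigma> \<zeta> where x: "X = (N, \<sigma>, \<zeta>)" by (cases X)
  have N: "N \<in> Obj \<A>" using X is_algebra_simps(1)[OF is_mixed_module_simps(1)] by (auto simp: x)
  have i: "(X, Ident \<A> (fst X), X) \<in> Arr mixed_cat" using MM.Ident_simps(1)[OF X] by simp
  show "Fa right_adjoint (Ident mixed_cat X) = Ident CC (Fo right_adjoint X)"
  proof (rule equalizer_of_mono[OF X])
    show "equalizer_of X \<cdot>\<^bsub>CC\<^esub> Fa right_adjoint (Ident mixed_cat X) = equalizer_of X \<cdot>\<^bsub>CC\<^esub> Ident CC (Fo right_adjoint X)"
      using right_adjoint_arrow(2)[OF i] X N equalizer_of_simps[OF X] G.CG.Ident_left[OF equalizer_of_simps(1,2)[OF X]]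
        G.CG.Ident_right[OF equalizer_of_simps(1,3)[OF X]]
      by (simp add: cofree_arrow_Ident x del: G.coalgebra_cat_simps)
  qed (use right_adjoint_arrow(1)[OF i] right_adjoint_object[OF X] G.CG.Ident_Hom in
      \<open>simp_all del: G.coalgebra_cat_simps\<close>)
next
  fix t X Y assume t: "t \<in> Hom mixed_cat X Y"
  then obtain h where "t = (X, h, Y)" "t \<in> Arr mixed_cat" by (cases t) (auto simp: Hom_iff)
  then show "Fa right_adjoint t \<in> Hom CC (Fo right_adjoint X) (Fo right_adjoint Y)"
    using right_adjoint_arrow(1) by simp
next
  fix t X Y t' Z assume t: "t \<in> Hom mixed_cat X Y" "t' \<in> Hom mixed_cat Y Z"
  obtain h where h: "t = (X, h, Y)" "(X, h, Y) \<in> Arr mixed_cat" using t by (cases t) (auto simp: Hom_iff)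
  obtain h' where h': "t' = (Y, h', Z)" "(Y, h', Z) \<in> Arr mixed_cat" using t by (cases t') (auto simp: Hom_iff)
  have XYZ: "X \<in> Obj mixed_cat" "Y \<in> Obj mixed_cat" "Z \<in> Obj mixed_cat"
    using MM.Dom_Cod_Obj[OF h(2)] MM.Dom_Cod_Obj[OF h'(2)] by simp_all
  have A: "h \<in> Arr \<A>" "h' \<in> Arr \<A>" "Dom \<A> h = fst X" "Cod \<A> h = fst Y" "Dom \<A> h' = fst Y" "Cod \<A> h' = fst Z"
    using h(2) h'(2) by (auto elim!: mixed_arr_cases)
  have hh: "(X, h' \<cdot> h, Z) \<in> Arr mixed_cat"
    using MM.Comp_Hom[OF t] by (simp add: h h' Hom_iff)
  note R = right_adjoint_arrow[OF h(2)] right_adjoint_arrow[OF h'(2)] right_adjoint_arrow[OF hh]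
  note e = equalizer_of_simps[OF XYZ(1)] equalizer_of_simps[OF XYZ(2)] equalizer_of_simps[OF XYZ(3)]
  show "Fa right_adjoint (t' \<cdot>\<^bsub>mixed_cat\<^esub> t) = Fa right_adjoint t' \<cdot>\<^bsub>CC\<^esub> Fa right_adjoint t"
  proof (rule equalizer_of_mono[OF XYZ(3)])
    have "equalizer_of Z \<cdot>\<^bsub>CC\<^esub> (Fa right_adjoint t' \<cdot>\<^bsub>CC\<^esub> Fa right_adjoint t) =
        cofree_arrow h' \<cdot>\<^bsub>CC\<^esub> (cofree_arrow h \<cdot>\<^bsub>CC\<^esub> equalizer_of X)"
      using e R(1,3) cofree_arrow_in A
      by (simp add: h(1) h'(1) Hom_iff R(4)[THEN G.CG.comp_reduce] R(2))
    then show "equalizer_of Z \<cdot>\<^bsub>CC\<^esub> Fa right_adjoint (t' \<cdot>\<^bsub>mixed_cat\<^esub> t) =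
        equalizer_of Z \<cdot>\<^bsub>CC\<^esub> (Fa right_adjoint t' \<cdot>\<^bsub>CC\<^esub> Fa right_adjoint t)"
      using e A cofree_arrow_in by (simp add: h(1) h'(1) R(6) cofree_arrow_comp)
    show "Fa right_adjoint (t' \<cdot>\<^bsub>mixed_cat\<^esub> t) \<in> Hom CC (Fo right_adjoint X) (Fo right_adjoint Z)"
      using R(5) by (simp add: h(1) h'(1))
    show "Fa right_adjoint t' \<cdot>\<^bsub>CC\<^esub> Fa right_adjoint t \<in> Hom CC (Fo right_adjoint X) (Fo right_adjoint Z)"
      using G.CG.Comp_Hom[OF R(1) R(3)] by (simp add: h(1) h'(1))
  qed
qed

lemma adj_unit_arrow:
  assumes "x \<in> Obj CC"
  shows "adj_unit x \<in> Hom CC x (Fo right_adjoint (Fo left_adjoint x))"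
    and "equalizer_of (Fo left_adjoint x) \<cdot>\<^bsub>CC\<^esub> adj_unit x = unit_arrow x"
proof -
  obtain N c where x: "x = (N, c)" by (cases x)
  have c: "G.is_coalgebra N c" using assms by (simp add: x)
  have "\<exists>!u. u \<in> Hom CC x (Fo right_adjoint (Fo left_adjoint x)) \<and>
      equalizer_of (Fo left_adjoint x) \<cdot>\<^bsub>CC\<^esub> u = unit_arrow x"
    using left_adjoint_object[OF c] unit_arrow_in[OF c] unit_arrow_fork[OF c]
    by (intro equalizer_of_factor) (simp_all add: x Hom_iff left_adjoint_simps, simp_all add: unit_arrow_def)
  from theI'[OF this]
  have "adj_unit x \<in> Hom CC x (Fo right_adjoint (Fo left_adjoint x)) \<and>
      equalizer_of (Fo left_adjoint x) \<cdot>\<^bsub>CC\<^esub> adj_unit x = unit_arrow x"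
    by (simp add: x adj_unit_def Let_def unit_arrow_def left_adjoint_simps)
  then show "adj_unit x \<in> Hom CC x (Fo right_adjoint (Fo left_adjoint x))"
    "equalizer_of (Fo left_adjoint x) \<cdot>\<^bsub>CC\<^esub> adj_unit x = unit_arrow x" by simp_all
qed

lemma adj_counit_arrow:
  assumes "X \<in> Obj mixed_cat"
  shows "adj_counit X \<in> Hom mixed_cat (Fo left_adjoint (Fo right_adjoint X)) X"
proof -
  obtain N \<sigma> \<zeta> where X: "X = (N, \<sigma>, \<zeta>)" by (cases X)
  have m: "is_mixed_module N \<sigma> \<zeta>" using assms by (simp add: X)
  obtain E c e where e: "equalizer_of (N, \<sigma>, \<zeta>) = ((E, c), e, (Fo G N, \<delta> N))" "G.is_coalgebra E c" "e \<in> Arr \<A>"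
    "Dom \<A> e = E" "Cod \<A> e = Fo G N" "\<delta> N \<cdot> e = Fa G e \<cdot> c" "(Fa G (j N) \<cdot> \<delta> N) \<cdot> e = Fa G \<zeta> \<cdot> e"
    using equalizer_of_cases[OF m] .
  show ?thesis
    using counit_mixed_map[OF m e(2-7)]
    by (simp add: X adj_counit_def right_adjoint_def e(1) left_adjoint_simps underlying_def Hom_iff[of _ mixed_cat])
qed

lemma adj_unit_natural: "natural_transformation CC CC id_func (comp_func right_adjoint left_adjoint) adj_unit"
  unfolding natural_transformation_def comp_func_def id_func_def
proof (intro conjI ballI, simp_all del: G.coalgebra_cat_simps)
  fix x assume "x \<in> Obj CC"
  then show "adj_unit x \<in> Hom CC x (Fo right_adjoint (Fo left_adjoint x))" by (rule adj_unit_arrow)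
next
  fix t assume t: "t \<in> Arr CC"
  obtain N c f N' c' where f: "t = ((N, c), f, (N', c'))" "G.is_coalgebra N c" "G.is_coalgebra N' c'"
    "f \<in> Arr \<A>" "Dom \<A> f = N" "Cod \<A> f = N'" "c' \<cdot> f = Fa G f \<cdot> c"
    using t by (rule G.coalgebra_arr_cases)
  note c = G.is_coalgebra_simps(1-4)[OF f(2)] G.is_coalgebra_simps(1-4)[OF f(3)]
  let ?X = "Fo left_adjoint (N, c)" and ?Y = "Fo left_adjoint (N', c')"
  interpret L: cat_functor CC mixed_cat left_adjoint by (rule left_adjoint_functor)
  have Lt: "(?X, Fa S f, ?Y) \<in> Arr mixed_cat"
    using L.Fa_simps(1)[OF t] by (simp add: f(1) left_adjoint_simps(2))
  have XY: "?X \<in> Obj mixed_cat" "?Y \<in> Obj mixed_cat" using f(2,3) L.Fo_in_Obj by simp_all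
  have nc: "(N, c) \<in> Obj CC" "(N', c') \<in> Obj CC" using f by simp_all
  note u = adj_unit_arrow[OF nc(1)] adj_unit_arrow[OF nc(2)]
  note R = right_adjoint_arrow[OF Lt]
  note e = equalizer_of_simps[OF XY(1)] equalizer_of_simps[OF XY(2)]
  have fstX: "fst ?X = Fo S N" by (simp add: left_adjoint_simps)
  have 1: "Fa G (Fa S f) \<cdot> Fa G (Iota S N) = Fa G (Iota S N') \<cdot> Fa G f"
    using f(4-6) c by (simp add: G.Fa_eq[OF S.Iota_nat])
  have "Fa right_adjoint (?X, Fa S f, ?Y) \<cdot>\<^bsub>CC\<^esub> adj_unit (N, c) = adj_unit (N', c') \<cdot>\<^bsub>CC\<^esub> t"
  proof (rule equalizer_of_mono[OF XY(2)])
    have "equalizer_of ?Y \<cdot>\<^bsub>CC\<^esub> (Fa right_adjoint (?X, Fa S f, ?Y) \<cdot>\<^bsub>CC\<^esub> adj_unit (N, c)) =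
        cofree_arrow (Fa S f) \<cdot>\<^bsub>CC\<^esub> unit_arrow (N, c)"
      using e R(1) u(1) cofree_arrow_in[OF S.Fa_simps(1)[OF f(4)]] f(4-6)
      by (simp add: Hom_iff R(2)[THEN G.CG.comp_reduce] u(2) fstX)
    also have "\<dots> = unit_arrow (N', c') \<cdot>\<^bsub>CC\<^esub> t"
      using c f(4-6) by (simp add: unit_arrow_def cofree_arrow_def f(1) 1[THEN comp_reduce] f(7))
    also have "\<dots> = equalizer_of ?Y \<cdot>\<^bsub>CC\<^esub> (adj_unit (N', c') \<cdot>\<^bsub>CC\<^esub> t)"
      using G.CG.comp_assoc[OF t, of "adj_unit (N', c')" "equalizer_of ?Y"] u e by (simp add: f(1) Hom_iff)
    finally show "equalizer_of ?Y \<cdot>\<^bsub>CC\<^esub> (Fa right_adjoint (?X, Fa S f, ?Y) \<cdot>\<^bsub>CC\<^esub> adj_unit (N, c)) =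
        equalizer_of ?Y \<cdot>\<^bsub>CC\<^esub> (adj_unit (N', c') \<cdot>\<^bsub>CC\<^esub> t)" .
    show "Fa right_adjoint (?X, Fa S f, ?Y) \<cdot>\<^bsub>CC\<^esub> adj_unit (N, c) \<in> Hom CC (N, c) (Fo right_adjoint ?Y)"
      by (rule G.CG.Comp_Hom[OF u(1) R(1)])
    show "adj_unit (N', c') \<cdot>\<^bsub>CC\<^esub> t \<in> Hom CC (N, c) (Fo right_adjoint ?Y)"
      by (rule G.CG.Comp_Hom[OF _ u(3)]) (use t in \<open>simp add: f(1) Hom_iff[of _ CC]\<close>)
  qed
  then show "Fa right_adjoint (Fa left_adjoint t) \<cdot>\<^bsub>CC\<^esub> adj_unit (Dom CC t) = adj_unit (Cod CC t) \<cdot>\<^bsub>CC\<^esub> t"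
    by (simp add: f(1) left_adjoint_simps(2))
qed

lemma adj_counit_natural:
  "natural_transformation mixed_cat mixed_cat (comp_func left_adjoint right_adjoint) id_func adj_counit"
  unfolding natural_transformation_def comp_func_def id_func_def
proof (intro conjI ballI, simp_all del: mixed_cat_simps)
  fix X assume "X \<in> Obj mixed_cat"
  then show "adj_counit X \<in> Hom mixed_cat (Fo left_adjoint (Fo right_adjoint X)) X" by (rule adj_counit_arrow)
next
  fix t assume t: "t \<in> Arr mixed_cat"
  obtain N \<sigma> \<zeta> h N' \<sigma>' \<zeta>' where h: "t = ((N, \<sigma>, \<zeta>), h, (N', \<sigma>', \<zeta>'))" "is_mixed_module N \<sigma> \<zeta>"
    "is_mixed_module N' \<sigma>' \<zeta>'" "h \<in> Arr \<A>" "Dom \<A> h = N" "Cod \<A> h = N'" "h \<cdot> \<sigma> = \<sigma>' \<cdot> Fa S h"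
    using t by (rule mixed_arr_cases)
  obtain E c e where e: "equalizer_of (N, \<sigma>, \<zeta>) = ((E, c), e, (Fo G N, \<delta> N))" "G.is_coalgebra E c" "e \<in> Arr \<A>"
    "Dom \<A> e = E" "Cod \<A> e = Fo G N" using equalizer_of_cases[OF h(2)] .
  obtain E' c' e' where e': "equalizer_of (N', \<sigma>', \<zeta>') = ((E', c'), e', (Fo G N', \<delta> N'))" "G.is_coalgebra E' c'"
    "e' \<in> Arr \<A>" "Dom \<A> e' = E'" "Cod \<A> e' = Fo G N'" using equalizer_of_cases[OF h(3)] .
  note s = is_algebra_simps(1-4)[OF is_mixed_module_simps(1)[OF h(2)]]
    is_algebra_simps(1-4)[OF is_mixed_module_simps(1)[OF h(3)]]
  note R = right_adjoint_arrow[OF t[unfolded h(1)]]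
  obtain u where u: "Fa right_adjoint t = ((E, c), u, (E', c'))" "u \<in> Arr \<A>" "Dom \<A> u = E" "Cod \<A> u = E'"
    using R(1) e e' by (auto simp: h(1) right_adjoint_def Hom_iff[of _ CC] elim!: G.coalgebra_arr_cases)
  have "e' \<cdot> u = Fa G h \<cdot> e"
    using R(2) u(1) e(1) e'(1) by (simp add: h(1) cofree_arrow_def)
  then have 1: "Fa S e' \<cdot> Fa S u = Fa S (Fa G h) \<cdot> Fa S e"
    using e e' u h(4-6) S.Fa_eq[of e' u "Fa G h \<cdot> e"] by simp
  have 2: "Fa S (\<epsilon> N') \<cdot> Fa S (Fa G h) = Fa S h \<cdot> Fa S (\<epsilon> N)"
    using s h(4-6) by (simp add: S.Fa_eq[OF G.counit_nat])
  have "h \<cdot> (\<sigma> \<cdot> Fa S (\<epsilon> N) \<cdot> Fa S e) = (\<sigma>' \<cdot> Fa S (\<epsilon> N') \<cdot> Fa S e') \<cdot> Fa S u"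
    using s e(2-) e'(2-) u(2-) h(4-6) by (simp add: 1 2[THEN comp_reduce] h(7)[THEN comp_reduce])
  moreover have "Fo right_adjoint (N, \<sigma>, \<zeta>) = (E, c)" "Fo right_adjoint (N', \<sigma>', \<zeta>') = (E', c')"
    by (simp_all add: right_adjoint_def e(1) e'(1))
  ultimately show "t \<cdot>\<^bsub>mixed_cat\<^esub> adj_counit (Dom mixed_cat t) =
      adj_counit (Cod mixed_cat t) \<cdot>\<^bsub>mixed_cat\<^esub> Fa left_adjoint (Fa right_adjoint t)"
    using e(1) e'(1) by (simp add: h(1) u(1)[unfolded h(1)] adj_counit_def underlying_def left_adjoint_simps)
qed

lemma triangle_left:
  assumes "x \<in> Obj CC"
  shows "adj_counit (Fo left_adjoint x) \<cdot>\<^bsub>mixed_cat\<^esub> Fa left_adjoint (adj_unit x) = Ident mixed_cat (Fo left_adjoint x)"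
proof -
  obtain N c where x: "x = (N, c)" by (cases x)
  have c': "G.is_coalgebra N c" using assms by (simp add: x)
  note c = G.is_coalgebra_simps[OF c']
  obtain E d e where e: "equalizer_of (Fo left_adjoint x) = ((E, d), e, (Fo G (Fo S N), \<delta> (Fo S N)))" "G.is_coalgebra E d"
    "e \<in> Arr \<A>" "Dom \<A> e = E" "Cod \<A> e = Fo G (Fo S N)"
    using equalizer_of_cases[OF left_adjoint_object[OF c']] by (metis x left_adjoint_simps(1))
  have R: "Fo right_adjoint (Fo left_adjoint x) = (E, d)" by (simp add: right_adjoint_def e(1))
  obtain u where u: "adj_unit x = ((N, c), u, (E, d))" "u \<in> Arr \<A>" "Dom \<A> u = N" "Cod \<A> u = E"
    using adj_unit_arrow(1)[OF assms] unfolding R by (auto simp: x Hom_iff[of _ CC] elim!: G.coalgebra_arr_cases)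
  have eu: "e \<cdot> u = Fa G (Iota S N) \<cdot> c"
    using adj_unit_arrow(2)[OF assms] unfolding e(1) u(1) by (simp add: x unit_arrow_def)
  have "Fa S e \<cdot> Fa S u = Fa S (Fa G (Iota S N)) \<cdot> Fa S c"
    using c(1-4) e u by (simp add: S.Fa_eq[OF eu])
  moreover have "Fa S (\<epsilon> (Fo S N)) \<cdot> Fa S (Fa G (Iota S N)) = Fa S (Iota S N) \<cdot> Fa S (\<epsilon> N)"
    using c(1-4) by (simp add: S.Fa_eq[OF G.counit_nat])
  moreover have "Fa S (\<epsilon> N) \<cdot> Fa S c = Ident \<A> (Fo S N)"
    using c(1-4) by (simp add: S.Fa_eq[OF c(6)])
  ultimately have "(Mu S N \<cdot> Fa S (\<epsilon> (Fo S N)) \<cdot> Fa S e) \<cdot> Fa S u = Ident \<A> (Fo S N)"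
    using c(1-4) e(2-) u(2-) comp_reduce[of "Fa S (\<epsilon> (Fo S N))" "Fa S (Fa G (Iota S N))" _ "Fa S c"]
      by (simp add: S.Mu_Iota_right)
  then show ?thesis
    using e(1) by (simp add: x u(1)[unfolded x] adj_counit_def left_adjoint_simps right_adjoint_def underlying_def)
qed

lemma triangle_right:
  assumes X: "X \<in> Obj mixed_cat"
  shows "Fa right_adjoint (adj_counit X) \<cdot>\<^bsub>CC\<^esub> adj_unit (Fo right_adjoint X) = Ident CC (Fo right_adjoint X)"
proof -
  obtain N \<sigma> \<zeta> where x: "X = (N, \<sigma>, \<zeta>)" by (cases X)
  have m: "is_mixed_module N \<sigma> \<zeta>" using X by (simp add: x)
  note s = is_algebra_simps[OF is_mixed_module_simps(1)[OF m]]
  obtain E c e where e: "equalizer_of X = ((E, c), e, (Fo G N, \<delta> N))" "G.is_coalgebra E c" "e \<in> Arr \<A>"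
    "Dom \<A> e = E" "Cod \<A> e = Fo G N" "\<delta> N \<cdot> e = Fa G e \<cdot> c"
    using equalizer_of_cases[OF m] by (metis x)
  note c = G.is_coalgebra_simps(1-4)[OF e(2)]
  have R: "Fo right_adjoint X = (E, c)" by (simp add: right_adjoint_def e(1))
  let ?k = "\<sigma> \<cdot> Fa S (\<epsilon> N) \<cdot> Fa S e" and ?X' = "Fo left_adjoint (E, c)"
  have k: "adj_counit X = (?X', ?k, X)"
    using e(1) by (simp add: x adj_counit_def right_adjoint_def underlying_def)
  have kA: "(?X', ?k, X) \<in> Arr mixed_cat"
    using adj_counit_arrow[OF X] unfolding k by (simp add: Hom_iff R)
  have E: "(E, c) \<in> Obj CC" using e(2) by simp
  have fstX: "fst ?X' = Fo S E" by (simp add: left_adjoint_simps)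
  have X': "?X' \<in> Obj mixed_cat" using MM.Dom_Cod_Obj(1)[OF kA] by simp
  note u = adj_unit_arrow[OF E] and K = right_adjoint_arrow[OF kA]
  note q = equalizer_of_simps[OF X] equalizer_of_simps[OF X']
  have "Fa right_adjoint (?X', ?k, X) \<cdot>\<^bsub>CC\<^esub> adj_unit (E, c) = Ident CC (Fo right_adjoint X)"
  proof (rule equalizer_of_mono[OF X])
    have kA': "?k \<in> Arr \<A>" "Dom \<A> ?k = Fo S E" "Cod \<A> ?k = N" using s(1-4) e(3-5) by simp_all
    have "?k \<cdot> Iota S E = \<epsilon> N \<cdot> e"
      using s(1-4) e(3-5) c S.Iota_nat[of e "Fo G N", symmetric]
        S.Iota_nat[of "\<epsilon> N" N, THEN comp_reduce, of e, symmetric]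
      by (simp add: s(6)[THEN comp_reduce])
    then have 1: "Fa G ?k \<cdot> Fa G (Iota S E) = Fa G (\<epsilon> N) \<cdot> Fa G e"
      using kA' s(1) e(3-5) c G.Fa_eq[of ?k "Iota S E"] by simp
    have "Fa G ?k \<cdot> (Fa G (Iota S E) \<cdot> c) = Fa G (\<epsilon> N) \<cdot> (\<delta> N \<cdot> e)"
      unfolding e(6) using kA' s(1) e(3-5) c 1[THEN comp_reduce, of c] by simp
    also have "\<dots> = e" using s(1) e(3-5) by (simp add: G.Fa_counit_comult[THEN comp_reduce])
    finally have 2: "cofree_arrow ?k \<cdot>\<^bsub>CC\<^esub> unit_arrow (E, c) = equalizer_of X"
      unfolding e(1) cofree_arrow_def unit_arrow_def using kA' by (simp del: S.Fa_on_Comp G.Fa_on_Comp)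
    have "equalizer_of X \<cdot>\<^bsub>CC\<^esub> (Fa right_adjoint (?X', ?k, X) \<cdot>\<^bsub>CC\<^esub> adj_unit (E, c)) =
        cofree_arrow ?k \<cdot>\<^bsub>CC\<^esub> (equalizer_of ?X' \<cdot>\<^bsub>CC\<^esub> adj_unit (E, c))"
      using q K(1) u(1) cofree_arrow_in[OF kA'(1)] kA'
      by (simp add: Hom_iff[of _ CC] K(2)[THEN G.CG.comp_reduce] fstX)
    then show "equalizer_of X \<cdot>\<^bsub>CC\<^esub> (Fa right_adjoint (?X', ?k, X) \<cdot>\<^bsub>CC\<^esub> adj_unit (E, c)) =
        equalizer_of X \<cdot>\<^bsub>CC\<^esub> Ident CC (Fo right_adjoint X)"
      using q(1-3) 2 u(2) G.CG.Ident_right[OF q(1,3)] by simp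
    show "Fa right_adjoint (?X', ?k, X) \<cdot>\<^bsub>CC\<^esub> adj_unit (E, c) \<in> Hom CC (Fo right_adjoint X) (Fo right_adjoint X)"
      using G.CG.Comp_Hom[OF u(1) K(1)] by (simp add: R)
    show "Ident CC (Fo right_adjoint X) \<in> Hom CC (Fo right_adjoint X) (Fo right_adjoint X)"
      by (rule G.CG.Ident_Hom[OF right_adjoint_object[OF X]])
  qed
  then show ?thesis by (simp add: k R)
qed

end

section \<open>Equivalence and the Galois map\<close>

context mixed_distributive_law
begin

abbreviation AA where "AA \<equiv> algebra_cat \<A> S"

lemma lifted_algebra_map:
  assumes "is_algebra \<A> S N \<sigma>" "is_algebra \<A> S N' \<sigma>'" "f \<in> Hom \<A> N N'" "f \<cdot> \<sigma> = \<sigma>' \<cdot> Fa S f"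
  shows "Fa H f \<cdot> (Fa H \<sigma> \<cdot> \<tau> N) = (Fa H \<sigma>' \<cdot> \<tau> N') \<cdot> Fa S (Fa H f)"
proof -
  note a = is_algebra_simps(1-4)[OF assms(1)] is_algebra_simps(1-4)[OF assms(2)]
  have f: "f \<in> Arr \<A>" "Dom \<A> f = N" "Cod \<A> f = N'" using assms(3) by (simp_all add: Hom_iff)
  have "Fa H f \<cdot> Fa H \<sigma> = Fa H \<sigma>' \<cdot> Fa H (Fa S f)" using a f by (simp add: H.Fa_eq[OF assms(4)])
  then show ?thesis using a f by (simp add: law_push H.Fa_eq[OF assms(4), THEN comp_reduce])
qed

lemma lifted_counit_algebra_map:
  assumes "is_algebra \<A> S N \<sigma>"
  shows "\<epsilon>' N \<cdot> (Fa H \<sigma> \<cdot> \<tau> N) = \<sigma> \<cdot> Fa S (\<epsilon>' N)"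
  using is_algebra_simps(1-4)[OF assms] by (simp add: counit'_push law_counit)

text \<open>
  The standard splitting of a coalgebra by \<open>\<epsilon>'\<^sub>N\<close> and \<open>\<epsilon>'\<^bsub>H N\<^esub>\<close> consists of algebra maps, because the whole
  comonad \<open>H\<close> lifts to algebras.
\<close>

lemma coaction_split_cofork:
  assumes m: "is_mixed_module N \<sigma> \<zeta>"
  defines "\<sigma>1 \<equiv> Fa H \<sigma> \<cdot> \<tau> N"
  defines "\<sigma>2 \<equiv> Fa H \<sigma>1 \<cdot> \<tau> (Fo H N)"
  shows "split_cofork AA ((N, \<sigma>), \<zeta>, (Fo H N, \<sigma>1))
    ((Fo H N, \<sigma>1), \<delta>' N, (Fo H (Fo H N), \<sigma>2)) ((Fo H N, \<sigma>1), Fa H \<zeta>, (Fo H (Fo H N), \<sigma>2))"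
proof -
  note a = is_mixed_module_simps[OF m]
  note s = is_algebra_simps(1-4)[OF a(1)] and z = H.is_coalgebra_simps[OF a(2)]
  have alg: "is_algebra \<A> S (Fo H N) \<sigma>1" unfolding \<sigma>1_def by (rule lifted_algebra[OF a(1)])
  then have alg2: "is_algebra \<A> S (Fo H (Fo H N)) \<sigma>2" unfolding \<sigma>2_def by (rule lifted_algebra)
  note s1 = is_algebra_simps(1-4)[OF alg] is_algebra_simps(1-4)[OF alg2]
  have zeta: "((N, \<sigma>), \<zeta>, (Fo H N, \<sigma>1)) \<in> Arr AA"
    using a alg s z(1-4) by (simp add: Hom_iff \<sigma>1_def)
  have comult: "((Fo H N, \<sigma>1), \<delta>' N, (Fo H (Fo H N), \<sigma>2)) \<in> Arr AA"
    using is_mixed_module_simps(3)[OF cofree_mixed_module[OF a(1)]] alg alg2 s s1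
    by (simp add: Hom_iff) (simp add: \<sigma>1_def \<sigma>2_def)
  have Hzeta: "((Fo H N, \<sigma>1), Fa H \<zeta>, (Fo H (Fo H N), \<sigma>2)) \<in> Arr AA"
    using lifted_algebra_map[OF a(1) alg, of \<zeta>] zeta alg alg2 s s1
    by (simp add: Hom_iff) (simp add: \<sigma>1_def \<sigma>2_def)
  have p: "((Fo H N, \<sigma>1), \<epsilon>' N, (N, \<sigma>)) \<in> Arr AA"
    using lifted_counit_algebra_map[OF a(1)] alg a(1) s by (simp add: Hom_iff \<sigma>1_def)
  have q: "((Fo H (Fo H N), \<sigma>2), \<epsilon>' (Fo H N), (Fo H N, \<sigma>1)) \<in> Arr AA"
    using lifted_counit_algebra_map[OF alg] alg alg2 s by (simp add: Hom_iff \<sigma>2_def)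
  show ?thesis
    by (rule split_coforkI[of _ _ _ _ "((Fo H N, \<sigma>1), \<epsilon>' N, (N, \<sigma>))"
          "((Fo H (Fo H N), \<sigma>2), \<epsilon>' (Fo H N), (Fo H N, \<sigma>1))"])
      (use zeta comult Hzeta p q z in
        \<open>simp_all add: H.counit_comult H.counit_nat del: S.algebra_cat_simps(2)\<close>)
qed

end

context comonad_change
begin

text \<open>
  The Galois maps at \<open>N\<close> and at \<open>H N\<close> identify the image of the pair under the free algebra functor with
  the pair that \<open>coaction_split_cofork\<close> splits.
\<close>

lemma left_right_split:
  assumes iso: "\<And>N \<sigma>. is_algebra \<A> S N \<sigma> \<Longrightarrow> is_iso \<A> (galois N \<sigma>)"
    and m: "is_mixed_module N \<sigma> \<zeta>"
  shows "monad_split_pair \<A> S (Fa G (j N) \<cdot> \<delta> N) (Fa G \<zeta>)"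
proof -
  define \<sigma>1 where "\<sigma>1 = Fa H \<sigma> \<cdot> \<tau> N"
  define \<sigma>2 where "\<sigma>2 = Fa H \<sigma>1 \<cdot> \<tau> (Fo H N)"
  note a = is_mixed_module_simps[OF m]
  note s = is_algebra_simps(1-4)[OF a(1)] and z = H.is_coalgebra_simps[OF a(2)]
  have alg: "is_algebra \<A> S (Fo H N) \<sigma>1" unfolding \<sigma>1_def by (rule lifted_algebra[OF a(1)])
  then have alg2: "is_algebra \<A> S (Fo H (Fo H N)) \<sigma>2" unfolding \<sigma>2_def by (rule lifted_algebra)
  let ?FN = "(Fo S (Fo G N), Mu S (Fo G N))" and ?FHN = "(Fo S (Fo G (Fo H N)), Mu S (Fo G (Fo H N)))"
  let ?f = "Fa G (j N) \<cdot> \<delta> N" and ?g = "Fa G \<zeta>"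
  have free: "is_algebra \<A> S (Fo S (Fo G N)) (Mu S (Fo G N))"
    "is_algebra \<A> S (Fo S (Fo G (Fo H N))) (Mu S (Fo G (Fo H N)))"
    using s(1) by (simp_all add: S.free_algebra_is_algebra)
  have f: "?f \<in> Arr \<A>" "Dom \<A> ?f = Fo G N" "Cod \<A> ?f = Fo G (Fo H N)"
    and g: "?g \<in> Arr \<A>" "Dom \<A> ?g = Fo G N" "Cod \<A> ?g = Fo G (Fo H N)"
    using s(1) z(1-4) by simp_all
  have Ff: "(?FN, Fa S ?f, ?FHN) \<in> Arr AA"
    using free f S.Mu_nat[OF f(1,3)] by (simp add: Hom_iff del: S.Fa_on_Comp G.Fa_on_Comp comp_assoc)
  have Fg: "(?FN, Fa S ?g, ?FHN) \<in> Arr AA"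
    using free g S.Mu_nat[OF g(1,3)] by (simp add: Hom_iff)
  have gal1: "(?FN, galois N \<sigma>, (Fo H N, \<sigma>1)) \<in> Arr AA"
    using free alg a(1) galois_algebra_map[OF a(1)] by (simp add: Hom_iff \<sigma>1_def del: comp_assoc)
  have gal2: "(?FHN, galois (Fo H N) \<sigma>1, (Fo H (Fo H N), \<sigma>2)) \<in> Arr AA"
    using free alg alg2 galois_algebra_map[OF alg] by (simp add: Hom_iff \<sigma>2_def del: comp_assoc)
  have "\<exists>e'. split_cofork AA e' (?FN, Fa S ?f, ?FHN) (?FN, Fa S ?g, ?FHN)"
  proof (rule S.AA.split_cofork_transport[OF coaction_split_cofork[OF m]])
    show "is_iso AA (?FN, galois N \<sigma>, (Fo H N, \<sigma>1))" by (rule S.algebra_iso[OF gal1 iso[OF a(1)]])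
    show "is_iso AA (?FHN, galois (Fo H N) \<sigma>1, (Fo H (Fo H N), \<sigma>2))"
      by (rule S.algebra_iso[OF gal2 iso[OF alg]])
    show "(?FHN, galois (Fo H N) \<sigma>1, (Fo H (Fo H N), \<sigma>2)) \<cdot>\<^bsub>AA\<^esub> (?FN, Fa S ?f, ?FHN) =
      ((Fo H N, Fa H \<sigma> \<cdot> \<tau> N), \<delta>' N, (Fo H (Fo H N), Fa H (Fa H \<sigma> \<cdot> \<tau> N) \<cdot> \<tau> (Fo H N))) \<cdot>\<^bsub>AA\<^esub>
        (?FN, galois N \<sigma>, (Fo H N, \<sigma>1))"
      using galois_left[OF a(1)] by (simp add: \<sigma>1_def \<sigma>2_def)
    show "(?FHN, galois (Fo H N) \<sigma>1, (Fo H (Fo H N), \<sigma>2)) \<cdot>\<^bsub>AA\<^esub> (?FN, Fa S ?g, ?FHN) =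
      ((Fo H N, Fa H \<sigma> \<cdot> \<tau> N), Fa H \<zeta>, (Fo H (Fo H N), Fa H (Fa H \<sigma> \<cdot> \<tau> N) \<cdot> \<tau> (Fo H N))) \<cdot>\<^bsub>AA\<^esub>
        (?FN, galois N \<sigma>, (Fo H N, \<sigma>1))"
      using galois_right[OF m] by (simp add: \<sigma>1_def \<sigma>2_def)
  qed (use Ff Fg in \<open>simp_all add: Hom_iff[of _ AA] \<sigma>1_def \<sigma>2_def del: S.algebra_cat_simps(2)\<close>)
  then show ?thesis
    using f g by (simp add: monad_split_pair_def parallel_pair_def free_algebra_def del: S.Fa_on_Comp)
qed

text \<open>
  At the cofree module \<open>H N\<close> the pair is split by \<open>G \<epsilon>'\<close> and \<open>G (H \<epsilon>')\<close>, that is, by the counit of the last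
  factor \<open>H\<close>. The splitting retracts \<open>right_arrow\<close>, so the pair is taken in the opposite order.
\<close>

lemma cofree_equalizer:
  assumes "is_algebra \<A> S N \<sigma>"
  defines "X \<equiv> (Fo H N, Fa H \<sigma> \<cdot> \<tau> N, \<delta>' N)"
  shows "is_equalizer CC (left_arrow X) (right_arrow X) (left_arrow (N, \<sigma>, \<zeta>))"
proof -
  note s = is_algebra_simps(1-4)[OF assms(1)]
  note m = cofree_mixed_module[OF assms(1)]
  note lr = left_right_arrow[OF m, folded X_def]
  have e: "left_arrow (N, \<sigma>, \<zeta>) \<in> Arr CC"
    using s by (simp add: left_arrow_def G.cofree_coalgebra Hom_iff comult_push G.comult_coassoc)
  have 1: "Fa G (\<delta>' N) \<cdot> Fa G (j N) = Fa G (Fa H (j N)) \<cdot> (Fa G (j (Fo G N)) \<cdot> Fa G (\<delta> N))"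
    using s by (simp add: G.Fa_eq[OF change_comult])
  have 2: "Fa G (j (Fo H N)) \<cdot> Fa G (Fa G (j N)) = Fa G (Fa H (j N)) \<cdot> Fa G (j (Fo G N))"
    using s by (simp add: G.Fa_eq[OF change_nat])
  have 3: "Fa G (j N) \<cdot> Fa G (Fa G (\<epsilon>' N)) = Fa G (Fa H (\<epsilon>' N)) \<cdot> Fa G (j (Fo H N))"
    using s by (simp add: G.Fa_eq[OF change_nat])
  have fork: "right_arrow X \<cdot>\<^bsub>CC\<^esub> left_arrow (N, \<sigma>, \<zeta>) = left_arrow X \<cdot>\<^bsub>CC\<^esub> left_arrow (N, \<sigma>, \<zeta>)"
    using s by (simp add: X_def left_arrow_def right_arrow_def comult_push G.comult_coassoc
        1[THEN comp_reduce] 2[THEN comp_reduce])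
  let ?p = "cofree_arrow (\<epsilon>' N)" and ?q = "cofree_arrow (Fa H (\<epsilon>' N))"
  have pq: "?p \<in> Arr CC" "?q \<in> Arr CC" using s by (simp_all add: cofree_arrow_in)
  have "Fa G (\<epsilon>' N) \<cdot> (Fa G (j N) \<cdot> \<delta> N) = Ident \<A> (Fo G N)"
    using s by (simp add: G.Fa_eq[OF change_counit, THEN comp_reduce] G.Fa_counit_comult)
  then have pe: "?p \<cdot>\<^bsub>CC\<^esub> left_arrow (N, \<sigma>, \<zeta>) = Ident CC (Fo G N, \<delta> N)"
    using s by (simp add: left_arrow_def cofree_arrow_def)
  have qr: "?q \<cdot>\<^bsub>CC\<^esub> right_arrow X = Ident CC (Fo G (Fo H N), \<delta> (Fo H N))"
    using s by (simp add: X_def right_arrow_def cofree_arrow_def G.Fa_eq[OF H.Fa_counit_comult])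
  have ep: "left_arrow (N, \<sigma>, \<zeta>) \<cdot>\<^bsub>CC\<^esub> ?p = ?q \<cdot>\<^bsub>CC\<^esub> left_arrow X"
    using s by (simp add: X_def left_arrow_def cofree_arrow_def comult_push 3[THEN comp_reduce])
  have ends: "Dom CC (left_arrow X) = (Fo G (Fo H N), \<delta> (Fo H N))"
    "Dom CC (right_arrow X) = (Fo G (Fo H N), \<delta> (Fo H N))"
    "Cod CC (left_arrow X) = (Fo G (Fo H (Fo H N)), \<delta> (Fo H (Fo H N)))"
    "Cod CC (right_arrow X) = (Fo G (Fo H (Fo H N)), \<delta> (Fo H (Fo H N)))"
    "Dom CC ?p = (Fo G (Fo H N), \<delta> (Fo H N))" "Cod CC ?p = (Fo G N, \<delta> N)"
    "Dom CC ?q = (Fo G (Fo H (Fo H N)), \<delta> (Fo H (Fo H N)))" "Cod CC ?q = (Fo G (Fo H N), \<delta> (Fo H N))"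
    using s by (simp_all add: X_def)
  have "split_cofork CC (left_arrow (N, \<sigma>, \<zeta>)) (right_arrow X) (left_arrow X)"
    by (rule split_coforkI[of _ _ _ _ ?p ?q])
      (use lr e fork pq pe qr ep ends in \<open>simp_all del: G.coalgebra_cat_simps\<close>)
  then show ?thesis by (intro is_equalizer_sym[OF G.CG.split_cofork_equalizer])
qed

end

text \<open>
  The counit at the cofree module, precomposed with \<open>S\<close> of the isomorphism between the two equalizers
  \<open>(G j) \<delta>\<close> and \<open>e\<close>, is \<open>\<sigma>\<^sub>1 (S \<epsilon>) S((G j) \<delta>) = \<sigma>\<^sub>1 S(j)\<close>, which is the Galois map.
\<close>

lemma (in comonad_change_equalizers) galois_iso_of_counit_iso:
  assumes alg: "is_algebra \<A> S N \<sigma>"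
    and counit_iso: "\<And>X. X \<in> Obj mixed_cat \<Longrightarrow> is_iso mixed_cat (adj_counit X)"
  shows "is_iso \<A> (galois N \<sigma>)"
proof -
  note s = is_algebra_simps(1-4)[OF alg]
  define \<sigma>1 where "\<sigma>1 = Fa H \<sigma> \<cdot> \<tau> N"
  let ?X = "(Fo H N, \<sigma>1, \<delta>' N)"
  have m: "is_mixed_module (Fo H N) \<sigma>1 (\<delta>' N)" unfolding \<sigma>1_def by (rule cofree_mixed_module[OF alg])
  then have X: "?X \<in> Obj mixed_cat" by simp
  note s1 = is_algebra_simps(1-4)[OF is_mixed_module_simps(1)[OF m]]
  obtain E c e where e: "equalizer_of ?X = ((E, c), e, (Fo G (Fo H N), \<delta> (Fo H N)))" "e \<in> Arr \<A>" "Dom \<A> e = E"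
    "Cod \<A> e = Fo G (Fo H N)" using equalizer_of_cases[OF m] .
  \<comment> \<open>\<open>left_arrow (N, \<sigma>, \<sigma>)\<close> stands for \<open>(G j) \<delta>\<close> at \<open>N\<close>; the last component is a filler.\<close>
  obtain w where w: "is_iso CC w" "Dom CC w = Dom CC (left_arrow (N, \<sigma>, \<sigma>))" "Cod CC w = Dom CC (equalizer_of ?X)"
    "equalizer_of ?X \<cdot>\<^bsub>CC\<^esub> w = left_arrow (N, \<sigma>, \<sigma>)"
    using G.CG.equalizers_isomorphic[OF equalizer_of_is_equalizer[OF X] cofree_equalizer[OF alg, of \<sigma>, folded \<sigma>1_def]] .
  have "w \<in> Arr CC" using w(1) by (simp add: is_iso_def)
  then obtain u where u: "w = ((Fo G N, \<delta> N), u, (E, c))" "u \<in> Arr \<A>" "Dom \<A> u = Fo G N" "Cod \<A> u = E"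
    using w(2,3) e(1) by (auto elim!: G.coalgebra_arr_cases)
  have iso_u: "is_iso \<A> u"
    using w(1) unfolding u(1) G.coalgebra_cat_def by (rule struct_cat_iso_underlying)
  have eu: "e \<cdot> u = Fa G (j N) \<cdot> \<delta> N"
    using w(4) unfolding e(1) u(1) by (simp add: left_arrow_def)
  let ?k = "\<sigma>1 \<cdot> Fa S (\<epsilon> (Fo H N)) \<cdot> Fa S e"
  have "is_iso mixed_cat (Fo left_adjoint (E, c), ?k, ?X)"
    using counit_iso[OF X] e(1) by (simp add: adj_counit_def underlying_def right_adjoint_def)
  then have iso_k: "is_iso \<A> ?k" unfolding mixed_cat_def by (rule struct_cat_iso_underlying)
  have "Fa S e \<cdot> Fa S u = Fa S (Fa G (j N)) \<cdot> Fa S (\<delta> N)"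
    using s e u by (simp add: S.Fa_eq[OF eu])
  moreover have "Fa S (\<epsilon> (Fo H N)) \<cdot> Fa S (Fa G (j N)) = Fa S (j N) \<cdot> Fa S (\<epsilon> (Fo G N))"
    using s by (simp add: S.Fa_eq[OF G.counit_nat])
  moreover have "Fa S (\<epsilon> (Fo G N)) \<cdot> Fa S (\<delta> N) = Ident \<A> (Fo S (Fo G N))"
    using s by (simp add: S.Fa_eq[OF G.counit_comult])
  ultimately have "?k \<cdot> Fa S u = \<sigma>1 \<cdot> Fa S (j N)"
    using s s1 e(2-) u(2-) comp_reduce[of "Fa S (\<epsilon> (Fo H N))" "Fa S (Fa G (j N))" _ "Fa S (\<delta> N)"] by simp
  also have "\<dots> = galois N \<sigma>" using s by (simp add: galois_def \<kappa>_eq \<sigma>1_def)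
  finally have "galois N \<sigma> = ?k \<cdot> Fa S u" by simp
  moreover have "is_iso \<A> (?k \<cdot> Fa S u)"
    using e u s s1 by (intro is_iso_comp S.preserves_iso iso_u iso_k) simp
  ultimately show ?thesis by simp
qed

text \<open>
  By \<open>counit_galois\<close> the counit is, up to the Galois map, the comparison between two equalizers of the
  same pair: \<open>S e\<close>, because \<open>S\<close> preserves the equalizer \<open>e\<close>, and the coaction \<open>\<zeta>\<close>.
\<close>

lemma (in comonad_change_equalizers) counit_iso_of_galois_iso:
  assumes iso: "\<And>N \<sigma>. is_algebra \<A> S N \<sigma> \<Longrightarrow> is_iso \<A> (galois N \<sigma>)"
    and m: "is_mixed_module N \<sigma> \<zeta>"
    and Se: "is_equalizer \<A> (Fa S (Fa G (j N) \<cdot> \<delta> N)) (Fa S (Fa G \<zeta>)) (Fa S (underlying (equalizer_of (N, \<sigma>, \<zeta>))))"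
  shows "is_iso mixed_cat (adj_counit (N, \<sigma>, \<zeta>))"
proof -
  note a = is_mixed_module_simps[OF m]
  note s = is_algebra_simps[OF a(1)] and z = H.is_coalgebra_simps[OF a(2)]
  note alg1 = lifted_algebra[OF a(1)]
  obtain E c e where e: "equalizer_of (N, \<sigma>, \<zeta>) = ((E, c), e, (Fo G N, \<delta> N))" "G.is_coalgebra E c" "e \<in> Arr \<A>"
    "Dom \<A> e = E" "Cod \<A> e = Fo G N" "\<delta> N \<cdot> e = Fa G e \<cdot> c" "(Fa G (j N) \<cdot> \<delta> N) \<cdot> e = Fa G \<zeta> \<cdot> e"
    using equalizer_of_cases[OF m] .
  have Se': "is_equalizer \<A> (Fa S (Fa G (j N) \<cdot> \<delta> N)) (Fa S (Fa G \<zeta>)) (Fa S e)"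
    using Se by (simp add: e(1) underlying_def del: S.Fa_on_Comp)
  have E: "E \<in> Obj \<A>" using G.is_coalgebra_simps(1)[OF e(2)] .
  define k where "k = \<sigma> \<cdot> Fa S (\<epsilon> N) \<cdot> Fa S e"
  have k: "k \<in> Arr \<A>" "Dom \<A> k = Fo S E" "Cod \<A> k = N" using s(1-4) e(3-5) by (simp_all add: k_def)
  have zk: "\<zeta> \<cdot> k = galois N \<sigma> \<cdot> Fa S e" unfolding k_def by (rule counit_galois[OF m e(3,5,7)])
  define \<gamma> where "\<gamma> = galois N \<sigma>"
  have \<gamma>: "\<gamma> \<in> Arr \<A>" "Dom \<A> \<gamma> = Fo S (Fo G N)" "Cod \<A> \<gamma> = Fo H N" using a(1) by (simp_all add: \<gamma>_def)
  obtain \<beta> where \<beta>: "\<beta> \<in> Arr \<A>" "Dom \<A> \<beta> = Fo H N" "Cod \<A> \<beta> = Fo S (Fo G N)"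
    "\<beta> \<cdot> \<gamma> = Ident \<A> (Fo S (Fo G N))" "\<gamma> \<cdot> \<beta> = Ident \<A> (Fo H N)"
    using is_isoE[OF iso[OF a(1)]] \<gamma> unfolding \<gamma>_def[symmetric] by metis
  let ?h = "\<beta> \<cdot> \<zeta>"
  have h: "?h \<in> Arr \<A>" "Dom \<A> ?h = N" "Cod \<A> ?h = Fo S (Fo G N)" using \<beta>(1-3) z(1-4) by simp_all
  have gh: "\<gamma> \<cdot> ?h = \<zeta>" using \<gamma> \<beta>(1-3) z(1-4) by (simp add: \<beta>(5)[THEN comp_reduce])
  let ?\<gamma>1 = "galois (Fo H N) (Fa H \<sigma> \<cdot> \<tau> N)"
  have "?\<gamma>1 \<cdot> (Fa S (Fa G (j N) \<cdot> \<delta> N) \<cdot> ?h) = \<delta>' N \<cdot> (\<gamma> \<cdot> ?h)"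
    using galois_left[OF a(1), THEN comp_reduce, of ?h] h \<gamma> s(1) alg1
    by (simp add: \<gamma>_def del: S.Fa_on_Comp)
  also have "\<dots> = Fa H \<zeta> \<cdot> (\<gamma> \<cdot> ?h)" unfolding gh by (rule z(5))
  also have "\<dots> = ?\<gamma>1 \<cdot> (Fa S (Fa G \<zeta>) \<cdot> ?h)"
    using galois_right[OF m, THEN comp_reduce, of ?h] h \<gamma> s(1) z(1-4) alg1 by (simp add: \<gamma>_def)
  finally have eq: "Fa S (Fa G (j N) \<cdot> \<delta> N) \<cdot> ?h = Fa S (Fa G \<zeta>) \<cdot> ?h"
    using h s(1) z(1-4) alg1 by - (rule iso_cancel_left[OF iso[OF alg1]], simp_all)
  \<comment> \<open>The factorization of \<open>\<gamma>\<^sup>-\<^sup>1 \<zeta>\<close> through \<open>S e\<close> is inverse to \<open>k\<close>.\<close>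
  obtain v where v: "v \<in> Arr \<A>" "Dom \<A> v = N" "Cod \<A> v = Fo S E" "Fa S e \<cdot> v = ?h"
    using equalizer_factor[OF Se' h(1) _ eq] h s(1) e(3-5) by auto
  have kv: "k \<cdot> v = Ident \<A> N"
  proof -
    have "\<zeta> \<cdot> (k \<cdot> v) = \<gamma> \<cdot> (Fa S e \<cdot> v)"
      using zk[folded \<gamma>_def, THEN comp_reduce, of v] k v(1-3) z(1-4) \<gamma> e(3-5) by simp
    also have "\<dots> = \<zeta>" unfolding v(4) by (rule gh)
    finally have *: "\<zeta> \<cdot> (k \<cdot> v) = \<zeta>" .
    have "\<epsilon>' N \<cdot> (\<zeta> \<cdot> (k \<cdot> v)) = k \<cdot> v"
      using z(1-4) k v(1-3) by (simp add: z(6)[THEN comp_reduce])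
    then show ?thesis unfolding * z(6) by simp
  qed
  have vk: "v \<cdot> k = Ident \<A> (Fo S E)"
  proof (rule equalizer_mono[OF Se'])
    have "Fa S e \<cdot> (v \<cdot> k) = \<beta> \<cdot> (\<zeta> \<cdot> k)"
      using v k e(3-5) \<beta>(1-3) z(1-4) by (simp add: v(4)[THEN comp_reduce])
    also have "\<dots> = Fa S e"
      unfolding zk \<gamma>_def[symmetric] using \<gamma> \<beta>(1-3) e(3-5) by (simp add: \<beta>(4)[THEN comp_reduce])
    finally show "Fa S e \<cdot> (v \<cdot> k) = Fa S e \<cdot> Ident \<A> (Fo S E)" using e(3-5) E by simp
  qed (use v k E e(3-5) in simp_all)
  have "is_iso \<A> k" using k v kv vk by (intro is_isoI[of k "Fo S E" N v]) (simp_all add: Hom_iff)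
  moreover have "adj_counit (N, \<sigma>, \<zeta>) = ((Fo S E, Mu S E, \<kappa> E \<cdot> Fa S c), k, (N, \<sigma>, \<zeta>))"
    using e(1) by (simp add: adj_counit_def right_adjoint_def underlying_def left_adjoint_simps k_def)
  ultimately show ?thesis
    using mixed_iso counit_mixed_map[OF m e(2-7)] by (simp add: k_def)
qed

text \<open>
  By the triangle identity the left adjoint sends the unit to the inverse of a component of the counit.
\<close>

lemma (in comonad_change_equalizers) unit_iso_of_counit_iso:
  assumes counit_iso: "\<And>X. X \<in> Obj mixed_cat \<Longrightarrow> is_iso mixed_cat (adj_counit X)"
    and cons: "conservative \<A> \<A> S" and x: "x \<in> Obj CC"
  shows "is_iso CC (adj_unit x)"
proof -
  obtain N c where nc: "x = (N, c)" by (cases x)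
  let ?X = "Fo left_adjoint x"
  interpret L: cat_functor CC mixed_cat left_adjoint by (rule left_adjoint_functor)
  have X: "?X \<in> Obj mixed_cat" using x by (rule L.Fo_in_Obj)
  note u = adj_unit_arrow(1)[OF x]
  have uA: "adj_unit x \<in> Arr CC" using u by (simp add: Hom_iff)
  have k: "adj_counit ?X \<in> Arr mixed_cat" "Dom mixed_cat (adj_counit ?X) = Fo left_adjoint (Fo right_adjoint ?X)"
    "Cod mixed_cat (adj_counit ?X) = ?X"
    using adj_counit_arrow[OF X] by (simp_all add: Hom_iff)
  obtain g where g: "g \<in> Arr mixed_cat" "Dom mixed_cat g = ?X"
    "Cod mixed_cat g = Fo left_adjoint (Fo right_adjoint ?X)"
    "g \<cdot>\<^bsub>mixed_cat\<^esub> adj_counit ?X = Ident mixed_cat (Fo left_adjoint (Fo right_adjoint ?X))"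
    "adj_counit ?X \<cdot>\<^bsub>mixed_cat\<^esub> g = Ident mixed_cat ?X"
    using MM.is_isoE[OF counit_iso[OF X]] k by metis
  have Lu: "Fa left_adjoint (adj_unit x) \<in> Hom mixed_cat ?X (Fo left_adjoint (Fo right_adjoint ?X))"
    using L.Fa_Hom[OF u] .
  have "Fa left_adjoint (adj_unit x) = g \<cdot>\<^bsub>mixed_cat\<^esub> (adj_counit ?X \<cdot>\<^bsub>mixed_cat\<^esub> Fa left_adjoint (adj_unit x))"
    using g k Lu MM.comp_reduce[OF g(4), of "Fa left_adjoint (adj_unit x)"]
      MM.Ident_left[of "Fa left_adjoint (adj_unit x)"]
    by (simp add: Hom_iff del: mixed_cat_simps)
  also have "\<dots> = g" using triangle_left[OF x] g MM.Ident_right[OF g(1,2)] by (simp del: mixed_cat_simps)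
  finally have "Fa left_adjoint (adj_unit x) = g" .
  moreover have "is_iso mixed_cat g" using g k by (intro MM.is_isoI[of g _ _ "adj_counit ?X"]) (simp_all add: Hom_iff)
  ultimately have iso: "is_iso mixed_cat (Fa left_adjoint (adj_unit x))" by simp
  obtain f N' c' where f: "adj_unit x = ((N, c), f, (N', c'))" "f \<in> Arr \<A>"
    using u by (auto simp: Hom_iff[of _ CC] nc elim!: G.coalgebra_arr_cases)
  have "is_iso mixed_cat (Fo left_adjoint (N, c), Fa S f, Fo left_adjoint (N', c'))"
    using iso by (simp add: f(1) left_adjoint_simps(2))
  then have "is_iso \<A> (Fa S f)" unfolding mixed_cat_def by (rule struct_cat_iso_underlying)
  then have "is_iso \<A> f" using cons f(2) by (simp add: conservative_def)
  then show ?thesis using G.coalgebra_iso uA unfolding f(1) by blast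
qed

text \<open>
  The chosen equalizer of coalgebras differs from the lift of an equalizer in \<open>\<A>\<close> by an isomorphism of
  coalgebras, so its underlying arrow is an equalizer in \<open>\<A>\<close> as well, and \<open>S\<close> preserves it.
\<close>

theorem (in comonad_change) equivalence_iff_galois:
  assumes equalizers: "\<And>f g. coreflexive_pair \<A> f g \<Longrightarrow> monad_split_pair \<A> S f g \<Longrightarrow>
      \<exists>e. is_equalizer \<A> f g e"
    and G_preserves: "\<And>f g. coreflexive_pair \<A> f g \<Longrightarrow> monad_split_pair \<A> S f g \<Longrightarrow>
      preserves_equalizers_of \<A> \<A> G f g"
    and GG_preserves: "\<And>f g. coreflexive_pair \<A> f g \<Longrightarrow> monad_split_pair \<A> S f g \<Longrightarrow>
      preserves_equalizers_of \<A> \<A> (comp_func G G) f g"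
    and S_preserves: "\<And>f g. coreflexive_pair \<A> f g \<Longrightarrow> monad_split_pair \<A> S f g \<Longrightarrow>
      preserves_equalizers_of \<A> \<A> S f g"
    and cons: "conservative \<A> \<A> S"
  shows "equalizers_exist \<and> adjoint_equivalence CC mixed_cat left_adjoint right_adjoint adj_unit adj_counit
    \<longleftrightarrow> (\<forall>N \<in> Obj \<A>. is_iso \<A> (galois (Fo S N) (Mu S N)))"
proof
  assume *: "equalizers_exist \<and> adjoint_equivalence CC mixed_cat left_adjoint right_adjoint adj_unit adj_counit"
  then interpret comonad_change_equalizers by unfold_locales simp
  have counit_iso: "is_iso mixed_cat (adj_counit X)" if "X \<in> Obj mixed_cat" for X
    using * that unfolding adjoint_equivalence_def by blast
  show "\<forall>N \<in> Obj \<A>. is_iso \<A> (galois (Fo S N) (Mu S N))"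
    using galois_iso_of_counit_iso[OF S.free_algebra_is_algebra counit_iso] by blast
next
  assume free: "\<forall>N \<in> Obj \<A>. is_iso \<A> (galois (Fo S N) (Mu S N))"
  have iso: "is_iso \<A> (galois N \<sigma>)" if "is_algebra \<A> S N \<sigma>" for N \<sigma>
    by (rule galois_iso_of_free[OF _ that]) (use free in blast)
  have pair: "coreflexive_pair \<A> (Fa G (j N) \<cdot> \<delta> N) (Fa G \<zeta>)" "monad_split_pair \<A> S (Fa G (j N) \<cdot> \<delta> N) (Fa G \<zeta>)"
    if "is_mixed_module N \<sigma> \<zeta>" for N \<sigma> \<zeta>
    using coreflexive_left_right[OF that] left_right_split[OF iso that] by simp_all
  have lift: "\<exists>e d. is_equalizer \<A> (Fa G (j N) \<cdot> \<delta> N) (Fa G \<zeta>) e \<and>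
      is_equalizer CC (left_arrow (N, \<sigma>, \<zeta>)) (right_arrow (N, \<sigma>, \<zeta>)) ((Dom \<A> e, d), e, (Fo G N, \<delta> N))"
    if m: "is_mixed_module N \<sigma> \<zeta>" for N \<sigma> \<zeta>
  proof -
    obtain e where e: "is_equalizer \<A> (Fa G (j N) \<cdot> \<delta> N) (Fa G \<zeta>) e" using equalizers[OF pair[OF m]] by blast
    have Ge: "is_equalizer \<A> (Fa G (Fa G (j N) \<cdot> \<delta> N)) (Fa G (Fa G \<zeta>)) (Fa G e)"
      using G_preserves[OF pair[OF m]] e unfolding preserves_equalizers_of_def by blast
    have GGe: "is_equalizer \<A> (Fa G (Fa G (Fa G (j N) \<cdot> \<delta> N))) (Fa G (Fa G (Fa G \<zeta>))) (Fa G (Fa G e))"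
      using GG_preserves[OF pair[OF m], unfolded preserves_equalizers_of_def, rule_format, OF e]
      by (simp add: comp_func_def)
    show ?thesis
      using G.equalizer_lifts[OF left_right_arrow[OF m, unfolded left_arrow_def right_arrow_def prod.case] e Ge GGe] e
      by (auto simp: left_arrow_def right_arrow_def)
  qed
  interpret comonad_change_equalizers
  proof unfold_locales
    show equalizers_exist
      unfolding equalizers_exist_def using lift by fastforce
  qed
  have "is_iso mixed_cat (adj_counit X)" if X: "X \<in> Obj mixed_cat" for X
  proof -
    obtain N \<sigma> \<zeta> where x: "X = (N, \<sigma>, \<zeta>)" by (cases X)
    have m: "is_mixed_module N \<sigma> \<zeta>" using X by (simp add: x)
    obtain e d where e: "is_equalizer \<A> (Fa G (j N) \<cdot> \<delta> N) (Fa G \<zeta>) e"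
      "is_equalizer CC (left_arrow X) (right_arrow X) ((Dom \<A> e, d), e, (Fo G N, \<delta> N))"
      using lift[OF m] by (auto simp: x)
    obtain w where w: "is_iso CC w" "Cod CC w = Dom CC ((Dom \<A> e, d), e, (Fo G N, \<delta> N))"
      "((Dom \<A> e, d), e, (Fo G N, \<delta> N)) \<cdot>\<^bsub>CC\<^esub> w = equalizer_of X"
      using G.CG.equalizers_isomorphic[OF e(2) equalizer_of_is_equalizer[OF X]] .
    have "w \<in> Arr CC" using w(1) by (simp add: is_iso_def)
    then obtain K k u where u: "w = ((K, k), u, (Dom \<A> e, d))" "Cod \<A> u = Dom \<A> e"
      using w(2) by (auto elim!: G.coalgebra_arr_cases)
    have "is_iso \<A> u" using w(1) unfolding u(1) G.coalgebra_cat_def by (rule struct_cat_iso_underlying)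
    then have "is_equalizer \<A> (Fa G (j N) \<cdot> \<delta> N) (Fa G \<zeta>) (e \<cdot> u)"
      using u(2) by (rule equalizer_comp_iso[OF e(1)])
    moreover have "underlying (equalizer_of X) = e \<cdot> u" using w(3)[symmetric] by (simp add: u(1) underlying_def)
    ultimately have "is_equalizer \<A> (Fa S (Fa G (j N) \<cdot> \<delta> N)) (Fa S (Fa G \<zeta>)) (Fa S (underlying (equalizer_of X)))"
      using S_preserves[OF pair[OF m]] unfolding preserves_equalizers_of_def by simp
    then show ?thesis using counit_iso_of_galois_iso[OF iso m] by (simp add: x)
  qed
  note counit_iso = this
  have "is_iso CC (adj_unit x)" if "x \<in> Obj CC" for x
    by (rule unit_iso_of_counit_iso[OF counit_iso cons that])
  then show "equalizers_exist \<and> adjoint_equivalence CC mixed_cat left_adjoint right_adjoint adj_unit adj_counit"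
    unfolding adjoint_equivalence_def
    by (intro conjI ballI exist left_adjoint_functor right_adjoint_functor adj_unit_natural
      adj_counit_natural triangle_left triangle_right counit_iso)
qed

section \<open>The comonad of a comonoid\<close>

context bifunctor
begin

lemma Ba_simps [simp]:
  assumes "f \<in> Arr \<A>" "g \<in> Arr \<B>"
  shows "Ba f g \<in> Arr \<D>" "Dom \<D> (Ba f g) = Bo (Dom \<A> f) (Dom \<B> g)"
    "Cod \<D> (Ba f g) = Bo (Cod \<A> f) (Cod \<B> g)"
  using Ba_Hom[of f "Dom \<A> f" "Cod \<A> f" g "Dom \<B> g" "Cod \<B> g"] assms by (simp_all add: Hom_iff)

lemma Bo_in_Obj [simp]: "X \<in> Obj \<A> \<Longrightarrow> Y \<in> Obj \<B> \<Longrightarrow> Bo X Y \<in> Obj \<D>"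
  by (rule Bo_Obj)

lemma Ba_on_Ident [simp]: "X \<in> Obj \<A> \<Longrightarrow> Y \<in> Obj \<B> \<Longrightarrow> Ba (Ident \<A> X) (Ident \<B> Y) = Ident \<D> (Bo X Y)"
  by (rule Ba_Ident)

lemma interchange:
  assumes "f \<in> Arr \<A>" "f' \<in> Arr \<A>" "Dom \<A> f' = Cod \<A> f" "g \<in> Arr \<B>" "g' \<in> Arr \<B>" "Dom \<B> g' = Cod \<B> g"
  shows "Ba f' g' \<cdot>\<^bsub>\<D>\<^esub> Ba f g = Ba (f' \<cdot>\<^bsub>\<A>\<^esub> f) (g' \<cdot>\<^bsub>\<B>\<^esub> g)"
  using Ba_Comp[of f "Dom \<A> f" "Cod \<A> f" f' "Cod \<A> f'" g "Dom \<B> g" "Cod \<B> g" g' "Cod \<B> g'"] assms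
  by (simp add: Hom_iff)

lemmas interchanges = interchange interchange[THEN D.comp_reduce]

end

context monoidal_category
begin

lemma Unit_in_Obj [simp]: "Unit \<C> \<in> Obj \<C>"
  by (rule Unit_Obj)

lemma Assoc_simps [simp]:
  assumes "X \<in> Obj \<C>" "Y \<in> Obj \<C>" "Z \<in> Obj \<C>"
  shows "Assoc \<C> X Y Z \<in> Arr \<C>" "Dom \<C> (Assoc \<C> X Y Z) = (X \<otimes> Y) \<otimes> Z"
    "Cod \<C> (Assoc \<C> X Y Z) = X \<otimes> (Y \<otimes> Z)"
  using Assoc_Hom[OF assms] by (simp_all add: Hom_iff)

lemma LUnit_simps [simp]:
  assumes "X \<in> Obj \<C>"
  shows "LUnit \<C> X \<in> Arr \<C>" "Dom \<C> (LUnit \<C> X) = Unit \<C> \<otimes> X" "Cod \<C> (LUnit \<C> X) = X"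
  using LUnit_Hom[OF assms] by (simp_all add: Hom_iff)

lemma RUnit_simps [simp]:
  assumes "X \<in> Obj \<C>"
  shows "RUnit \<C> X \<in> Arr \<C>" "Dom \<C> (RUnit \<C> X) = X \<otimes> Unit \<C>" "Cod \<C> (RUnit \<C> X) = X"
  using RUnit_Hom[OF assms] by (simp_all add: Hom_iff)

end

context is_comonoid
begin

lemma comonoid_simps [simp]:
  "Carr C \<in> Obj \<C>"
  "Comult C \<in> Arr \<C>" "Dom \<C> (Comult C) = Carr C" "Cod \<C> (Comult C) = Carr C \<otimes> Carr C"
  "Counit C \<in> Arr \<C>" "Dom \<C> (Counit C) = Carr C" "Cod \<C> (Counit C) = Unit \<C>"
  using Carr_Obj Comult_Hom Counit_Hom by (simp_all add: Hom_iff)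

end

context module_category
begin

lemma MAssoc_simps [simp]:
  assumes "X \<in> Obj \<C>" "Y \<in> Obj \<C>" "N \<in> Obj \<M>"
  shows "MAssoc \<M> X Y N \<in> Arr \<M>" "Dom \<M> (MAssoc \<M> X Y N) = (X \<otimes>\<^bsub>\<C>\<^esub> Y) \<odot>\<^bsub>\<M>\<^esub> N"
    "Cod \<M> (MAssoc \<M> X Y N) = X \<odot>\<^bsub>\<M>\<^esub> (Y \<odot>\<^bsub>\<M>\<^esub> N)"
  using MAssoc_Hom[OF assms] by (simp_all add: Hom_iff)

lemma MUnit_simps [simp]:
  assumes "N \<in> Obj \<M>"
  shows "MUnit \<M> N \<in> Arr \<M>" "Dom \<M> (MUnit \<M> N) = Unit \<C> \<odot>\<^bsub>\<M>\<^esub> N" "Cod \<M> (MUnit \<M> N) = N"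
  using MUnit_Hom[OF assms] by (simp_all add: Hom_iff)

lemma MAssoc_nat:
  assumes "f \<in> Arr \<C>" "g \<in> Arr \<C>" "h \<in> Arr \<M>" "Cod \<C> f = X" "Cod \<C> g = Y" "Cod \<M> h = N"
  shows "MAssoc \<M> X Y N \<cdot>\<^bsub>\<M>\<^esub> ((f \<boxtimes>\<^bsub>\<C>\<^esub> g) \<boxdot>\<^bsub>\<M>\<^esub> h) =
    (f \<boxdot>\<^bsub>\<M>\<^esub> (g \<boxdot>\<^bsub>\<M>\<^esub> h)) \<cdot>\<^bsub>\<M>\<^esub> MAssoc \<M> (Dom \<C> f) (Dom \<C> g) (Dom \<M> h)"
  using MAssoc_natural[of f "Dom \<C> f" X g "Dom \<C> g" Y h "Dom \<M> h" N] assms by (simp add: Hom_iff)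

lemma MUnit_nat:
  assumes "h \<in> Arr \<M>" "Cod \<M> h = N"
  shows "MUnit \<M> N \<cdot>\<^bsub>\<M>\<^esub> (Ident \<C> (Unit \<C>) \<boxdot>\<^bsub>\<M>\<^esub> h) = h \<cdot>\<^bsub>\<M>\<^esub> MUnit \<M> (Dom \<M> h)"
  using MUnit_natural[of h "Dom \<M> h" N] assms by (simp add: Hom_iff)

lemma unit_action_faithful:
  assumes "f \<in> Arr \<M>" "g \<in> Arr \<M>" "Dom \<M> f = Dom \<M> g" "Cod \<M> f = Cod \<M> g"
    and eq: "Ident \<C> (Unit \<C>) \<boxdot>\<^bsub>\<M>\<^esub> f = Ident \<C> (Unit \<C>) \<boxdot>\<^bsub>\<M>\<^esub> g"
  shows "f = g"
proof (rule M.iso_cancel_right)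
  show "is_iso \<M> (MUnit \<M> (Dom \<M> f))" using assms(1) by (simp add: MUnit_iso)
  show "f \<cdot>\<^bsub>\<M>\<^esub> MUnit \<M> (Dom \<M> f) = g \<cdot>\<^bsub>\<M>\<^esub> MUnit \<M> (Dom \<M> f)"
    using MUnit_nat[OF assms(1), of "Cod \<M> f"] MUnit_nat[OF assms(2), of "Cod \<M> f"] assms eq by simp
qed (use assms in simp_all)

text \<open>
  The coherence law with the unit object in first position follows from the pentagon and the triangle
  with the unit in the middle, as in Kelly's argument: act by the unit object once more and cancel.
\<close>

lemma MUnit_MAssoc:
  assumes X: "X \<in> Obj \<C>" and N: "N \<in> Obj \<M>"
  shows "MUnit \<M> (X \<odot>\<^bsub>\<M>\<^esub> N) \<cdot>\<^bsub>\<M>\<^esub> MAssoc \<M> (Unit \<C>) X N = LUnit \<C> X \<boxdot>\<^bsub>\<M>\<^esub> Ident \<M> N"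
proof (rule unit_action_faithful)
  let ?I = "Unit \<C>" let ?i = "Ident \<C> (Unit \<C>)" and ?n = "Ident \<M> N"
  let ?lhs = "MUnit \<M> (X \<odot>\<^bsub>\<M>\<^esub> N) \<cdot>\<^bsub>\<M>\<^esub> MAssoc \<M> ?I X N"
  let ?b = "MAssoc \<M> ?I (?I \<otimes>\<^bsub>\<C>\<^esub> X) N \<cdot>\<^bsub>\<M>\<^esub> (Assoc \<C> ?I ?I X \<boxdot>\<^bsub>\<M>\<^esub> ?n)"
  have "is_iso \<C> (Assoc \<C> ?I ?I X)" using X by (simp add: Assoc_iso)
  then obtain A' where A': "A' \<in> Arr \<C>" "Dom \<C> A' = ?I \<otimes>\<^bsub>\<C>\<^esub> (?I \<otimes>\<^bsub>\<C>\<^esub> X)" "Cod \<C> A' = (?I \<otimes>\<^bsub>\<C>\<^esub> ?I) \<otimes>\<^bsub>\<C>\<^esub> X"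
    "A' \<cdot>\<^bsub>\<C>\<^esub> Assoc \<C> ?I ?I X = Ident \<C> ((?I \<otimes>\<^bsub>\<C>\<^esub> ?I) \<otimes>\<^bsub>\<C>\<^esub> X)"
    "Assoc \<C> ?I ?I X \<cdot>\<^bsub>\<C>\<^esub> A' = Ident \<C> (?I \<otimes>\<^bsub>\<C>\<^esub> (?I \<otimes>\<^bsub>\<C>\<^esub> X))"
    using X by (auto elim: is_isoE)
  have "is_iso \<M> (Assoc \<C> ?I ?I X \<boxdot>\<^bsub>\<M>\<^esub> ?n)"
    using X N A' by (intro M.is_isoI[of _ _ _ "A' \<boxdot>\<^bsub>\<M>\<^esub> ?n"]) (simp_all add: Hom_iff act.interchange)
  then have b: "is_iso \<M> ?b" using X N by (intro M.is_iso_comp MAssoc_iso) simp_all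
  have "(?i \<boxdot>\<^bsub>\<M>\<^esub> ?lhs) \<cdot>\<^bsub>\<M>\<^esub> ?b =
      (?i \<boxdot>\<^bsub>\<M>\<^esub> MUnit \<M> (X \<odot>\<^bsub>\<M>\<^esub> N)) \<cdot>\<^bsub>\<M>\<^esub> ((?i \<boxdot>\<^bsub>\<M>\<^esub> MAssoc \<M> ?I X N) \<cdot>\<^bsub>\<M>\<^esub> ?b)"
    using X N by (simp add: act.interchanges)
  also have "(?i \<boxdot>\<^bsub>\<M>\<^esub> MAssoc \<M> ?I X N) \<cdot>\<^bsub>\<M>\<^esub> ?b =
      MAssoc \<M> ?I ?I (X \<odot>\<^bsub>\<M>\<^esub> N) \<cdot>\<^bsub>\<M>\<^esub> MAssoc \<M> (?I \<otimes>\<^bsub>\<C>\<^esub> ?I) X N"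
    using X N by (simp add: M_pentagon)
  also have "(?i \<boxdot>\<^bsub>\<M>\<^esub> MUnit \<M> (X \<odot>\<^bsub>\<M>\<^esub> N)) \<cdot>\<^bsub>\<M>\<^esub>
        (MAssoc \<M> ?I ?I (X \<odot>\<^bsub>\<M>\<^esub> N) \<cdot>\<^bsub>\<M>\<^esub> MAssoc \<M> (?I \<otimes>\<^bsub>\<C>\<^esub> ?I) X N) =
      (RUnit \<C> ?I \<boxdot>\<^bsub>\<M>\<^esub> (Ident \<C> X \<boxdot>\<^bsub>\<M>\<^esub> ?n)) \<cdot>\<^bsub>\<M>\<^esub> MAssoc \<M> (?I \<otimes>\<^bsub>\<C>\<^esub> ?I) X N"
    using X N by (simp add: M_triangle[THEN M.comp_reduce])
  also have "\<dots> = MAssoc \<M> ?I X N \<cdot>\<^bsub>\<M>\<^esub> ((RUnit \<C> ?I \<boxtimes>\<^bsub>\<C>\<^esub> Ident \<C> X) \<boxdot>\<^bsub>\<M>\<^esub> ?n)"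
    using X N MAssoc_nat[of "RUnit \<C> ?I" "Ident \<C> X" ?n ?I X N] by simp
  also have "\<dots> = MAssoc \<M> ?I X N \<cdot>\<^bsub>\<M>\<^esub> (((?i \<boxtimes>\<^bsub>\<C>\<^esub> LUnit \<C> X) \<boxdot>\<^bsub>\<M>\<^esub> ?n) \<cdot>\<^bsub>\<M>\<^esub> (Assoc \<C> ?I ?I X \<boxdot>\<^bsub>\<M>\<^esub> ?n))"
    using X N by (simp add: act.interchange triangle)
  also have "\<dots> = (?i \<boxdot>\<^bsub>\<M>\<^esub> (LUnit \<C> X \<boxdot>\<^bsub>\<M>\<^esub> ?n)) \<cdot>\<^bsub>\<M>\<^esub> ?b"
    using X N by (simp add: MAssoc_nat[THEN M.comp_reduce])
  finally show "?i \<boxdot>\<^bsub>\<M>\<^esub> ?lhs = ?i \<boxdot>\<^bsub>\<M>\<^esub> (LUnit \<C> X \<boxdot>\<^bsub>\<M>\<^esub> ?n)"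
    using X N by - (rule M.iso_cancel_right[OF b], simp_all)
qed (use X N in simp_all)

lemma hat_simps [simp]:
  "Fo (hat \<C> \<M> C) N = Carr C \<odot>\<^bsub>\<M>\<^esub> N" "Fa (hat \<C> \<M> C) f = Ident \<C> (Carr C) \<boxdot>\<^bsub>\<M>\<^esub> f"
  by (simp_all add: hat_def)

text \<open>
  The coherence isomorphisms reduce the three comonad laws to the laws of the comonoid: coassociativity
  by the pentagon, the counit laws by \<open>MUnit_MAssoc\<close> and by the triangle.
\<close>

lemma hat_comonad:
  assumes "is_comonoid \<C> C"
  shows "cat_comonad \<M> (hat \<C> \<M> C) (hat_comult \<M> C) (hat_counit \<M> C)"
proof -
  interpret C: is_comonoid \<C> C by fact
  let ?C = "Carr C" and ?c = "Ident \<C> (Carr C)"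
  show ?thesis
  proof
    fix N assume N: "N \<in> Obj \<M>"
    let ?n = "Ident \<M> N"
    show "Fo (hat \<C> \<M> C) N \<in> Obj \<M>" "Fa (hat \<C> \<M> C) (Ident \<M> N) = Ident \<M> (Fo (hat \<C> \<M> C) N)"
      using N by simp_all
    have "hat_comult \<M> C (?C \<odot>\<^bsub>\<M>\<^esub> N) \<cdot>\<^bsub>\<M>\<^esub> hat_comult \<M> C N =
        MAssoc \<M> ?C ?C (?C \<odot>\<^bsub>\<M>\<^esub> N) \<cdot>\<^bsub>\<M>\<^esub> ((Comult C \<boxdot>\<^bsub>\<M>\<^esub> (?c \<boxdot>\<^bsub>\<M>\<^esub> ?n)) \<cdot>\<^bsub>\<M>\<^esub>
          (MAssoc \<M> ?C ?C N \<cdot>\<^bsub>\<M>\<^esub> (Comult C \<boxdot>\<^bsub>\<M>\<^esub> ?n)))"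
      using N by (simp add: hat_comult_def)
    also have "\<dots> = MAssoc \<M> ?C ?C (?C \<odot>\<^bsub>\<M>\<^esub> N) \<cdot>\<^bsub>\<M>\<^esub> (MAssoc \<M> (?C \<otimes>\<^bsub>\<C>\<^esub> ?C) ?C N \<cdot>\<^bsub>\<M>\<^esub>
        (((Comult C \<boxtimes>\<^bsub>\<C>\<^esub> ?c) \<boxdot>\<^bsub>\<M>\<^esub> ?n) \<cdot>\<^bsub>\<M>\<^esub> (Comult C \<boxdot>\<^bsub>\<M>\<^esub> ?n)))"
      using N MAssoc_nat[of "Comult C" ?c ?n, THEN M.comp_reduce, of "?C \<otimes>\<^bsub>\<C>\<^esub> ?C" ?C N "Comult C \<boxdot>\<^bsub>\<M>\<^esub> ?n"]
      by simp
    also have "\<dots> = (?c \<boxdot>\<^bsub>\<M>\<^esub> MAssoc \<M> ?C ?C N) \<cdot>\<^bsub>\<M>\<^esub> (MAssoc \<M> ?C (?C \<otimes>\<^bsub>\<C>\<^esub> ?C) N \<cdot>\<^bsub>\<M>\<^esub>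
        ((Assoc \<C> ?C ?C ?C \<cdot>\<^bsub>\<C>\<^esub> (Comult C \<boxtimes>\<^bsub>\<C>\<^esub> ?c) \<cdot>\<^bsub>\<C>\<^esub> Comult C) \<boxdot>\<^bsub>\<M>\<^esub> ?n))"
      using N by (simp add: M_pentagon[THEN M.comp_reduce] act.interchange)
    also have "\<dots> = (?c \<boxdot>\<^bsub>\<M>\<^esub> MAssoc \<M> ?C ?C N) \<cdot>\<^bsub>\<M>\<^esub> (MAssoc \<M> ?C (?C \<otimes>\<^bsub>\<C>\<^esub> ?C) N \<cdot>\<^bsub>\<M>\<^esub>
        (((?c \<boxtimes>\<^bsub>\<C>\<^esub> Comult C) \<boxdot>\<^bsub>\<M>\<^esub> ?n) \<cdot>\<^bsub>\<M>\<^esub> (Comult C \<boxdot>\<^bsub>\<M>\<^esub> ?n)))"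
      using N by (simp add: C.Comult_coassoc act.interchange)
    also have "\<dots> = (?c \<boxdot>\<^bsub>\<M>\<^esub> MAssoc \<M> ?C ?C N) \<cdot>\<^bsub>\<M>\<^esub> ((?c \<boxdot>\<^bsub>\<M>\<^esub> (Comult C \<boxdot>\<^bsub>\<M>\<^esub> ?n)) \<cdot>\<^bsub>\<M>\<^esub>
        (MAssoc \<M> ?C ?C N \<cdot>\<^bsub>\<M>\<^esub> (Comult C \<boxdot>\<^bsub>\<M>\<^esub> ?n)))"
      using N MAssoc_nat[of ?c "Comult C" ?n, THEN M.comp_reduce, of ?C "?C \<otimes>\<^bsub>\<C>\<^esub> ?C" N "Comult C \<boxdot>\<^bsub>\<M>\<^esub> ?n"]
      by simp
    also have "\<dots> = (?c \<boxdot>\<^bsub>\<M>\<^esub> hat_comult \<M> C N) \<cdot>\<^bsub>\<M>\<^esub> hat_comult \<M> C N"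
      using N by (simp add: hat_comult_def act.interchanges)
    finally show "hat_comult \<M> C (Fo (hat \<C> \<M> C) N) \<cdot>\<^bsub>\<M>\<^esub> hat_comult \<M> C N =
        Fa (hat \<C> \<M> C) (hat_comult \<M> C N) \<cdot>\<^bsub>\<M>\<^esub> hat_comult \<M> C N" by simp
    have "hat_counit \<M> C (?C \<odot>\<^bsub>\<M>\<^esub> N) \<cdot>\<^bsub>\<M>\<^esub> hat_comult \<M> C N =
        MUnit \<M> (?C \<odot>\<^bsub>\<M>\<^esub> N) \<cdot>\<^bsub>\<M>\<^esub> ((Counit C \<boxdot>\<^bsub>\<M>\<^esub> (?c \<boxdot>\<^bsub>\<M>\<^esub> ?n)) \<cdot>\<^bsub>\<M>\<^esub>
          (MAssoc \<M> ?C ?C N \<cdot>\<^bsub>\<M>\<^esub> (Comult C \<boxdot>\<^bsub>\<M>\<^esub> ?n)))"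
      using N by (simp add: hat_comult_def hat_counit_def)
    also have "\<dots> = MUnit \<M> (?C \<odot>\<^bsub>\<M>\<^esub> N) \<cdot>\<^bsub>\<M>\<^esub> (MAssoc \<M> (Unit \<C>) ?C N \<cdot>\<^bsub>\<M>\<^esub>
        (((Counit C \<boxtimes>\<^bsub>\<C>\<^esub> ?c) \<boxdot>\<^bsub>\<M>\<^esub> ?n) \<cdot>\<^bsub>\<M>\<^esub> (Comult C \<boxdot>\<^bsub>\<M>\<^esub> ?n)))"
      using N MAssoc_nat[of "Counit C" ?c ?n, THEN M.comp_reduce, of "Unit \<C>" ?C N "Comult C \<boxdot>\<^bsub>\<M>\<^esub> ?n"]
      by simp
    also have "\<dots> = (LUnit \<C> ?C \<cdot>\<^bsub>\<C>\<^esub> (Counit C \<boxtimes>\<^bsub>\<C>\<^esub> ?c) \<cdot>\<^bsub>\<C>\<^esub> Comult C) \<boxdot>\<^bsub>\<M>\<^esub> ?n"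
      using N by (simp add: MUnit_MAssoc[THEN M.comp_reduce] act.interchange)
    finally show "hat_counit \<M> C (Fo (hat \<C> \<M> C) N) \<cdot>\<^bsub>\<M>\<^esub> hat_comult \<M> C N = Ident \<M> (Fo (hat \<C> \<M> C) N)"
      using N by (simp add: C.Counit_left)
    have "(?c \<boxdot>\<^bsub>\<M>\<^esub> hat_counit \<M> C N) \<cdot>\<^bsub>\<M>\<^esub> hat_comult \<M> C N =
        (?c \<boxdot>\<^bsub>\<M>\<^esub> MUnit \<M> N) \<cdot>\<^bsub>\<M>\<^esub> ((?c \<boxdot>\<^bsub>\<M>\<^esub> (Counit C \<boxdot>\<^bsub>\<M>\<^esub> ?n)) \<cdot>\<^bsub>\<M>\<^esub>
          (MAssoc \<M> ?C ?C N \<cdot>\<^bsub>\<M>\<^esub> (Comult C \<boxdot>\<^bsub>\<M>\<^esub> ?n)))"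
      using N by (simp add: hat_comult_def hat_counit_def act.interchanges)
    also have "\<dots> = (?c \<boxdot>\<^bsub>\<M>\<^esub> MUnit \<M> N) \<cdot>\<^bsub>\<M>\<^esub> (MAssoc \<M> ?C (Unit \<C>) N \<cdot>\<^bsub>\<M>\<^esub>
        (((?c \<boxtimes>\<^bsub>\<C>\<^esub> Counit C) \<boxdot>\<^bsub>\<M>\<^esub> ?n) \<cdot>\<^bsub>\<M>\<^esub> (Comult C \<boxdot>\<^bsub>\<M>\<^esub> ?n)))"
      using N MAssoc_nat[of ?c "Counit C" ?n, THEN M.comp_reduce, of ?C "Unit \<C>" N "Comult C \<boxdot>\<^bsub>\<M>\<^esub> ?n"]
      by simp
    also have "\<dots> = (RUnit \<C> ?C \<cdot>\<^bsub>\<C>\<^esub> (?c \<boxtimes>\<^bsub>\<C>\<^esub> Counit C) \<cdot>\<^bsub>\<C>\<^esub> Comult C) \<boxdot>\<^bsub>\<M>\<^esub> ?n"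
      using N by (simp add: M_triangle[THEN M.comp_reduce] act.interchange)
    finally show "Fa (hat \<C> \<M> C) (hat_counit \<M> C N) \<cdot>\<^bsub>\<M>\<^esub> hat_comult \<M> C N = Ident \<M> (Fo (hat \<C> \<M> C) N)"
      using N by (simp add: C.Counit_right)
  next
    fix f X Y assume "f \<in> Hom \<M> X Y"
    then show "Fa (hat \<C> \<M> C) f \<in> Hom \<M> (Fo (hat \<C> \<M> C) X) (Fo (hat \<C> \<M> C) Y)"
      by (simp add: Hom_iff)
    fix g Z assume "g \<in> Hom \<M> Y Z"
    with \<open>f \<in> Hom \<M> X Y\<close> show "Fa (hat \<C> \<M> C) (g \<cdot>\<^bsub>\<M>\<^esub> f) = Fa (hat \<C> \<M> C) g \<cdot>\<^bsub>\<M>\<^esub> Fa (hat \<C> \<M> C) f"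
      by (auto simp: Hom_iff act.interchange)
  next
    show "natural_transformation \<M> \<M> (hat \<C> \<M> C) (comp_func (hat \<C> \<M> C) (hat \<C> \<M> C)) (hat_comult \<M> C)"
      unfolding natural_transformation_def
    proof (intro conjI ballI)
      fix N assume "N \<in> Obj \<M>"
      then show "hat_comult \<M> C N \<in> Hom \<M> (Fo (hat \<C> \<M> C) N) (Fo (comp_func (hat \<C> \<M> C) (hat \<C> \<M> C)) N)"
        by (simp add: hat_comult_def Hom_iff comp_func_def)
    next
      fix f assume f: "f \<in> Arr \<M>"
      have "(?c \<boxdot>\<^bsub>\<M>\<^esub> (?c \<boxdot>\<^bsub>\<M>\<^esub> f)) \<cdot>\<^bsub>\<M>\<^esub> hat_comult \<M> C (Dom \<M> f) =
          MAssoc \<M> ?C ?C (Cod \<M> f) \<cdot>\<^bsub>\<M>\<^esub> (((?c \<boxtimes>\<^bsub>\<C>\<^esub> ?c) \<boxdot>\<^bsub>\<M>\<^esub> f) \<cdot>\<^bsub>\<M>\<^esub> (Comult C \<boxdot>\<^bsub>\<M>\<^esub> Ident \<M> (Dom \<M> f)))"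
        using f MAssoc_nat[of ?c ?c f, THEN M.comp_reduce, of ?C ?C "Cod \<M> f" "Comult C \<boxdot>\<^bsub>\<M>\<^esub> Ident \<M> (Dom \<M> f)"]
        by (simp add: hat_comult_def)
      also have "\<dots> = hat_comult \<M> C (Cod \<M> f) \<cdot>\<^bsub>\<M>\<^esub> (?c \<boxdot>\<^bsub>\<M>\<^esub> f)"
        using f by (simp add: hat_comult_def act.interchange)
      finally show "Fa (comp_func (hat \<C> \<M> C) (hat \<C> \<M> C)) f \<cdot>\<^bsub>\<M>\<^esub> hat_comult \<M> C (Dom \<M> f) =
          hat_comult \<M> C (Cod \<M> f) \<cdot>\<^bsub>\<M>\<^esub> Fa (hat \<C> \<M> C) f"
        by (simp add: comp_func_def)
    qed
    show "natural_transformation \<M> \<M> (hat \<C> \<M> C) id_func (hat_counit \<M> C)"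
      unfolding natural_transformation_def
    proof (intro conjI ballI)
      fix N assume "N \<in> Obj \<M>"
      then show "hat_counit \<M> C N \<in> Hom \<M> (Fo (hat \<C> \<M> C) N) (Fo id_func N)"
        by (simp add: hat_counit_def Hom_iff id_func_def)
    next
      fix f assume f: "f \<in> Arr \<M>"
      have "f \<cdot>\<^bsub>\<M>\<^esub> hat_counit \<M> C (Dom \<M> f) =
          MUnit \<M> (Cod \<M> f) \<cdot>\<^bsub>\<M>\<^esub> ((Ident \<C> (Unit \<C>) \<boxdot>\<^bsub>\<M>\<^esub> f) \<cdot>\<^bsub>\<M>\<^esub> (Counit C \<boxdot>\<^bsub>\<M>\<^esub> Ident \<M> (Dom \<M> f)))"
        using f MUnit_nat[of f "Cod \<M> f", THEN M.comp_reduce, of "Counit C \<boxdot>\<^bsub>\<M>\<^esub> Ident \<M> (Dom \<M> f)"]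
        by (simp add: hat_counit_def)
      also have "\<dots> = hat_counit \<M> C (Cod \<M> f) \<cdot>\<^bsub>\<M>\<^esub> (?c \<boxdot>\<^bsub>\<M>\<^esub> f)"
        using f by (simp add: hat_counit_def act.interchange)
      finally show "Fa id_func f \<cdot>\<^bsub>\<M>\<^esub> hat_counit \<M> C (Dom \<M> f) = hat_counit \<M> C (Cod \<M> f) \<cdot>\<^bsub>\<M>\<^esub> Fa (hat \<C> \<M> C) f"
        by (simp add: id_func_def)
    qed
  qed
qed

end

section \<open>The distributive law of a comodule-monad\<close>

context is_bimonad
begin

lemma Psi_simps [simp]:
  assumes "X \<in> Obj \<C>" "Y \<in> Obj \<C>"
  shows "Psi T X Y \<in> Arr \<C>" "Dom \<C> (Psi T X Y) = Fo T (X \<otimes> Y)" "Cod \<C> (Psi T X Y) = Fo T X \<otimes> Fo T Y"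
  using Psi_Hom[OF assms] by (simp_all add: Hom_iff)

lemma Psi0_simps [simp]:
  "Psi0 T \<in> Arr \<C>" "Dom \<C> (Psi0 T) = Fo T (Unit \<C>)" "Cod \<C> (Psi0 T) = Unit \<C>"
  using Psi0_Hom by (simp_all add: Hom_iff)

lemma Psi_nat:
  assumes "f \<in> Arr \<C>" "g \<in> Arr \<C>" "Cod \<C> f = X" "Cod \<C> g = Y"
  shows "Psi T X Y \<cdot> Fa T (f \<boxtimes> g) = (Fa T f \<boxtimes> Fa T g) \<cdot> Psi T (Dom \<C> f) (Dom \<C> g)"
  using Psi_natural[of f "Dom \<C> f" X g "Dom \<C> g" Y] assms by (simp add: Hom_iff)

end

locale bimonad_comonoid = is_bimonad + is_comonoid
begin

lemma free_comonoid_simps [simp]: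
  "Carr (free_comonoid \<C> T C) = Fo T (Carr C)"
  "Comult (free_comonoid \<C> T C) = Psi T (Carr C) (Carr C) \<cdot> Fa T (Comult C)"
  "Counit (free_comonoid \<C> T C) = Psi0 T \<cdot> Fa T (Counit C)"
  by (simp_all add: free_comonoid_def)

lemma free_comonoid_is_comonoid: "is_comonoid \<C> (free_comonoid \<C> T C)"
proof unfold_locales
  let ?C = "Carr C" and ?D = "Comult C" and ?c = "Ident \<C> (Carr C)" and ?Z = "Fo T (Carr C)"
  let ?z = "Ident \<C> ?Z" and ?\<psi> = "Psi T (Carr C) (Carr C)"
  let ?F = "free_comonoid \<C> T C"
  show "Carr ?F \<in> Obj \<C>" "Comult ?F \<in> Hom \<C> (Carr ?F) (Carr ?F \<otimes> Carr ?F)"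
    "Counit ?F \<in> Hom \<C> (Carr ?F) (Unit \<C>)"
    by (simp_all add: Hom_iff)
  have "(Comult ?F \<boxtimes> ?z) \<cdot> Comult ?F = (?\<psi> \<boxtimes> ?z) \<cdot> ((Fa T ?D \<boxtimes> Fa T ?c) \<cdot> (?\<psi> \<cdot> Fa T ?D))"
    by (simp add: interchanges)
  also have "\<dots> = (?\<psi> \<boxtimes> ?z) \<cdot> (Psi T (?C \<otimes> ?C) ?C \<cdot> Fa T ((?D \<boxtimes> ?c) \<cdot> ?D))"
    using Psi_nat[of ?D ?c "?C \<otimes> ?C" ?C, THEN comp_reduce, of "Fa T ?D"] by simp
  finally have "Assoc \<C> ?Z ?Z ?Z \<cdot> ((Comult ?F \<boxtimes> ?z) \<cdot> Comult ?F) =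
      (Assoc \<C> ?Z ?Z ?Z \<cdot> (?\<psi> \<boxtimes> ?z) \<cdot> Psi T (?C \<otimes> ?C) ?C) \<cdot> Fa T ((?D \<boxtimes> ?c) \<cdot> ?D)"
    by simp
  also have "\<dots> = (?z \<boxtimes> ?\<psi>) \<cdot> (Psi T ?C (?C \<otimes> ?C) \<cdot> Fa T (Assoc \<C> ?C ?C ?C \<cdot> (?D \<boxtimes> ?c) \<cdot> ?D))"
    by (simp add: Psi_coassoc[symmetric])
  also have "\<dots> = (?z \<boxtimes> ?\<psi>) \<cdot> ((Fa T ?c \<boxtimes> Fa T ?D) \<cdot> (?\<psi> \<cdot> Fa T ?D))"
    unfolding Comult_coassoc
    using Psi_nat[of ?c ?D ?C "?C \<otimes> ?C", THEN comp_reduce, of "Fa T ?D"] by simp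
  also have "\<dots> = (?z \<boxtimes> Comult ?F) \<cdot> Comult ?F"
    by (simp add: interchanges)
  finally show "Assoc \<C> (Carr ?F) (Carr ?F) (Carr ?F) \<cdot> (Comult ?F \<boxtimes> Ident \<C> (Carr ?F)) \<cdot> Comult ?F =
      (Ident \<C> (Carr ?F) \<boxtimes> Comult ?F) \<cdot> Comult ?F" by simp
  have "(Counit ?F \<boxtimes> ?z) \<cdot> Comult ?F = (Psi0 T \<boxtimes> ?z) \<cdot> ((Fa T (Counit C) \<boxtimes> Fa T ?c) \<cdot> (?\<psi> \<cdot> Fa T ?D))"
    by (simp add: interchanges)
  also have "\<dots> = (Psi0 T \<boxtimes> ?z) \<cdot> (Psi T (Unit \<C>) ?C \<cdot> Fa T ((Counit C \<boxtimes> ?c) \<cdot> ?D))"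
    using Psi_nat[of "Counit C" ?c "Unit \<C>" ?C, THEN comp_reduce, of "Fa T ?D"] by simp
  finally have "LUnit \<C> ?Z \<cdot> ((Counit ?F \<boxtimes> ?z) \<cdot> Comult ?F) =
      (LUnit \<C> ?Z \<cdot> (Psi0 T \<boxtimes> ?z) \<cdot> Psi T (Unit \<C>) ?C) \<cdot> Fa T ((Counit C \<boxtimes> ?c) \<cdot> ?D)" by simp
  also have "\<dots> = Fa T (LUnit \<C> ?C \<cdot> (Counit C \<boxtimes> ?c) \<cdot> ?D)" by (simp add: Psi_counit_left)
  finally show "LUnit \<C> (Carr ?F) \<cdot> (Counit ?F \<boxtimes> Ident \<C> (Carr ?F)) \<cdot> Comult ?F = Ident \<C> (Carr ?F)"
    unfolding Counit_left by simp
  have "(?z \<boxtimes> Counit ?F) \<cdot> Comult ?F = (?z \<boxtimes> Psi0 T) \<cdot> ((Fa T ?c \<boxtimes> Fa T (Counit C)) \<cdot> (?\<psi> \<cdot> Fa T ?D))"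
    by (simp add: interchanges)
  also have "\<dots> = (?z \<boxtimes> Psi0 T) \<cdot> (Psi T ?C (Unit \<C>) \<cdot> Fa T ((?c \<boxtimes> Counit C) \<cdot> ?D))"
    using Psi_nat[of ?c "Counit C" ?C "Unit \<C>", THEN comp_reduce, of "Fa T ?D"] by simp
  finally have "RUnit \<C> ?Z \<cdot> ((?z \<boxtimes> Counit ?F) \<cdot> Comult ?F) =
      (RUnit \<C> ?Z \<cdot> (?z \<boxtimes> Psi0 T) \<cdot> Psi T ?C (Unit \<C>)) \<cdot> Fa T ((?c \<boxtimes> Counit C) \<cdot> ?D)" by simp
  also have "\<dots> = Fa T (RUnit \<C> ?C \<cdot> (?c \<boxtimes> Counit C) \<cdot> ?D)" by (simp add: Psi_counit_right)
  finally show "RUnit \<C> (Carr ?F) \<cdot> (Ident \<C> (Carr ?F) \<boxtimes> Counit ?F) \<cdot> Comult ?F = Ident \<C> (Carr ?F)"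
    unfolding Counit_right by simp
qed

text \<open>
  The next four lemmas are the parts of the bimonad axioms for \<open>\<mu>\<close> and \<open>\<iota>\<close> that make \<open>\<mu>\<^sub>C\<close> an action
  compatible with the comonoid \<open>T(C)\<close>, and \<open>\<iota>\<^sub>C : C \<rightarrow> T(C)\<close> a morphism of comonoids.
\<close>

lemma Mu_free_comult:
  "(Psi T (Carr C) (Carr C) \<cdot> Fa T (Comult C)) \<cdot> Mu T (Carr C) =
    (Mu T (Carr C) \<boxtimes> Mu T (Carr C)) \<cdot> (Psi T (Fo T (Carr C)) (Fo T (Carr C)) \<cdot>
      Fa T (Psi T (Carr C) (Carr C) \<cdot> Fa T (Comult C)))"
  using Mu_nat[of "Comult C" "Carr C \<otimes> Carr C", symmetric]
  by (simp add: Mu_Psi[THEN comp_reduce])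

lemma Mu_free_counit:
  "(Psi0 T \<cdot> Fa T (Counit C)) \<cdot> Mu T (Carr C) = Psi0 T \<cdot> Fa T (Psi0 T \<cdot> Fa T (Counit C))"
  using Mu_nat[of "Counit C" "Unit \<C>", symmetric] by (simp add: Mu_Psi0[THEN comp_reduce])

lemma Iota_free_comult:
  "(Psi T (Carr C) (Carr C) \<cdot> Fa T (Comult C)) \<cdot> Iota T (Carr C) =
    (Iota T (Carr C) \<boxtimes> Iota T (Carr C)) \<cdot> Comult C"
  using Iota_nat[of "Comult C" "Carr C \<otimes> Carr C", symmetric] by (simp add: Iota_Psi[THEN comp_reduce])

lemma Iota_free_counit:
  "(Psi0 T \<cdot> Fa T (Counit C)) \<cdot> Iota T (Carr C) = Counit C"
  using Iota_nat[of "Counit C" "Unit \<C>", symmetric] by (simp add: Iota_Psi0[THEN comp_reduce])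

end

context is_comodule_monad
begin

lemma Chi_simps [simp]:
  assumes "X \<in> Obj \<C>" "N \<in> Obj \<M>"
  shows "Chi S X N \<in> Arr \<M>" "Dom \<M> (Chi S X N) = Fo S (X \<odot>\<^bsub>\<M>\<^esub> N)"
    "Cod \<M> (Chi S X N) = Fo T X \<odot>\<^bsub>\<M>\<^esub> Fo S N"
  using Chi_Hom[OF assms] by (simp_all add: Hom_iff)

lemma Chi_nat:
  assumes "f \<in> Arr \<C>" "h \<in> Arr \<M>" "Cod \<C> f = X" "Cod \<M> h = N"
  shows "Chi S X N \<cdot>\<^bsub>\<M>\<^esub> Fa S (f \<boxdot>\<^bsub>\<M>\<^esub> h) = (Fa T f \<boxdot>\<^bsub>\<M>\<^esub> Fa S h) \<cdot>\<^bsub>\<M>\<^esub> Chi S (Dom \<C> f) (Dom \<M> h)"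
  using Chi_natural[of f "Dom \<C> f" X h "Dom \<M> h" N] assms by (simp add: Hom_iff)

end

locale hopf_module_setting = is_comodule_monad \<C> T \<M> S + bimonad_comonoid \<C> T C
  for \<C> :: "('o, 'a, 'v) moncat_scheme" and T :: "('o, 'a, 'w) bimonad_scheme"
    and \<M> :: "('o, 'a, 'p, 'b, 'x) modcat_scheme"
    and S :: "('o, 'p, 'b, 'y) comodule_monad_scheme" and C :: "('o, 'a, 'z) comonoid_scheme"
begin

text \<open>
  The mixed distributive law \<open>S(Z \<cdot> N) \<rightarrow> Z \<cdot> S(N)\<close> that the comodule-monad and the \<open>T\<close>-algebra \<open>Z\<close> induce.
\<close>

definition hopf_law where
  "hopf_law N = (Mu T (Carr C) \<boxdot>\<^bsub>\<M>\<^esub> Ident \<M> (Fo S N)) \<cdot>\<^bsub>\<M>\<^esub> Chi S (Fo T (Carr C)) N"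

abbreviation Z where "Z \<equiv> free_comonoid \<C> T C"

text \<open>
  The multiplication of \<open>S\<close> passes through \<open>\<chi>\<close> by \<open>Mu_Chi\<close>; the two factors of \<open>\<mu>\<close> that arise on \<open>Z\<close> are
  matched by the associativity of the action \<open>\<mu>\<^sub>C\<close>.
\<close>

lemma hopf_law_Mu:
  assumes N: "N \<in> Obj \<M>"
  shows "hopf_law N \<cdot>\<^bsub>\<M>\<^esub> Mu S (Fo T (Carr C) \<odot>\<^bsub>\<M>\<^esub> N) =
    (Ident \<C> (Fo T (Carr C)) \<boxdot>\<^bsub>\<M>\<^esub> Mu S N) \<cdot>\<^bsub>\<M>\<^esub> hopf_law (Fo S N) \<cdot>\<^bsub>\<M>\<^esub> Fa S (hopf_law N)"
proof -
  let ?Z = "Fo T (Carr C)" and ?m = "Mu T (Carr C)"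
  have "hopf_law N \<cdot>\<^bsub>\<M>\<^esub> Mu S (?Z \<odot>\<^bsub>\<M>\<^esub> N) =
      ((?m \<cdot>\<^bsub>\<C>\<^esub> Mu T ?Z) \<boxdot>\<^bsub>\<M>\<^esub> Mu S N) \<cdot>\<^bsub>\<M>\<^esub> (Chi S (Fo T ?Z) (Fo S N) \<cdot>\<^bsub>\<M>\<^esub> Fa S (Chi S ?Z N))"
    using N by (simp add: hopf_law_def Mu_Chi act.interchanges)
  also have "\<dots> = (?m \<boxdot>\<^bsub>\<M>\<^esub> Mu S N) \<cdot>\<^bsub>\<M>\<^esub> ((Fa T ?m \<boxdot>\<^bsub>\<M>\<^esub> Fa S (Ident \<M> (Fo S N))) \<cdot>\<^bsub>\<M>\<^esub>
      (Chi S (Fo T ?Z) (Fo S N) \<cdot>\<^bsub>\<M>\<^esub> Fa S (Chi S ?Z N)))"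
    using N by (simp add: Mu_assoc act.interchanges)
  also have "\<dots> = (?m \<boxdot>\<^bsub>\<M>\<^esub> Mu S N) \<cdot>\<^bsub>\<M>\<^esub> (Chi S ?Z (Fo S N) \<cdot>\<^bsub>\<M>\<^esub> Fa S (hopf_law N))"
    using N Chi_nat[of ?m "Ident \<M> (Fo S N)" ?Z "Fo S N", THEN M.comp_reduce, of "Fa S (Chi S ?Z N)"]
    by (simp add: hopf_law_def)
  also have "\<dots> = (Ident \<C> ?Z \<boxdot>\<^bsub>\<M>\<^esub> Mu S N) \<cdot>\<^bsub>\<M>\<^esub> hopf_law (Fo S N) \<cdot>\<^bsub>\<M>\<^esub> Fa S (hopf_law N)"
    using N by (simp add: hopf_law_def act.interchanges)
  finally show ?thesis .
qed

text \<open>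
  The two successive \<open>\<chi>\<close> on the right merge into \<open>\<psi>\<close> and a single \<open>\<chi>\<close> by \<open>Chi_coassoc\<close>, after which the
  claim is that \<open>\<mu>\<^sub>C\<close> is compatible with the comultiplication of \<open>Z\<close>.
\<close>

lemma hopf_law_comult:
  assumes N: "N \<in> Obj \<M>"
  shows "hat_comult \<M> Z (Fo S N) \<cdot>\<^bsub>\<M>\<^esub> hopf_law N =
    (Ident \<C> (Fo T (Carr C)) \<boxdot>\<^bsub>\<M>\<^esub> hopf_law N) \<cdot>\<^bsub>\<M>\<^esub> hopf_law (Fo T (Carr C) \<odot>\<^bsub>\<M>\<^esub> N) \<cdot>\<^bsub>\<M>\<^esub>
      Fa S (hat_comult \<M> Z N)"
proof -
  let ?Z = "Fo T (Carr C)" and ?m = "Mu T (Carr C)"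
  let ?z = "Ident \<C> ?Z" and ?n = "Ident \<M> N" and ?s = "Ident \<M> (Fo S N)"
  let ?\<Delta> = "Comult Z" and ?a = "MAssoc \<M> ?Z ?Z N"
  interpret Z: is_comonoid \<C> Z by (rule free_comonoid_is_comonoid)
  note \<Delta> = Z.comonoid_simps(2-4)[unfolded free_comonoid_simps(1)]
  note [simp del] = free_comonoid_simps(2,3)
  have "(?z \<boxdot>\<^bsub>\<M>\<^esub> hopf_law N) \<cdot>\<^bsub>\<M>\<^esub> hopf_law (?Z \<odot>\<^bsub>\<M>\<^esub> N) \<cdot>\<^bsub>\<M>\<^esub> Fa S (hat_comult \<M> Z N) =
      (?m \<boxdot>\<^bsub>\<M>\<^esub> (?m \<boxdot>\<^bsub>\<M>\<^esub> ?s)) \<cdot>\<^bsub>\<M>\<^esub> ((Ident \<C> (Fo T ?Z) \<boxdot>\<^bsub>\<M>\<^esub> Chi S ?Z N) \<cdot>\<^bsub>\<M>\<^esub>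
        (Chi S ?Z (?Z \<odot>\<^bsub>\<M>\<^esub> N) \<cdot>\<^bsub>\<M>\<^esub> (Fa S ?a \<cdot>\<^bsub>\<M>\<^esub> Fa S (?\<Delta> \<boxdot>\<^bsub>\<M>\<^esub> ?n))))"
    using N \<Delta> by (simp add: hopf_law_def hat_comult_def act.interchanges)
  also have "\<dots> = (?m \<boxdot>\<^bsub>\<M>\<^esub> (?m \<boxdot>\<^bsub>\<M>\<^esub> ?s)) \<cdot>\<^bsub>\<M>\<^esub> (((Ident \<C> (Fo T ?Z) \<boxdot>\<^bsub>\<M>\<^esub> Chi S ?Z N) \<cdot>\<^bsub>\<M>\<^esub>
        Chi S ?Z (?Z \<odot>\<^bsub>\<M>\<^esub> N) \<cdot>\<^bsub>\<M>\<^esub> Fa S ?a) \<cdot>\<^bsub>\<M>\<^esub> Fa S (?\<Delta> \<boxdot>\<^bsub>\<M>\<^esub> ?n))"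
    using N \<Delta> by simp
  also have "\<dots> = (?m \<boxdot>\<^bsub>\<M>\<^esub> (?m \<boxdot>\<^bsub>\<M>\<^esub> ?s)) \<cdot>\<^bsub>\<M>\<^esub> (MAssoc \<M> (Fo T ?Z) (Fo T ?Z) (Fo S N) \<cdot>\<^bsub>\<M>\<^esub>
        ((Psi T ?Z ?Z \<boxdot>\<^bsub>\<M>\<^esub> ?s) \<cdot>\<^bsub>\<M>\<^esub> (Chi S (?Z \<otimes>\<^bsub>\<C>\<^esub> ?Z) N \<cdot>\<^bsub>\<M>\<^esub> Fa S (?\<Delta> \<boxdot>\<^bsub>\<M>\<^esub> ?n))))"
    unfolding Chi_coassoc[OF Fo_in_Obj[OF Carr_Obj] Fo_in_Obj[OF Carr_Obj] N] using N \<Delta> by simp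
  also have "\<dots> = MAssoc \<M> ?Z ?Z (Fo S N) \<cdot>\<^bsub>\<M>\<^esub>
      ((((?m \<boxtimes>\<^bsub>\<C>\<^esub> ?m) \<cdot>\<^bsub>\<C>\<^esub> (Psi T ?Z ?Z \<cdot>\<^bsub>\<C>\<^esub> Fa T ?\<Delta>)) \<boxdot>\<^bsub>\<M>\<^esub> ?s) \<cdot>\<^bsub>\<M>\<^esub> Chi S ?Z N)"
    using N \<Delta> MAssoc_nat[of ?m ?m ?s ?Z ?Z "Fo S N", THEN M.comp_reduce, symmetric]
      Chi_nat[of ?\<Delta> ?n "?Z \<otimes>\<^bsub>\<C>\<^esub> ?Z" N] by (simp add: act.interchanges)
  also have "(?m \<boxtimes>\<^bsub>\<C>\<^esub> ?m) \<cdot>\<^bsub>\<C>\<^esub> (Psi T ?Z ?Z \<cdot>\<^bsub>\<C>\<^esub> Fa T ?\<Delta>) = ?\<Delta> \<cdot>\<^bsub>\<C>\<^esub> ?m"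
    using Mu_free_comult by (simp only: free_comonoid_simps(2))
  also have "MAssoc \<M> ?Z ?Z (Fo S N) \<cdot>\<^bsub>\<M>\<^esub> (((?\<Delta> \<cdot>\<^bsub>\<C>\<^esub> ?m) \<boxdot>\<^bsub>\<M>\<^esub> ?s) \<cdot>\<^bsub>\<M>\<^esub> Chi S ?Z N) =
      hat_comult \<M> Z (Fo S N) \<cdot>\<^bsub>\<M>\<^esub> hopf_law N"
    using N \<Delta> by (simp add: hopf_law_def hat_comult_def act.interchanges)
  finally show ?thesis by simp
qed

lemma hopf_law_counit:
  assumes N: "N \<in> Obj \<M>"
  shows "hat_counit \<M> Z (Fo S N) \<cdot>\<^bsub>\<M>\<^esub> hopf_law N = Fa S (hat_counit \<M> Z N)"
proof -
  let ?Z = "Fo T (Carr C)" and ?m = "Mu T (Carr C)"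
  let ?n = "Ident \<M> N" and ?s = "Ident \<M> (Fo S N)" and ?\<epsilon> = "Counit Z"
  interpret Z: is_comonoid \<C> Z by (rule free_comonoid_is_comonoid)
  note \<epsilon> = Z.comonoid_simps(5-7)[unfolded free_comonoid_simps(1)]
  note [simp del] = free_comonoid_simps(2,3)
  have "Fa S (hat_counit \<M> Z N) = (MUnit \<M> (Fo S N) \<cdot>\<^bsub>\<M>\<^esub> (Psi0 T \<boxdot>\<^bsub>\<M>\<^esub> ?s) \<cdot>\<^bsub>\<M>\<^esub> Chi S (Unit \<C>) N) \<cdot>\<^bsub>\<M>\<^esub>
      Fa S (?\<epsilon> \<boxdot>\<^bsub>\<M>\<^esub> ?n)"
    unfolding Chi_counit[OF N] using N \<epsilon> by (simp add: hat_counit_def)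
  also have "\<dots> = MUnit \<M> (Fo S N) \<cdot>\<^bsub>\<M>\<^esub> (((Psi0 T \<cdot>\<^bsub>\<C>\<^esub> Fa T ?\<epsilon>) \<boxdot>\<^bsub>\<M>\<^esub> ?s) \<cdot>\<^bsub>\<M>\<^esub> Chi S ?Z N)"
    using N \<epsilon> Chi_nat[of ?\<epsilon> ?n "Unit \<C>" N] by (simp add: act.interchanges)
  also have "Psi0 T \<cdot>\<^bsub>\<C>\<^esub> Fa T ?\<epsilon> = ?\<epsilon> \<cdot>\<^bsub>\<C>\<^esub> ?m"
    using Mu_free_counit by (simp only: free_comonoid_simps(3))
  also have "MUnit \<M> (Fo S N) \<cdot>\<^bsub>\<M>\<^esub> (((?\<epsilon> \<cdot>\<^bsub>\<C>\<^esub> ?m) \<boxdot>\<^bsub>\<M>\<^esub> ?s) \<cdot>\<^bsub>\<M>\<^esub> Chi S ?Z N) =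
      hat_counit \<M> Z (Fo S N) \<cdot>\<^bsub>\<M>\<^esub> hopf_law N"
    using N \<epsilon> by (simp add: hopf_law_def hat_counit_def act.interchanges)
  finally show ?thesis by simp
qed

lemma hopf_mixed_distributive_law:
  "mixed_distributive_law \<M> S (hat \<C> \<M> Z) (hat_comult \<M> Z) (hat_counit \<M> Z) hopf_law"
proof -
  interpret H: cat_comonad \<M> "hat \<C> \<M> Z" "hat_comult \<M> Z" "hat_counit \<M> Z"
    by (rule hat_comonad[OF free_comonoid_is_comonoid])
  show ?thesis
  proof
    show "natural_transformation \<M> \<M> (comp_func S (hat \<C> \<M> Z)) (comp_func (hat \<C> \<M> Z) S) hopf_law"
      unfolding natural_transformation_def
    proof (intro conjI ballI)
      fix N assume "N \<in> Obj \<M>"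
      then show "hopf_law N \<in> Hom \<M> (Fo (comp_func S (hat \<C> \<M> Z)) N) (Fo (comp_func (hat \<C> \<M> Z) S) N)"
        by (simp add: hopf_law_def Hom_iff comp_func_def)
    next
      fix f assume f: "f \<in> Arr \<M>"
      then show "Fa (comp_func (hat \<C> \<M> Z) S) f \<cdot>\<^bsub>\<M>\<^esub> hopf_law (Dom \<M> f) =
          hopf_law (Cod \<M> f) \<cdot>\<^bsub>\<M>\<^esub> Fa (comp_func S (hat \<C> \<M> Z)) f"
        by (simp add: hopf_law_def comp_func_def Chi_nat act.interchanges)
    qed
    fix N assume N: "N \<in> Obj \<M>"
    show "hopf_law N \<cdot>\<^bsub>\<M>\<^esub> Mu S (Fo (hat \<C> \<M> Z) N) =
        Fa (hat \<C> \<M> Z) (Mu S N) \<cdot>\<^bsub>\<M>\<^esub> hopf_law (Fo S N) \<cdot>\<^bsub>\<M>\<^esub> Fa S (hopf_law N)"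
      using hopf_law_Mu[OF N] by simp
    show "hopf_law N \<cdot>\<^bsub>\<M>\<^esub> Iota S (Fo (hat \<C> \<M> Z) N) = Fa (hat \<C> \<M> Z) (Iota S N)"
      using N by (simp add: hopf_law_def Iota_Chi act.interchange Mu_Iota_left)
    show "hat_comult \<M> Z (Fo S N) \<cdot>\<^bsub>\<M>\<^esub> hopf_law N =
        Fa (hat \<C> \<M> Z) (hopf_law N) \<cdot>\<^bsub>\<M>\<^esub> hopf_law (Fo (hat \<C> \<M> Z) N) \<cdot>\<^bsub>\<M>\<^esub> Fa S (hat_comult \<M> Z N)"
      using hopf_law_comult[OF N] by simp
    show "hat_counit \<M> Z (Fo S N) \<cdot>\<^bsub>\<M>\<^esub> hopf_law N = Fa S (hat_counit \<M> Z N)"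
      by (rule hopf_law_counit[OF N])
  qed
qed

definition unit_change where
  "unit_change N = Iota T (Carr C) \<boxdot>\<^bsub>\<M>\<^esub> Ident \<M> N"

text \<open>
  The last axiom, \<open>\<chi>\<^bsub>C,N\<^esub> = \<tau> S(j)\<close>, is the naturality of \<open>\<chi>\<close> in \<open>\<iota>\<^sub>C\<close> followed by \<open>\<mu>\<^sub>C T(\<iota>\<^sub>C) = id\<close>.
\<close>

lemma hopf_comonad_change:
  "comonad_change \<M> S (hat \<C> \<M> Z) (hat_comult \<M> Z) (hat_counit \<M> Z) hopf_law
    (hat \<C> \<M> C) (hat_comult \<M> C) (hat_counit \<M> C) unit_change (Chi S (Carr C))"
proof -
  interpret mixed_distributive_law \<M> S "hat \<C> \<M> Z" "hat_comult \<M> Z" "hat_counit \<M> Z" hopf_law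
    by (rule hopf_mixed_distributive_law)
  interpret G: cat_comonad \<M> "hat \<C> \<M> C" "hat_comult \<M> C" "hat_counit \<M> C"
    by (rule hat_comonad[OF is_comonoid_axioms])
  let ?C = "Carr C" and ?Z = "Fo T (Carr C)" and ?i = "Iota T (Carr C)"
  show ?thesis
  proof
    show "natural_transformation \<M> \<M> (hat \<C> \<M> C) (hat \<C> \<M> Z) unit_change"
      by (auto simp: natural_transformation_def unit_change_def Hom_iff act.interchange)
    fix N assume N: "N \<in> Obj \<M>"
    let ?n = "Ident \<M> N"
    have "hat_comult \<M> Z N \<cdot>\<^bsub>\<M>\<^esub> unit_change N =
        MAssoc \<M> ?Z ?Z N \<cdot>\<^bsub>\<M>\<^esub> (((?i \<boxtimes>\<^bsub>\<C>\<^esub> ?i) \<boxdot>\<^bsub>\<M>\<^esub> ?n) \<cdot>\<^bsub>\<M>\<^esub> (Comult C \<boxdot>\<^bsub>\<M>\<^esub> ?n))"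
      using N Iota_free_comult by (simp add: hat_comult_def unit_change_def act.interchanges)
    also have "\<dots> = (?i \<boxdot>\<^bsub>\<M>\<^esub> (?i \<boxdot>\<^bsub>\<M>\<^esub> ?n)) \<cdot>\<^bsub>\<M>\<^esub> (MAssoc \<M> ?C ?C N \<cdot>\<^bsub>\<M>\<^esub> (Comult C \<boxdot>\<^bsub>\<M>\<^esub> ?n))"
      using N MAssoc_nat[of ?i ?i ?n, THEN M.comp_reduce, of ?Z ?Z N "Comult C \<boxdot>\<^bsub>\<M>\<^esub> ?n"] by simp
    also have "\<dots> = (Ident \<C> ?Z \<boxdot>\<^bsub>\<M>\<^esub> unit_change N) \<cdot>\<^bsub>\<M>\<^esub> (unit_change (?C \<odot>\<^bsub>\<M>\<^esub> N) \<cdot>\<^bsub>\<M>\<^esub> hat_comult \<M> C N)"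
      using N by (simp add: hat_comult_def unit_change_def act.interchanges)
    finally show "hat_comult \<M> Z N \<cdot>\<^bsub>\<M>\<^esub> unit_change N = Fa (hat \<C> \<M> Z) (unit_change N) \<cdot>\<^bsub>\<M>\<^esub>
        unit_change (Fo (hat \<C> \<M> C) N) \<cdot>\<^bsub>\<M>\<^esub> hat_comult \<M> C N" by simp
    show "hat_counit \<M> Z N \<cdot>\<^bsub>\<M>\<^esub> unit_change N = hat_counit \<M> C N"
      using N Iota_free_counit by (simp add: hat_counit_def unit_change_def act.interchanges)
    have "Chi S ?Z N \<cdot>\<^bsub>\<M>\<^esub> Fa S (unit_change N) = (Fa T ?i \<boxdot>\<^bsub>\<M>\<^esub> Ident \<M> (Fo S N)) \<cdot>\<^bsub>\<M>\<^esub> Chi S ?C N"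
      using N Chi_nat[of ?i ?n ?Z N] by (simp add: unit_change_def)
    then show "Chi S ?C N = hopf_law N \<cdot>\<^bsub>\<M>\<^esub> Fa S (unit_change N)"
      using N by (simp add: hopf_law_def act.interchanges Mu_Iota_right unit_change_def)
  qed
qed

end

section \<open>Hopf modules\<close>

context hopf_module_setting
begin

sublocale K: comonad_change \<M> S "hat \<C> \<M> Z" "hat_comult \<M> Z" "hat_counit \<M> Z" hopf_law
    "hat \<C> \<M> C" "hat_comult \<M> C" "hat_counit \<M> C" unit_change "Chi S (Carr C)"
  by (rule hopf_comonad_change)

lemma comodule_cat_eq: "comodule_cat \<C> \<M> C = K.CC"
  unfolding comodule_cat_def K.G.coalgebra_cat_def is_comodule_def K.G.is_coalgebra_def is_comodule_map_def hat_simps ..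

text \<open>
  The compatibility condition for Hopf modules contains \<open>\<mu>\<^sub>C \<cdot> \<sigma>\<close>, which factors as \<open>(Z \<cdot> \<sigma>) (\<mu>\<^sub>C \<cdot> id)\<close>.
\<close>

lemma hopf_module_eq: "is_hopf_module \<C> T \<M> S C N \<sigma> \<zeta> \<longleftrightarrow> K.is_mixed_module N \<sigma> \<zeta>"
proof -
  have "(Mu T (Carr C) \<boxdot>\<^bsub>\<M>\<^esub> \<sigma>) \<cdot>\<^bsub>\<M>\<^esub> Chi S (Fo T (Carr C)) N \<cdot>\<^bsub>\<M>\<^esub> Fa S \<zeta> =
      Fa (hat \<C> \<M> Z) \<sigma> \<cdot>\<^bsub>\<M>\<^esub> hopf_law N \<cdot>\<^bsub>\<M>\<^esub> Fa S \<zeta>"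
    if "is_algebra \<M> S N \<sigma>" "K.H.is_coalgebra N \<zeta>"
    using is_algebra_simps(1-4)[OF that(1)] K.H.is_coalgebra_simps(1-4)[OF that(2)]
    by (simp add: hopf_law_def act.interchanges)
  then show ?thesis
    unfolding is_hopf_module_def K.is_mixed_module_def is_comodule_def K.H.is_coalgebra_def hat_simps by auto
qed

lemma hopf_cat_eq: "hopf_cat \<C> T \<M> S C = K.mixed_cat"
  unfolding hopf_cat_def K.mixed_cat_def hopf_module_eq is_comodule_map_def ..

lemma functor_A_eq: "functor_A S \<M> C = K.left_adjoint"
  unfolding functor_A_def K.left_adjoint_def ..

lemma B_pair_eq: "B_left \<C> T \<M> C = K.left_arrow" "B_right \<C> T \<M> C = K.right_arrow"
  by (simp_all add: B_left_def B_right_def K.left_arrow_def K.right_arrow_def cofree_comodule_def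
      unit_change_def hat_comult_def fun_eq_iff)

lemma B_equalizer_eq: "B_equalizer \<C> T \<M> C = K.equalizer_of"
  unfolding B_equalizer_def K.equalizer_of_def comodule_cat_eq B_pair_eq ..

lemma cofree_comodule_arrow: "Fa (cofree_comodule \<C> \<M> C) h = K.cofree_arrow h"
  by (simp add: cofree_comodule_def K.cofree_arrow_def)

lemma functor_B_eq: "functor_B \<C> T \<M> C = K.right_adjoint"
  unfolding functor_B_def K.right_adjoint_def comodule_cat_eq B_equalizer_eq cofree_comodule_arrow Let_def ..

lemma AB_unit_eq: "AB_unit \<C> T \<M> S C = K.adj_unit"
  unfolding AB_unit_def K.adj_unit_def comodule_cat_eq functor_A_eq functor_B_eq B_equalizer_eq Let_def
  by (simp add: cofree_comodule_def)

lemma AB_counit_eq: "AB_counit \<C> T \<M> S C = K.adj_counit"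
  unfolding AB_counit_def K.adj_counit_def functor_A_eq functor_B_eq B_equalizer_eq ..

lemma galois_map_eq: "galois_map \<C> T \<M> S (Carr C) N = K.galois (Fo S N) (Mu S N)"
  by (simp add: galois_map_def K.galois_def)

lemma B_equalizers_exist_eq: "B_equalizers_exist \<C> T \<M> S C \<longleftrightarrow> K.equalizers_exist"
  unfolding B_equalizers_exist_def K.equalizers_exist_def comodule_cat_eq hopf_cat_eq B_pair_eq ..

end

theorem theorem5p8:
  fixes \<C> :: "('o, 'a) moncat"
    and T :: "('o, 'a) bimonad"
    and \<M> :: "('o, 'a, 'p, 'b) modcat"
    and S :: "('o, 'p, 'b) comodule_monad"
    and C :: "('o, 'a) comonoid"
  assumes "monoidal_category \<C>"
    and "is_bimonad \<C> T"
    and "module_category \<C> \<M>"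
    and "is_comodule_monad \<C> T \<M> S"
    and "is_comonoid \<C> C"
    and equalizers_exist: "\<And>f g. coreflexive_pair \<M> f g \<Longrightarrow> monad_split_pair \<M> S f g \<Longrightarrow>
      \<exists>e. is_equalizer \<M> f g e"
    and hat_preserves: "\<And>f g. coreflexive_pair \<M> f g \<Longrightarrow> monad_split_pair \<M> S f g \<Longrightarrow>
      preserves_equalizers_of \<M> \<M> (hat \<C> \<M> C) f g"
    and hat2_preserves: "\<And>f g. coreflexive_pair \<M> f g \<Longrightarrow> monad_split_pair \<M> S f g \<Longrightarrow>
      preserves_equalizers_of \<M> \<M> (comp_func (hat \<C> \<M> C) (hat \<C> \<M> C)) f g"
    and S_preserves: "\<And>f g. coreflexive_pair \<M> f g \<Longrightarrow> monad_split_pair \<M> S f g \<Longrightarrow>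
      preserves_equalizers_of \<M> \<M> S f g"
    and S_conservative: "conservative \<M> \<M> S"
  shows "(B_equalizers_exist \<C> T \<M> S C \<and>
      adjoint_equivalence (comodule_cat \<C> \<M> C) (hopf_cat \<C> T \<M> S C)
        (functor_A S \<M> C) (functor_B \<C> T \<M> C)
        (AB_unit \<C> T \<M> S C) (AB_counit \<C> T \<M> S C))
    \<longleftrightarrow> (\<forall>N \<in> Obj \<M>. is_iso \<M> (galois_map \<C> T \<M> S (Carr C) N))"
proof -
  interpret hopf_module_setting \<C> T \<M> S C
    using assms(2,4,5) by (simp add: hopf_module_setting_def bimonad_comonoid_def)
  show ?thesis
    unfolding B_equalizers_exist_eq comodule_cat_eq hopf_cat_eq functor_A_eq functor_B_eq AB_unit_eq
      AB_counit_eq galois_map_eq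
    by (rule K.equivalence_iff_galois)
      (use equalizers_exist hat_preserves hat2_preserves S_preserves S_conservative in blast)+
qed

end
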